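(* Let $R$ be a commutative ring with identity and $W\subseteq R$ a multiplicatively closed set. Then: (1) An $R$-module $M$ is $W$-torsion free if and only if $\operatorname{to}_W(M)=0$. (2) An $R$-module $M$ is $W$-divisible if and only if $\operatorname{div}_W(M)=M$. (3) An $R$-module $M$ is $h_W$-divisible if and only if $\operatorname{tr}_{W^{-1}R}(M)=M$. (4) For any $R$-module $M$, $\operatorname{tr}_{W^{-1}R}(M)\subseteq\operatorname{div}_W(M)$. (5) $\operatorname{to}_W=\varinjlim_{w\in W}\operatorname{tr}_{R/(w)}$. (6) $\operatorname{div}_W$ is idempotent and functorial. (7) $\operatorname{to}_W$ is idempotent, functorial, and co-idempotent. (8) If $R$ is a complete local Noetherian ring and $M$ is Matlis-dualizable, then $\operatorname{div}_W(M)=\operatorname{tr}_{W^{-1}R}(M)$. (9) If $R$ is a complete local Noetherian ring, then when applied to Matlis-dualizable modules, $\operatorname{to}_W=\operatorname{div}_W^{\smile}$. (10) If $R$ is a complete local Noetherian ring and $M$ is Matlis-dualizable, then $\operatorname{div}_W(M)=\bigcap_{w\in W}wM$.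
   Context: An $R$-module $M$ is: $W$-torsion free if multiplication by each $w\in W$ is injective on $M$; $W$-divisible if multiplication by each $w\in W$ is surjective on $M$; $h_W$-divisible if there is a free $W^{-1}R$-module $N$ and a surjective $R$-linear map $N\to M$ (equivalently, the evaluation map $\operatorname{Hom}_R(W^{-1}R,M)\to M$, $f\mapsto f(1)$, is surjective). $\operatorname{to}_W(M)$ is the kernel of the localization map $M\to W^{-1}M$, i.e. $\{z\in M\mid wz=0\text{ for some }w\in W\}$. $\operatorname{div}_W(M)$ is the sum (equivalently the union) of the $W$-divisible submodules of $M$. For $R$-modules $L,N$, $\operatorname{tr}_L(N)=\sum_{f\in\operatorname{Hom}_R(L,N)}f(L)$. A submodule selector is an isomorphism-compatible assignment of a submodule $\alpha(M)\subseteq M$ to each module $M$ in a class closed under submodules and quotients. It is functorial if $g(\alpha(M))\subseteq\alpha(N)$ for every homomorphism $g:M\to N$; idempotent if $\alpha(\alpha(M))=\alpha(M)$; co-idempotent if $\alpha(M/\alpha(M))=0$. In (5), $W$ is directed by divisibility (if $w$ divides $w'$ then $\operatorname{tr}_{R/(w)}(M)\subseteq\operatorname{tr}_{R/(w')}(M)$), and $(\varinjlim_{w\in W}\operatorname{tr}_{R/(w)})(M)=\bigcup_{w\in W}\operatorname{tr}_{R/(w)}(M)$. For $R$ complete local Noetherian, let $E$ be the injective hull of the residue field and $(-)^\vee=\operatorname{Hom}_R(-,E)$. $M$ is Matlis-dualizable if the natural map $M\to M^{\vee\vee}$ is an isomorphism. The smile dual of a submodule selector $\alpha$ is $\alpha^{\smile}(M)=(M^\vee/\alpha(M^\vee))^\vee$,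 regarded as a submodule of $M\cong M^{\vee\vee}$ via the dual of the quotient map $M^\vee\to M^\vee/\alpha(M^\vee)$. *)

theory Defs
  imports "HOL-Algebra.Module" "HOL-Algebra.Ring_Divisibility" "HOL-Algebra.Ideal_Product"
begin

section \<open>Modules over a commutative ring\<close>

text \<open>The \<^typ>\<open>('r, 'm) module\<close> record of HOL-Algebra has ring multiplication fields that
  the locale \<^locale>\<open>module\<close> ignores; they are left \<^const>\<open>undefined\<close> where no
  multiplication is around.  Homomorphisms are extensional on the carrier, so that
  Hom-sets are again carriers of modules.\<close>

definition mod_hom ::
  "('r, 'x) ring_scheme \<Rightarrow> ('r, 'm) module \<Rightarrow> ('r, 'n) module \<Rightarrow> ('m \<Rightarrow> 'n) set" where
  "mod_hom R M N = {f \<in> carrier M \<rightarrow>\<^sub>E carrier N.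
     (\<forall>x\<in>carrier M. \<forall>y\<in>carrier M. f (x \<oplus>\<^bsub>M\<^esub> y) = f x \<oplus>\<^bsub>N\<^esub> f y) \<and>
     (\<forall>r\<in>carrier R. \<forall>x\<in>carrier M. f (r \<odot>\<^bsub>M\<^esub> x) = r \<odot>\<^bsub>N\<^esub> f x)}"

definition mod_iso ::
  "('r, 'x) ring_scheme \<Rightarrow> ('r, 'm) module \<Rightarrow> ('r, 'n) module \<Rightarrow> ('m \<Rightarrow> 'n) set" where
  "mod_iso R M N = {f \<in> mod_hom R M N. bij_betw f (carrier M) (carrier N)}"

definition hom_module ::
  "('r, 'x) ring_scheme \<Rightarrow> ('r, 'm) module \<Rightarrow> ('r, 'n) module \<Rightarrow> ('r, 'm \<Rightarrow> 'n) module" where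
  "hom_module R M N = \<lparr>carrier = mod_hom R M N, monoid.mult = undefined, one = undefined,
     zero = (\<lambda>x\<in>carrier M. \<zero>\<^bsub>N\<^esub>),
     add = (\<lambda>f g. \<lambda>x\<in>carrier M. f x \<oplus>\<^bsub>N\<^esub> g x),
     smult = (\<lambda>r f. \<lambda>x\<in>carrier M. r \<odot>\<^bsub>N\<^esub> f x)\<rparr>"

definition quot_module :: "('r, 'm) module \<Rightarrow> 'm set \<Rightarrow> ('r, 'm set) module" where
  "quot_module M H = \<lparr>carrier = a_rcosets\<^bsub>M\<^esub> H, monoid.mult = undefined, one = undefined,
     zero = H, add = set_add M, smult = (\<lambda>r X. \<Union>x\<in>X. H +>\<^bsub>M\<^esub> (r \<odot>\<^bsub>M\<^esub> x))\<rparr>"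

definition quot_map :: "('r, 'm) module \<Rightarrow> 'm set \<Rightarrow> 'm \<Rightarrow> 'm set" where
  "quot_map M H = (\<lambda>x\<in>carrier M. H +>\<^bsub>M\<^esub> x)"

definition regular_module :: "('r, 'x) ring_scheme \<Rightarrow> ('r, 'r) module" where
  "regular_module R = \<lparr>carrier = carrier R, monoid.mult = monoid.mult R, one = one R,
     zero = zero R, add = add R, smult = monoid.mult R\<rparr>"

definition restrict_scalars :: "('r \<Rightarrow> 's) \<Rightarrow> ('s, 'n) module \<Rightarrow> ('r, 'n) module" where
  "restrict_scalars \<phi> N = \<lparr>carrier = carrier N, monoid.mult = monoid.mult N, one = one N,
     zero = zero N, add = add N, smult = (\<lambda>r x. \<phi> r \<odot>\<^bsub>N\<^esub> x)\<rparr>"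

text \<open>The sum of a set of submodules: all finite sums of elements picked from them.\<close>

definition submodule_sum :: "('r, 'm) module \<Rightarrow> 'm set set \<Rightarrow> 'm set" where
  "submodule_sum M \<H> =
     {finsum M x \<F> |x \<F>. finite \<F> \<and> \<F> \<subseteq> \<H> \<and> (\<forall>H\<in>\<F>. x H \<in> H)}"

definition trace ::
  "('r, 'x) ring_scheme \<Rightarrow> ('r, 'l) module \<Rightarrow> ('r, 'n) module \<Rightarrow> 'n set" where
  "trace R L N = submodule_sum N ((\<lambda>f. f ` carrier L) ` mod_hom R L N)"

text \<open>Every element is a linear combination of basis elements with uniquely determined,
  almost everywhere zero, coefficients.\<close>

definition is_basis :: "('s, 'y) ring_scheme \<Rightarrow> ('s, 'n) module \<Rightarrow> 'n set \<Rightarrow> bool" where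
  "is_basis S N B \<longleftrightarrow> B \<subseteq> carrier N \<and>
     (\<forall>x\<in>carrier N. \<exists>!a. a \<in> B \<rightarrow>\<^sub>E carrier S \<and> finite {b \<in> B. a b \<noteq> \<zero>\<^bsub>S\<^esub>} \<and>
        x = (\<Oplus>\<^bsub>N\<^esub>b\<in>{b \<in> B. a b \<noteq> \<zero>\<^bsub>S\<^esub>}. a b \<odot>\<^bsub>N\<^esub> b))"

definition free_module :: "('s, 'y) ring_scheme \<Rightarrow> ('s, 'n) module \<Rightarrow> bool" where
  "free_module S N \<longleftrightarrow> module S N \<and> (\<exists>B. is_basis S N B)"


section \<open>Localization\<close>

text \<open>\<^term>\<open>loc_class R W M x w\<close> is the fraction \<open>x/w\<close>, i.e. the class of \<open>(x, w)\<close> under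
  \<open>(x, w) \<sim> (y, v) \<longleftrightarrow> (\<exists>u\<in>W. u v x = u w y)\<close>.  The unions below run over representatives;
  all members of such a union coincide.\<close>

definition loc_class ::
  "('r, 'x) ring_scheme \<Rightarrow> 'r set \<Rightarrow> ('r, 'm) module \<Rightarrow> 'm \<Rightarrow> 'r \<Rightarrow> ('m \<times> 'r) set" where
  "loc_class R W M x w = {(y, v) \<in> carrier M \<times> W.
     \<exists>u\<in>W. u \<odot>\<^bsub>M\<^esub> (v \<odot>\<^bsub>M\<^esub> x) = u \<odot>\<^bsub>M\<^esub> (w \<odot>\<^bsub>M\<^esub> y)}"

definition loc_module ::
  "('r, 'x) ring_scheme \<Rightarrow> 'r set \<Rightarrow> ('r, 'm) module \<Rightarrow> ('r, ('m \<times> 'r) set) module" where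
  "loc_module R W M = \<lparr>
     carrier = {loc_class R W M x w |x w. x \<in> carrier M \<and> w \<in> W},
     monoid.mult = undefined, one = undefined,
     zero = loc_class R W M \<zero>\<^bsub>M\<^esub> \<one>\<^bsub>R\<^esub>,
     add = (\<lambda>X Y. \<Union>(x, w)\<in>X. \<Union>(y, v)\<in>Y.
       loc_class R W M ((v \<odot>\<^bsub>M\<^esub> x) \<oplus>\<^bsub>M\<^esub> (w \<odot>\<^bsub>M\<^esub> y)) (w \<otimes>\<^bsub>R\<^esub> v)),
     smult = (\<lambda>r X. \<Union>(x, w)\<in>X. loc_class R W M (r \<odot>\<^bsub>M\<^esub> x) w)\<rparr>"

definition loc_map ::
  "('r, 'x) ring_scheme \<Rightarrow> 'r set \<Rightarrow> ('r, 'm) module \<Rightarrow> 'm \<Rightarrow> ('m \<times> 'r) set" where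
  "loc_map R W M = (\<lambda>x\<in>carrier M. loc_class R W M x \<one>\<^bsub>R\<^esub>)"

text \<open>\<open>W\<^sup>-\<^sup>1R\<close> as an \<open>R\<close>-module and as a ring.\<close>

definition loc_regular ::
  "('r, 'x) ring_scheme \<Rightarrow> 'r set \<Rightarrow> ('r, ('r \<times> 'r) set) module" where
  "loc_regular R W = loc_module R W (regular_module R)"

definition loc_ring :: "('r, 'x) ring_scheme \<Rightarrow> 'r set \<Rightarrow> ('r \<times> 'r) set ring" where
  "loc_ring R W = \<lparr>
     carrier = carrier (loc_regular R W),
     monoid.mult = (\<lambda>X Y. \<Union>(x, w)\<in>X. \<Union>(y, v)\<in>Y.
       loc_class R W (regular_module R) (x \<otimes>\<^bsub>R\<^esub> y) (w \<otimes>\<^bsub>R\<^esub> v)),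
     one = loc_class R W (regular_module R) \<one>\<^bsub>R\<^esub> \<one>\<^bsub>R\<^esub>,
     zero = zero (loc_regular R W),
     add = add (loc_regular R W)\<rparr>"


section \<open>Torsion and divisibility\<close>

definition W_torsion_free :: "'r set \<Rightarrow> ('r, 'm) module \<Rightarrow> bool" where
  "W_torsion_free W M \<longleftrightarrow> (\<forall>w\<in>W. inj_on (\<lambda>x. w \<odot>\<^bsub>M\<^esub> x) (carrier M))"

definition W_divisible :: "'r set \<Rightarrow> ('r, 'm) module \<Rightarrow> bool" where
  "W_divisible W M \<longleftrightarrow> (\<forall>w\<in>W. (\<lambda>x. w \<odot>\<^bsub>M\<^esub> x) ` carrier M = carrier M)"

text \<open>The quantifier over free \<open>W\<^sup>-\<^sup>1R\<close>-modules has to range over modules with carrier in one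
  type.  The type of (finitely supported) functions from \<open>M\<close> to \<open>W\<^sup>-\<^sup>1R\<close> is large enough:
  by lemma \<open>h_divisibleI\<close> below, a free module in any other type serves as well.\<close>

definition h_divisible ::
  "('r, 'x) ring_scheme \<Rightarrow> 'r set \<Rightarrow> ('r, 'm) module \<Rightarrow> bool" where
  "h_divisible R W M \<longleftrightarrow> (\<exists>N :: (('r \<times> 'r) set, 'm \<Rightarrow> ('r \<times> 'r) set) module.
     free_module (loc_ring R W) N \<and>
     (\<exists>g\<in>mod_hom R (restrict_scalars (loc_map R W (regular_module R)) N) M.
        g ` carrier N = carrier M))"

definition to_W :: "('r, 'x) ring_scheme \<Rightarrow> 'r set \<Rightarrow> ('r, 'm) module \<Rightarrow> 'm set" where
  "to_W R W M = a_kernel M (loc_module R W M) (loc_map R W M)"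

definition div_W :: "('r, 'x) ring_scheme \<Rightarrow> 'r set \<Rightarrow> ('r, 'm) module \<Rightarrow> 'm set" where
  "div_W R W M = submodule_sum M {D. submodule D R M \<and> W_divisible W (M\<lparr>carrier := D\<rparr>)}"

text \<open>The selector \<open>tr\<^bsub>R/(w)\<^esub>\<close>, and the direct limit of a family of selectors directed by
  inclusion.\<close>

definition cyclic_trace :: "('r, 'x) ring_scheme \<Rightarrow> 'r \<Rightarrow> ('r, 'm) module \<Rightarrow> 'm set" where
  "cyclic_trace R w = trace R (quot_module (regular_module R) (PIdl\<^bsub>R\<^esub> w))"

definition selector_lim ::
  "'i set \<Rightarrow> ('i \<Rightarrow> ('r, 'm) module \<Rightarrow> 'm set) \<Rightarrow> ('r, 'm) module \<Rightarrow> 'm set" where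
  "selector_lim I \<alpha> M = (\<Union>i\<in>I. \<alpha> i M)"


section \<open>Submodule selectors\<close>

text \<open>The class of modules is that of all \<open>R\<close>-modules.  A selector is a polymorphic constant
  here, so properties relating modules of different types take the instances of the selector
  at these types as separate arguments.\<close>

definition submodule_selector ::
  "('r, 'x) ring_scheme \<Rightarrow> (('r, 'm) module \<Rightarrow> 'm set) \<Rightarrow> (('r, 'n) module \<Rightarrow> 'n set) \<Rightarrow> bool"
  where
  "submodule_selector R \<alpha> \<alpha>' \<longleftrightarrow>
     (\<forall>M. module R M \<longrightarrow> submodule (\<alpha> M) R M) \<and>
     (\<forall>N. module R N \<longrightarrow> submodule (\<alpha>' N) R N) \<and>
     (\<forall>M N. module R M \<longrightarrow> module R N \<longrightarrow> (\<forall>g\<in>mod_iso R M N. g ` \<alpha> M = \<alpha>' N))"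

definition functorial_selector ::
  "('r, 'x) ring_scheme \<Rightarrow> (('r, 'm) module \<Rightarrow> 'm set) \<Rightarrow> (('r, 'n) module \<Rightarrow> 'n set) \<Rightarrow> bool"
  where
  "functorial_selector R \<alpha> \<alpha>' \<longleftrightarrow>
     (\<forall>M N. module R M \<longrightarrow> module R N \<longrightarrow> (\<forall>g\<in>mod_hom R M N. g ` \<alpha> M \<subseteq> \<alpha>' N))"

definition idempotent_selector :: "('r, 'x) ring_scheme \<Rightarrow> (('r, 'm) module \<Rightarrow> 'm set) \<Rightarrow> bool" where
  "idempotent_selector R \<alpha> \<longleftrightarrow> (\<forall>M. module R M \<longrightarrow> \<alpha> (M\<lparr>carrier := \<alpha> M\<rparr>) = \<alpha> M)"

definition co_idempotent_selector ::
  "('r, 'x) ring_scheme \<Rightarrow> (('r, 'm) module \<Rightarrow> 'm set) \<Rightarrow>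
   (('r, 'm set) module \<Rightarrow> 'm set set) \<Rightarrow> bool" where
  "co_idempotent_selector R \<alpha> \<alpha>' \<longleftrightarrow>
     (\<forall>M. module R M \<longrightarrow> \<alpha>' (quot_module M (\<alpha> M)) = {\<zero>\<^bsub>quot_module M (\<alpha> M)\<^esub>})"


section \<open>Complete local Noetherian rings and Matlis duality\<close>

definition local_ring :: "('r, 'x) ring_scheme \<Rightarrow> bool" where
  "local_ring R \<longleftrightarrow> cring R \<and> (\<exists>!\<mm>. maximalideal \<mm> R)"

definition max_ideal :: "('r, 'x) ring_scheme \<Rightarrow> 'r set" where
  "max_ideal R = (THE \<mm>. maximalideal \<mm> R)"

primrec ideal_power :: "('r, 'x) ring_scheme \<Rightarrow> 'r set \<Rightarrow> nat \<Rightarrow> 'r set" where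
  "ideal_power R I 0 = carrier R"
| "ideal_power R I (Suc n) = I \<cdot>\<^bsub>R\<^esub> ideal_power R I n"

text \<open>The inverse limit of the \<open>R/I\<^sup>n\<close>: the transition maps send a coset of \<open>I\<^sup>n\<^sup>+\<^sup>1\<close> to the coset
  of \<open>I\<^sup>n\<close> that contains it.\<close>

definition adic_limit :: "('r, 'x) ring_scheme \<Rightarrow> 'r set \<Rightarrow> (nat \<Rightarrow> 'r set) set" where
  "adic_limit R I = {X. \<forall>n. X n \<in> carrier (R Quot (ideal_power R I n)) \<and> X (Suc n) \<subseteq> X n}"

definition adic_complete :: "('r, 'x) ring_scheme \<Rightarrow> 'r set \<Rightarrow> bool" where
  "adic_complete R I \<longleftrightarrow>
     bij_betw (\<lambda>r n. ideal_power R I n +>\<^bsub>R\<^esub> r) (carrier R) (adic_limit R I)"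

definition complete_local_noetherian :: "('r, 'x) ring_scheme \<Rightarrow> bool" where
  "complete_local_noetherian R \<longleftrightarrow>
     local_ring R \<and> noetherian_ring R \<and> adic_complete R (max_ideal R)"

text \<open>Test objects for injectivity have carriers in the type of the ring.  By Baer's criterion
  this implies the extension property for test objects in arbitrary types, see lemma
  \<open>injective_module_extend\<close> below.\<close>

definition injective_module :: "('r, 'x) ring_scheme \<Rightarrow> ('r, 'e) module \<Rightarrow> bool" where
  "injective_module R E \<longleftrightarrow> module R E \<and>
     (\<forall>(A :: ('r, 'r) module) (B :: ('r, 'r) module). module R A \<longrightarrow> module R B \<longrightarrow>
        (\<forall>i\<in>mod_hom R A B. \<forall>f\<in>mod_hom R A E. inj_on i (carrier A) \<longrightarrow>
           (\<exists>h\<in>mod_hom R B E. \<forall>x\<in>carrier A. h (i x) = f x)))"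

definition essential_submodule ::
  "('r, 'x) ring_scheme \<Rightarrow> 'e set \<Rightarrow> ('r, 'e) module \<Rightarrow> bool" where
  "essential_submodule R H E \<longleftrightarrow> submodule H R E \<and>
     (\<forall>K. submodule K R E \<longrightarrow> H \<inter> K = {\<zero>\<^bsub>E\<^esub>} \<longrightarrow> K = {\<zero>\<^bsub>E\<^esub>})"

definition injective_hull ::
  "('r, 'x) ring_scheme \<Rightarrow> ('r, 'k) module \<Rightarrow> ('r, 'e) module \<Rightarrow> bool" where
  "injective_hull R K E \<longleftrightarrow> injective_module R E \<and>
     (\<exists>i\<in>mod_hom R K E. inj_on i (carrier K) \<and> essential_submodule R (i ` carrier K) E)"

definition residue_module :: "('r, 'x) ring_scheme \<Rightarrow> ('r, 'r set) module" where
  "residue_module R = quot_module (regular_module R) (max_ideal R)"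

definition matlis_dual ::
  "('r, 'x) ring_scheme \<Rightarrow> ('r, 'e) module \<Rightarrow> ('r, 'm) module \<Rightarrow> ('r, 'm \<Rightarrow> 'e) module" where
  "matlis_dual R E M = hom_module R M E"

definition matlis_dual_map ::
  "('r, 'x) ring_scheme \<Rightarrow> ('r, 'e) module \<Rightarrow> ('r, 'm) module \<Rightarrow> ('r, 'n) module \<Rightarrow>
   ('m \<Rightarrow> 'n) \<Rightarrow> ('n \<Rightarrow> 'e) \<Rightarrow> ('m \<Rightarrow> 'e)" where
  "matlis_dual_map R E M N g = (\<lambda>f\<in>carrier (matlis_dual R E N). compose (carrier M) f g)"

definition bidual_map ::
  "('r, 'x) ring_scheme \<Rightarrow> ('r, 'e) module \<Rightarrow> ('r, 'm) module \<Rightarrow> 'm \<Rightarrow> ('m \<Rightarrow> 'e) \<Rightarrow> 'e" where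
  "bidual_map R E M = (\<lambda>x\<in>carrier M. \<lambda>f\<in>carrier (matlis_dual R E M). f x)"

definition matlis_dualizable ::
  "('r, 'x) ring_scheme \<Rightarrow> ('r, 'e) module \<Rightarrow> ('r, 'm) module \<Rightarrow> bool" where
  "matlis_dualizable R E M \<longleftrightarrow> module R M \<and>
     bidual_map R E M \<in> mod_iso R M (matlis_dual R E (matlis_dual R E M))"

text \<open>For \<open>\<pi> : M\<^sup>\<or> \<rightarrow> M\<^sup>\<or>/\<alpha>(M\<^sup>\<or>)\<close> the quotient map, the image of
  \<open>\<pi>\<^sup>\<or> : (M\<^sup>\<or>/\<alpha>(M\<^sup>\<or>))\<^sup>\<or> \<rightarrow> M\<^sup>\<or>\<^sup>\<or>\<close> is transported to \<open>M\<close> along the natural map.\<close>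

definition smile_dual ::
  "('r, 'x) ring_scheme \<Rightarrow> ('r, 'e) module \<Rightarrow> (('r, 'm \<Rightarrow> 'e) module \<Rightarrow> ('m \<Rightarrow> 'e) set) \<Rightarrow>
   ('r, 'm) module \<Rightarrow> 'm set" where
  "smile_dual R E \<alpha> M =
     (let D = matlis_dual R E M; Q = quot_module D (\<alpha> D) in
      {x \<in> carrier M. bidual_map R E M x \<in>
         matlis_dual_map R E D Q (quot_map D (\<alpha> D)) ` carrier (matlis_dual R E Q)})"



section \<open>The constructions are modules and rings\<close>


lemma mod_homI:
  assumes "f \<in> carrier M \<rightarrow>\<^sub>E carrier N"
    and "\<And>x y. x \<in> carrier M \<Longrightarrow> y \<in> carrier M \<Longrightarrow> f (x \<oplus>\<^bsub>M\<^esub> y) = f x \<oplus>\<^bsub>N\<^esub> f y"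
    and "\<And>r x. r \<in> carrier R \<Longrightarrow> x \<in> carrier M \<Longrightarrow> f (r \<odot>\<^bsub>M\<^esub> x) = r \<odot>\<^bsub>N\<^esub> f x"
  shows "f \<in> mod_hom R M N"
  using assms by (auto simp: mod_hom_def)

lemma mod_homD:
  assumes "f \<in> mod_hom R M N"
  shows "f \<in> carrier M \<rightarrow>\<^sub>E carrier N"
    and "\<And>x. x \<in> carrier M \<Longrightarrow> f x \<in> carrier N"
    and "\<And>x y. x \<in> carrier M \<Longrightarrow> y \<in> carrier M \<Longrightarrow> f (x \<oplus>\<^bsub>M\<^esub> y) = f x \<oplus>\<^bsub>N\<^esub> f y"
    and "\<And>r x. r \<in> carrier R \<Longrightarrow> x \<in> carrier M \<Longrightarrow> f (r \<odot>\<^bsub>M\<^esub> x) = r \<odot>\<^bsub>N\<^esub> f x"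
  using assms by (auto simp: mod_hom_def)

lemma regular_module_simps [simp]:
  "carrier (regular_module R) = carrier R" "zero (regular_module R) = zero R"
  "add (regular_module R) = add R" "smult (regular_module R) = monoid.mult R"
  by (simp_all add: regular_module_def)

lemma regular_module_module:
  assumes "cring R"
  shows "module R (regular_module R)"
proof -
  interpret R: cring R by fact
  show ?thesis
  proof (rule moduleI)
    show "abelian_group (regular_module R)"
    proof (rule abelian_groupI)
      fix x assume "x \<in> carrier (regular_module R)"
      then show "\<exists>y\<in>carrier (regular_module R). y \<oplus>\<^bsub>regular_module R\<^esub> x = \<zero>\<^bsub>regular_module R\<^esub>"
        by (auto intro!: bexI[of _ "\<ominus>\<^bsub>R\<^esub> x"] simp: R.l_neg)
    qed (auto simp: R.a_ac)
  qed (auto simp: R.l_distr R.r_distr R.m_assoc R.cring_axioms)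
qed

lemma submodule_regular_ideal:
  assumes "ideal I R" "cring R"
  shows "submodule I R (regular_module R)"
proof -
  interpret ideal I R by fact
  interpret M: module R "regular_module R" by (rule regular_module_module) fact
  show ?thesis
  proof (rule M.submoduleI)
    fix a assume a: "a \<in> I"
    then have "\<ominus>\<^bsub>regular_module R\<^esub> a = \<ominus>\<^bsub>R\<^esub> a"
      using Icarr[OF a] by (intro M.minus_equality) (auto simp: l_neg)
    then show "\<ominus>\<^bsub>regular_module R\<^esub> a \<in> I" using a by simp
  qed (auto simp: I_l_closed Icarr)
qed

locale localization = M: module R M + W: submonoid W R for R (structure) and M :: "('a, 'c) module" (structure) and W
begin

abbreviation cl where "cl \<equiv> loc_class R W M"

lemma Wc [simp]: "w \<in> W \<Longrightarrow> w \<in> carrier R" using W.subset by auto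

lemma class_self: "x \<in> carrier M \<Longrightarrow> w \<in> W \<Longrightarrow> (x, w) \<in> cl x w"
  by (auto simp: loc_class_def intro!: bexI[of _ \<one>])

lemma sm: "a \<in> carrier R \<Longrightarrow> b \<in> carrier R \<Longrightarrow> x \<in> carrier M \<Longrightarrow> a \<odot>\<^bsub>M\<^esub> (b \<odot>\<^bsub>M\<^esub> x) = (a \<otimes> b) \<odot>\<^bsub>M\<^esub> x"
  by (simp add: M.smult_assoc1)

lemma class_eqI:
  assumes "x \<in> carrier M" "w \<in> W" "y \<in> carrier M" "v \<in> W" "u \<in> W" "(u \<otimes> v) \<odot>\<^bsub>M\<^esub> x = (u \<otimes> w) \<odot>\<^bsub>M\<^esub> y"
  shows "cl x w = cl y v"
proof -
  have aux: "cl x w \<subseteq> cl y v"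
    if h: "x \<in> carrier M" "w \<in> W" "y \<in> carrier M" "v \<in> W" "u \<in> W" "(u \<otimes> v) \<odot>\<^bsub>M\<^esub> x = (u \<otimes> w) \<odot>\<^bsub>M\<^esub> y" for x w y v
  proof clarify
    fix z t assume "(z, t) \<in> cl x w"
    then have z: "z \<in> carrier M" "t \<in> W"
      and "\<exists>s\<in>W. s \<odot>\<^bsub>M\<^esub> (t \<odot>\<^bsub>M\<^esub> x) = s \<odot>\<^bsub>M\<^esub> (w \<odot>\<^bsub>M\<^esub> z)"
      by (simp_all add: loc_class_def)
    then obtain s where "s \<in> W" "s \<odot>\<^bsub>M\<^esub> (t \<odot>\<^bsub>M\<^esub> x) = s \<odot>\<^bsub>M\<^esub> (w \<odot>\<^bsub>M\<^esub> z)" by (elim bexE)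
    with z have s: "z \<in> carrier M" "t \<in> W" "s \<in> W" "(s \<otimes> t) \<odot>\<^bsub>M\<^esub> x = (s \<otimes> w) \<odot>\<^bsub>M\<^esub> z"
      using h(1,2) by (simp_all add: sm)
    have "(u \<otimes> s \<otimes> w) \<odot>\<^bsub>M\<^esub> (t \<odot>\<^bsub>M\<^esub> y) = (s \<otimes> t) \<odot>\<^bsub>M\<^esub> ((u \<otimes> w) \<odot>\<^bsub>M\<^esub> y)"
      using h(1-5) s(1-3) by (simp add: sm M.R.m_ac)
    also have "\<dots> = (u \<otimes> v) \<odot>\<^bsub>M\<^esub> ((s \<otimes> t) \<odot>\<^bsub>M\<^esub> x)"
      unfolding h(6)[symmetric] using h(1-5) s(1-3) by (simp add: sm M.R.m_ac)
    also have "\<dots> = (u \<otimes> s \<otimes> w) \<odot>\<^bsub>M\<^esub> (v \<odot>\<^bsub>M\<^esub> z)" using h(1-5) s(1-3)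
      by (subst s(4)) (simp add: sm M.R.m_ac)
    finally have "(u \<otimes> s \<otimes> w) \<odot>\<^bsub>M\<^esub> (t \<odot>\<^bsub>M\<^esub> y) = (u \<otimes> s \<otimes> w) \<odot>\<^bsub>M\<^esub> (v \<odot>\<^bsub>M\<^esub> z)" .
    moreover have "u \<otimes> s \<otimes> w \<in> W" using h(2,5) s(3) by simp
    ultimately show "(z, t) \<in> cl y v" using s(1,2) unfolding loc_class_def by blast
  qed
  show ?thesis using aux[OF assms] aux[OF assms(3,4,1,2,5) assms(6)[symmetric]] by (rule equalityI)
qed

lemma class_memD:
  assumes "(y, v) \<in> cl x w" "x \<in> carrier M" "w \<in> W"
  shows "y \<in> carrier M" "v \<in> W" "cl y v = cl x w"
    "\<exists>u\<in>W. (u \<otimes> v) \<odot>\<^bsub>M\<^esub> x = (u \<otimes> w) \<odot>\<^bsub>M\<^esub> y"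
proof -
  have y: "y \<in> carrier M" "v \<in> W" and "\<exists>u\<in>W. u \<odot>\<^bsub>M\<^esub> (v \<odot>\<^bsub>M\<^esub> x) = u \<odot>\<^bsub>M\<^esub> (w \<odot>\<^bsub>M\<^esub> y)"
    using assms(1) by (simp_all add: loc_class_def)
  then obtain u where "u \<in> W" "u \<odot>\<^bsub>M\<^esub> (v \<odot>\<^bsub>M\<^esub> x) = u \<odot>\<^bsub>M\<^esub> (w \<odot>\<^bsub>M\<^esub> y)" by (elim bexE)
  with y have u: "y \<in> carrier M" "v \<in> W" "u \<in> W" "(u \<otimes> v) \<odot>\<^bsub>M\<^esub> x = (u \<otimes> w) \<odot>\<^bsub>M\<^esub> y"
    using assms(2,3) by (simp_all add: sm)
  then show "y \<in> carrier M" "v \<in> W" "\<exists>u\<in>W. (u \<otimes> v) \<odot>\<^bsub>M\<^esub> x = (u \<otimes> w) \<odot>\<^bsub>M\<^esub> y" by blast+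
  show "cl y v = cl x w" by (rule class_eqI[OF assms(2,3) u, symmetric])
qed

lemma add_class:
  assumes x: "x \<in> carrier M" "w \<in> W" and y: "y \<in> carrier M" "v \<in> W"
  shows "cl x w \<oplus>\<^bsub>loc_module R W M\<^esub> cl y v = cl ((v \<odot>\<^bsub>M\<^esub> x) \<oplus>\<^bsub>M\<^esub> (w \<odot>\<^bsub>M\<^esub> y)) (w \<otimes> v)"
proof -
  have "cl ((v' \<odot>\<^bsub>M\<^esub> x') \<oplus>\<^bsub>M\<^esub> (w' \<odot>\<^bsub>M\<^esub> y')) (w' \<otimes> v') = cl ((v \<odot>\<^bsub>M\<^esub> x) \<oplus>\<^bsub>M\<^esub> (w \<odot>\<^bsub>M\<^esub> y)) (w \<otimes> v)"
    if "(x', w') \<in> cl x w" "(y', v') \<in> cl y v" for x' w' y' v'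
  proof -
    note a = class_memD[OF that(1) x] and b = class_memD[OF that(2) y]
    obtain s where s: "s \<in> W" "(s \<otimes> w') \<odot>\<^bsub>M\<^esub> x = (s \<otimes> w) \<odot>\<^bsub>M\<^esub> x'" using a by auto
    obtain t where t: "t \<in> W" "(t \<otimes> v') \<odot>\<^bsub>M\<^esub> y = (t \<otimes> v) \<odot>\<^bsub>M\<^esub> y'" using b by auto
    have 1: "((s \<otimes> t) \<otimes> (w \<otimes> v) \<otimes> v') \<odot>\<^bsub>M\<^esub> x' = ((s \<otimes> t) \<otimes> (w' \<otimes> v') \<otimes> v) \<odot>\<^bsub>M\<^esub> x"
    proof -
      have "((s \<otimes> t) \<otimes> (w \<otimes> v) \<otimes> v') \<odot>\<^bsub>M\<^esub> x' = (t \<otimes> v \<otimes> v') \<odot>\<^bsub>M\<^esub> ((s \<otimes> w) \<odot>\<^bsub>M\<^esub> x')"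
        using a(1,2) b(1,2) s(1) t(1) x y by (simp add: sm M.R.m_ac)
      also have "\<dots> = ((s \<otimes> t) \<otimes> (w' \<otimes> v') \<otimes> v) \<odot>\<^bsub>M\<^esub> x"
        unfolding s(2)[symmetric] using a(1,2) b(1,2) s(1) t(1) x y by (simp add: sm M.R.m_ac)
      finally show ?thesis .
    qed
    have 2: "((s \<otimes> t) \<otimes> (w \<otimes> v) \<otimes> w') \<odot>\<^bsub>M\<^esub> y' = ((s \<otimes> t) \<otimes> (w' \<otimes> v') \<otimes> w) \<odot>\<^bsub>M\<^esub> y"
    proof -
      have "((s \<otimes> t) \<otimes> (w \<otimes> v) \<otimes> w') \<odot>\<^bsub>M\<^esub> y' = (s \<otimes> w \<otimes> w') \<odot>\<^bsub>M\<^esub> ((t \<otimes> v) \<odot>\<^bsub>M\<^esub> y')"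
        using a(1,2) b(1,2) s(1) t(1) x y by (simp add: sm M.R.m_ac)
      also have "\<dots> = ((s \<otimes> t) \<otimes> (w' \<otimes> v') \<otimes> w) \<odot>\<^bsub>M\<^esub> y"
        unfolding t(2)[symmetric] using a(1,2) b(1,2) s(1) t(1) x y by (simp add: sm M.R.m_ac)
      finally show ?thesis .
    qed
    show ?thesis
    proof (rule class_eqI[where u = "s \<otimes> t"])
      show "(s \<otimes> t \<otimes> (w \<otimes> v)) \<odot>\<^bsub>M\<^esub> (v' \<odot>\<^bsub>M\<^esub> x' \<oplus>\<^bsub>M\<^esub> w' \<odot>\<^bsub>M\<^esub> y') =
            (s \<otimes> t \<otimes> (w' \<otimes> v')) \<odot>\<^bsub>M\<^esub> (v \<odot>\<^bsub>M\<^esub> x \<oplus>\<^bsub>M\<^esub> w \<odot>\<^bsub>M\<^esub> y)"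
        using 1 2 a(1,2) b(1,2) s(1) t(1) x y by (simp add: M.smult_r_distr sm)
    qed (use a(1,2) b(1,2) s(1) t(1) x y in auto)
  qed
  then have "(\<Union>(x', w')\<in>cl x w. \<Union>(y', v')\<in>cl y v. cl ((v' \<odot>\<^bsub>M\<^esub> x') \<oplus>\<^bsub>M\<^esub> (w' \<odot>\<^bsub>M\<^esub> y')) (w' \<otimes> v')) =
     (\<Union>p\<in>cl x w. \<Union>q\<in>cl y v. cl ((v \<odot>\<^bsub>M\<^esub> x) \<oplus>\<^bsub>M\<^esub> (w \<odot>\<^bsub>M\<^esub> y)) (w \<otimes> v))"
    by (intro SUP_cong refl) (auto intro!: SUP_cong)
  also have "\<dots> = cl ((v \<odot>\<^bsub>M\<^esub> x) \<oplus>\<^bsub>M\<^esub> (w \<odot>\<^bsub>M\<^esub> y)) (w \<otimes> v)"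
    using class_self[OF x] class_self[OF y] by auto
  finally show ?thesis by (simp add: loc_module_def)
qed

lemma smult_class:
  assumes x: "x \<in> carrier M" "w \<in> W" and r: "r \<in> carrier R"
  shows "r \<odot>\<^bsub>loc_module R W M\<^esub> cl x w = cl (r \<odot>\<^bsub>M\<^esub> x) w"
proof -
  have "cl (r \<odot>\<^bsub>M\<^esub> x') w' = cl (r \<odot>\<^bsub>M\<^esub> x) w" if "(x', w') \<in> cl x w" for x' w'
  proof -
    note a = class_memD[OF that x]
    obtain s where s: "s \<in> W" "(s \<otimes> w') \<odot>\<^bsub>M\<^esub> x = (s \<otimes> w) \<odot>\<^bsub>M\<^esub> x'" using a by auto
    have "(s \<otimes> w) \<odot>\<^bsub>M\<^esub> (r \<odot>\<^bsub>M\<^esub> x') = r \<odot>\<^bsub>M\<^esub> ((s \<otimes> w) \<odot>\<^bsub>M\<^esub> x')"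
      using a(1,2) s(1) x r by (simp add: sm M.R.m_ac)
    also have "\<dots> = (s \<otimes> w') \<odot>\<^bsub>M\<^esub> (r \<odot>\<^bsub>M\<^esub> x)"
      unfolding s(2)[symmetric] using a(1,2) s(1) x r by (simp add: sm M.R.m_ac)
    finally show ?thesis using a(1,2) s(1) x r by (intro class_eqI[where u = s]) auto
  qed
  then have "(\<Union>(x', w')\<in>cl x w. cl (r \<odot>\<^bsub>M\<^esub> x') w') = (\<Union>p\<in>cl x w. cl (r \<odot>\<^bsub>M\<^esub> x) w)"
    by (intro SUP_cong refl) auto
  also have "\<dots> = cl (r \<odot>\<^bsub>M\<^esub> x) w" using class_self[OF x] by auto
  finally show ?thesis by (simp add: loc_module_def)
qed

lemma zero_class: "\<zero>\<^bsub>loc_module R W M\<^esub> = cl \<zero>\<^bsub>M\<^esub> \<one>" by (simp add: loc_module_def)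

lemma carrierE: assumes "X \<in> carrier (loc_module R W M)"
  obtains x w where "x \<in> carrier M" "w \<in> W" "X = cl x w"
  using assms by (auto simp: loc_module_def)

lemma carrierI: "x \<in> carrier M \<Longrightarrow> w \<in> W \<Longrightarrow> cl x w \<in> carrier (loc_module R W M)"
  by (auto simp: loc_module_def)

lemma loc_module_module: "module R (loc_module R W M)"
proof (rule moduleI)
  let ?L = "loc_module R W M"
  show "cring R" by (rule M.R.cring_axioms)
  show "abelian_group ?L"
  proof (rule abelian_groupI)
    fix X Y Z assume X: "X \<in> carrier ?L" and Y: "Y \<in> carrier ?L" and Z: "Z \<in> carrier ?L"
    obtain x w where x: "x \<in> carrier M" "w \<in> W" "X = cl x w" using carrierE[OF X] .
    obtain y v where y: "y \<in> carrier M" "v \<in> W" "Y = cl y v" using carrierE[OF Y] .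
    obtain z u where z: "z \<in> carrier M" "u \<in> W" "Z = cl z u" using carrierE[OF Z] .
    show "X \<oplus>\<^bsub>?L\<^esub> Y \<oplus>\<^bsub>?L\<^esub> Z = X \<oplus>\<^bsub>?L\<^esub> (Y \<oplus>\<^bsub>?L\<^esub> Z)"
      using x y z by (simp add: add_class M.smult_r_distr sm M.R.m_ac M.M.a_ac)
  next
    fix X Y assume X: "X \<in> carrier ?L" and Y: "Y \<in> carrier ?L"
    obtain x w where x: "x \<in> carrier M" "w \<in> W" "X = cl x w" using carrierE[OF X] .
    obtain y v where y: "y \<in> carrier M" "v \<in> W" "Y = cl y v" using carrierE[OF Y] .
    show "X \<oplus>\<^bsub>?L\<^esub> Y \<in> carrier ?L" using x y by (simp add: add_class carrierI)
    show "X \<oplus>\<^bsub>?L\<^esub> Y = Y \<oplus>\<^bsub>?L\<^esub> X" using x y by (simp add: add_class M.R.m_ac M.M.a_ac)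
  next
    show "\<zero>\<^bsub>?L\<^esub> \<in> carrier ?L" by (simp add: zero_class carrierI)
    fix X assume X: "X \<in> carrier ?L"
    obtain x w where x: "x \<in> carrier M" "w \<in> W" "X = cl x w" using carrierE[OF X] .
    show "\<zero>\<^bsub>?L\<^esub> \<oplus>\<^bsub>?L\<^esub> X = X" using x by (simp add: zero_class add_class)
    have "cl (\<ominus>\<^bsub>M\<^esub> x) w \<oplus>\<^bsub>?L\<^esub> X = \<zero>\<^bsub>?L\<^esub>"
      using x by (simp add: add_class zero_class M.smult_r_minus M.M.l_neg)
         (rule class_eqI[where u = \<one>], auto)
    then show "\<exists>Y\<in>carrier ?L. Y \<oplus>\<^bsub>?L\<^esub> X = \<zero>\<^bsub>?L\<^esub>" using x carrierI[of "\<ominus>\<^bsub>M\<^esub> x" w] by auto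
  qed
next
  let ?L = "loc_module R W M"
  show "a \<odot>\<^bsub>?L\<^esub> X \<in> carrier ?L" if a: "a \<in> carrier R" and X: "X \<in> carrier ?L" for a X
    using carrierE[OF X] a by (metis smult_class carrierI M.smult_closed)
  show "(a \<oplus> b) \<odot>\<^bsub>?L\<^esub> X = a \<odot>\<^bsub>?L\<^esub> X \<oplus>\<^bsub>?L\<^esub> b \<odot>\<^bsub>?L\<^esub> X"
    if ab: "a \<in> carrier R" "b \<in> carrier R" and X: "X \<in> carrier ?L" for a b X
  proof -
    obtain x w where x: "x \<in> carrier M" "w \<in> W" "X = cl x w" using carrierE[OF X] .
    show ?thesis using x ab by (simp add: smult_class add_class)
      (rule class_eqI[where u = \<one>], auto simp: M.smult_l_distr M.smult_r_distr sm M.R.m_ac)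
  qed
  show "a \<odot>\<^bsub>?L\<^esub> (X \<oplus>\<^bsub>?L\<^esub> Y) = a \<odot>\<^bsub>?L\<^esub> X \<oplus>\<^bsub>?L\<^esub> a \<odot>\<^bsub>?L\<^esub> Y"
    if a: "a \<in> carrier R" and X: "X \<in> carrier ?L" and Y: "Y \<in> carrier ?L" for a X Y
  proof -
    obtain x w where x: "x \<in> carrier M" "w \<in> W" "X = cl x w" using carrierE[OF X] .
    obtain y v where y: "y \<in> carrier M" "v \<in> W" "Y = cl y v" using carrierE[OF Y] .
    show ?thesis using x y a by (simp add: smult_class add_class M.smult_r_distr sm M.R.m_ac)
  qed
  show "(a \<otimes> b) \<odot>\<^bsub>?L\<^esub> X = a \<odot>\<^bsub>?L\<^esub> (b \<odot>\<^bsub>?L\<^esub> X)"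
    if ab: "a \<in> carrier R" "b \<in> carrier R" and X: "X \<in> carrier ?L" for a b X
  proof -
    obtain x w where x: "x \<in> carrier M" "w \<in> W" "X = cl x w" using carrierE[OF X] .
    show ?thesis using x ab by (simp add: smult_class sm)
  qed
  show "\<one> \<odot>\<^bsub>?L\<^esub> X = X" if X: "X \<in> carrier ?L" for X
  proof -
    obtain x w where x: "x \<in> carrier M" "w \<in> W" "X = cl x w" using carrierE[OF X] .
    show ?thesis using x by (simp add: smult_class)
  qed
qed

lemma to_W_eq: "to_W R W M = {z \<in> carrier M. \<exists>w\<in>W. w \<odot>\<^bsub>M\<^esub> z = \<zero>\<^bsub>M\<^esub>}"
proof -
  have "cl z \<one> = cl \<zero>\<^bsub>M\<^esub> \<one> \<longleftrightarrow> (\<exists>w\<in>W. w \<odot>\<^bsub>M\<^esub> z = \<zero>\<^bsub>M\<^esub>)" if z: "z \<in> carrier M" for z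
  proof
    assume "cl z \<one> = cl \<zero>\<^bsub>M\<^esub> \<one>"
    then have "(\<zero>\<^bsub>M\<^esub>, \<one>) \<in> cl z \<one>" using class_self[of "\<zero>\<^bsub>M\<^esub>" \<one>] by simp
    then show "\<exists>w\<in>W. w \<odot>\<^bsub>M\<^esub> z = \<zero>\<^bsub>M\<^esub>" using z by (auto simp: loc_class_def)
  next
    assume "\<exists>w\<in>W. w \<odot>\<^bsub>M\<^esub> z = \<zero>\<^bsub>M\<^esub>"
    then obtain w where "w \<in> W" "w \<odot>\<^bsub>M\<^esub> z = \<zero>\<^bsub>M\<^esub>" by blast
    then show "cl z \<one> = cl \<zero>\<^bsub>M\<^esub> \<one>" using z by (intro class_eqI[where u = w]) auto
  qed
  then show ?thesis
    by (auto simp: to_W_def a_kernel_def kernel_def loc_map_def loc_module_def)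
qed

end

lemma loc_ring_cring:
  assumes "cring R" "submonoid W R"
  shows "cring (loc_ring R W)"
proof -
  interpret R: cring R by fact
  interpret L: localization R "regular_module R" W
    using assms by (simp add: localization_def regular_module_module)
  interpret LM: module R "loc_module R W (regular_module R)" by (rule L.loc_module_module)
  let ?S = "loc_ring R W"
  have mult: "L.cl x w \<otimes>\<^bsub>?S\<^esub> L.cl y v = L.cl (x \<otimes>\<^bsub>R\<^esub> y) (w \<otimes>\<^bsub>R\<^esub> v)"
    if x: "x \<in> carrier R" "w \<in> W" and y: "y \<in> carrier R" "v \<in> W" for x w y v
  proof -
    have "L.cl (x' \<otimes>\<^bsub>R\<^esub> y') (w' \<otimes>\<^bsub>R\<^esub> v') = L.cl (x \<otimes>\<^bsub>R\<^esub> y) (w \<otimes>\<^bsub>R\<^esub> v)"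
      if "(x', w') \<in> L.cl x w" "(y', v') \<in> L.cl y v" for x' w' y' v'
    proof -
      note p = that
      have a: "x' \<in> carrier R" "w' \<in> W" using L.class_memD(1,2)[OF that(1)] x by simp_all
      have b: "y' \<in> carrier R" "v' \<in> W" using L.class_memD(1,2)[OF that(2)] y by simp_all
      obtain s where s: "s \<in> W" "(s \<otimes>\<^bsub>R\<^esub> w') \<otimes>\<^bsub>R\<^esub> x = (s \<otimes>\<^bsub>R\<^esub> w) \<otimes>\<^bsub>R\<^esub> x'" using L.class_memD(4)[OF p(1)] x by (simp, elim bexE) blast
      obtain t where t: "t \<in> W" "(t \<otimes>\<^bsub>R\<^esub> v') \<otimes>\<^bsub>R\<^esub> y = (t \<otimes>\<^bsub>R\<^esub> v) \<otimes>\<^bsub>R\<^esub> y'" using L.class_memD(4)[OF p(2)] y by (simp, elim bexE) blast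
      note c = a b s(1) t(1) x y
      have "((s \<otimes>\<^bsub>R\<^esub> t) \<otimes>\<^bsub>R\<^esub> (w \<otimes>\<^bsub>R\<^esub> v)) \<otimes>\<^bsub>R\<^esub> (x' \<otimes>\<^bsub>R\<^esub> y') = ((s \<otimes>\<^bsub>R\<^esub> w) \<otimes>\<^bsub>R\<^esub> x') \<otimes>\<^bsub>R\<^esub> ((t \<otimes>\<^bsub>R\<^esub> v) \<otimes>\<^bsub>R\<^esub> y')"
        using c by (simp add: R.m_ac)
      also have "\<dots> = ((s \<otimes>\<^bsub>R\<^esub> t) \<otimes>\<^bsub>R\<^esub> (w' \<otimes>\<^bsub>R\<^esub> v')) \<otimes>\<^bsub>R\<^esub> (x \<otimes>\<^bsub>R\<^esub> y)"
        unfolding s(2)[symmetric] t(2)[symmetric] using c by (simp add: R.m_ac)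
      finally show ?thesis using c by (intro L.class_eqI[where u = "s \<otimes>\<^bsub>R\<^esub> t"]) auto
    qed
    then have "(\<Union>(x', w')\<in>L.cl x w. \<Union>(y', v')\<in>L.cl y v. L.cl (x' \<otimes>\<^bsub>R\<^esub> y') (w' \<otimes>\<^bsub>R\<^esub> v')) =
       (\<Union>p\<in>L.cl x w. \<Union>q\<in>L.cl y v. L.cl (x \<otimes>\<^bsub>R\<^esub> y) (w \<otimes>\<^bsub>R\<^esub> v))"
      by (intro SUP_cong refl) (auto intro!: SUP_cong)
    also have "\<dots> = L.cl (x \<otimes>\<^bsub>R\<^esub> y) (w \<otimes>\<^bsub>R\<^esub> v)"
      using L.class_self[of x w] L.class_self[of y v] x y by auto
    finally show ?thesis by (simp add: loc_ring_def)
  qed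
  have car: "carrier ?S = carrier (loc_module R W (regular_module R))"
    and add: "add ?S = add (loc_module R W (regular_module R))"
    and zero: "zero ?S = zero (loc_module R W (regular_module R))"
    and one: "one ?S = L.cl \<one>\<^bsub>R\<^esub> \<one>\<^bsub>R\<^esub>"
    by (simp_all add: loc_ring_def loc_regular_def)
  have cI: "L.cl x w \<in> carrier ?S" if "x \<in> carrier R" "w \<in> W" for x w
    using L.carrierI[of x w] that by (simp add: car)
  have cE: "\<exists>x w. x \<in> carrier R \<and> w \<in> W \<and> X = L.cl x w" if "X \<in> carrier ?S" for X
    using that by (auto simp: car loc_module_def)
  show ?thesis
  proof (rule cringI)
    show "abelian_group ?S"
      by (rule abelian_groupI) (use LM.M.l_neg in \<open>simp_all add: car add zero LM.M.a_ac\<close>)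
    show "comm_monoid ?S"
    proof (rule comm_monoidI)
      fix X Y Z assume "X \<in> carrier ?S" "Y \<in> carrier ?S" "Z \<in> carrier ?S"
      note XYZ = this[THEN cE]
      obtain x w where "x \<in> carrier R" "w \<in> W" "X = L.cl x w" using XYZ(1) by blast
      moreover obtain y v where "y \<in> carrier R" "v \<in> W" "Y = L.cl y v" using XYZ(2) by blast
      moreover obtain z u where "z \<in> carrier R" "u \<in> W" "Z = L.cl z u" using XYZ(3) by blast
      ultimately show "X \<otimes>\<^bsub>?S\<^esub> Y \<otimes>\<^bsub>?S\<^esub> Z = X \<otimes>\<^bsub>?S\<^esub> (Y \<otimes>\<^bsub>?S\<^esub> Z)"
        by (simp add: mult R.m_ac)
    next
      fix X Y assume "X \<in> carrier ?S" "Y \<in> carrier ?S"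
      note XY = this[THEN cE]
      obtain x w where "x \<in> carrier R" "w \<in> W" "X = L.cl x w" using XY(1) by blast
      moreover obtain y v where "y \<in> carrier R" "v \<in> W" "Y = L.cl y v" using XY(2) by blast
      ultimately show "X \<otimes>\<^bsub>?S\<^esub> Y \<in> carrier ?S" "X \<otimes>\<^bsub>?S\<^esub> Y = Y \<otimes>\<^bsub>?S\<^esub> X" by (simp_all add: mult cI R.m_ac)
    next
      fix X assume "X \<in> carrier ?S"
      then obtain x w where "x \<in> carrier R" "w \<in> W" "X = L.cl x w" by (meson cE)
      then show "\<one>\<^bsub>?S\<^esub> \<otimes>\<^bsub>?S\<^esub> X = X" by (simp add: mult one)
    qed (simp add: one cI)
    fix X Y Z assume "X \<in> carrier ?S" "Y \<in> carrier ?S" "Z \<in> carrier ?S"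
    note XYZ = this[THEN cE]
    obtain x w where "x \<in> carrier R" "w \<in> W" "X = L.cl x w" using XYZ(1) by blast
    moreover obtain y v where "y \<in> carrier R" "v \<in> W" "Y = L.cl y v" using XYZ(2) by blast
    moreover obtain z u where "z \<in> carrier R" "u \<in> W" "Z = L.cl z u" using XYZ(3) by blast
    ultimately show "(X \<oplus>\<^bsub>?S\<^esub> Y) \<otimes>\<^bsub>?S\<^esub> Z = X \<otimes>\<^bsub>?S\<^esub> Z \<oplus>\<^bsub>?S\<^esub> Y \<otimes>\<^bsub>?S\<^esub> Z"
      by (simp add: add L.add_class mult)
        (rule L.class_eqI[where u = "\<one>\<^bsub>R\<^esub>"], auto simp: R.l_distr R.r_distr R.m_ac)
  qed
qed

lemma quot_module_module:
  assumes "module R M" "submodule H R M"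
  shows "module R (quot_module M H)"
proof -
  interpret M: module R M by fact
  interpret S: submodule H R M by fact
  interpret A: abelian_subgroup H M
    by (rule abelian_subgroupI3) (unfold_locales)
  have H: "H \<subseteq> carrier M" by (rule M.submoduleE(1)[OF assms(2)])
  have sm: "r \<odot>\<^bsub>quot_module M H\<^esub> (H +>\<^bsub>M\<^esub> x) = H +>\<^bsub>M\<^esub> (r \<odot>\<^bsub>M\<^esub> x)"
    if r: "r \<in> carrier R" and x: "x \<in> carrier M" for r x
  proof -
    have "H +>\<^bsub>M\<^esub> (r \<odot>\<^bsub>M\<^esub> y) = H +>\<^bsub>M\<^esub> (r \<odot>\<^bsub>M\<^esub> x)" if y: "y \<in> H +>\<^bsub>M\<^esub> x" for y
    proof -
      obtain h where h: "h \<in> H" "y = h \<oplus>\<^bsub>M\<^esub> x" using y by (auto simp: a_r_coset_def')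
      then have "r \<odot>\<^bsub>M\<^esub> y = r \<odot>\<^bsub>M\<^esub> h \<oplus>\<^bsub>M\<^esub> r \<odot>\<^bsub>M\<^esub> x" using r x H by (auto simp: M.smult_r_distr)
      then have "r \<odot>\<^bsub>M\<^esub> y \<in> H +>\<^bsub>M\<^esub> (r \<odot>\<^bsub>M\<^esub> x)" using S.smult_closed[OF r h(1)] by (auto simp: a_r_coset_def')
      then show ?thesis using A.a_repr_independence'[of _ "r \<odot>\<^bsub>M\<^esub> x"] r x by simp
    qed
    moreover have "x \<in> H +>\<^bsub>M\<^esub> x" using A.a_rcos_self x by simp
    ultimately have "(\<Union>y\<in>H +>\<^bsub>M\<^esub> x. H +>\<^bsub>M\<^esub> (r \<odot>\<^bsub>M\<^esub> y)) = H +>\<^bsub>M\<^esub> (r \<odot>\<^bsub>M\<^esub> x)" by blast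
    then show ?thesis by (simp add: quot_module_def)
  qed
  have add: "(H +>\<^bsub>M\<^esub> x) \<oplus>\<^bsub>quot_module M H\<^esub> (H +>\<^bsub>M\<^esub> y) = H +>\<^bsub>M\<^esub> (x \<oplus>\<^bsub>M\<^esub> y)"
    if "x \<in> carrier M" "y \<in> carrier M" for x y
    using A.a_rcos_sum[OF that] by (simp add: quot_module_def)
  have cE: "\<exists>x\<in>carrier M. X = H +>\<^bsub>M\<^esub> x" if "X \<in> carrier (quot_module M H)" for X
    using that by (auto simp: quot_module_def A_RCOSETS_def')
  have cI: "H +>\<^bsub>M\<^esub> x \<in> carrier (quot_module M H)" if "x \<in> carrier M" for x
    using that by (auto simp: quot_module_def A_RCOSETS_def')
  have ag: "abelian_group (quot_module M H)"
  proof (rule abelian_groupI)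
    show z: "\<zero>\<^bsub>quot_module M H\<^esub> \<in> carrier (quot_module M H)"
      using cI[of "\<zero>\<^bsub>M\<^esub>"] M.M.a_coset_add_zero H by (simp add: quot_module_def)
    have z': "\<zero>\<^bsub>quot_module M H\<^esub> = H +>\<^bsub>M\<^esub> \<zero>\<^bsub>M\<^esub>"
      using M.M.a_coset_add_zero H by (simp add: quot_module_def)
    fix X assume "X \<in> carrier (quot_module M H)"
    from this[THEN cE] obtain x where x: "x \<in> carrier M" "X = H +>\<^bsub>M\<^esub> x" by (elim bexE)
    show "\<zero>\<^bsub>quot_module M H\<^esub> \<oplus>\<^bsub>quot_module M H\<^esub> X = X" using x by (simp add: z' add)
    have "(H +>\<^bsub>M\<^esub> (\<ominus>\<^bsub>M\<^esub> x)) \<oplus>\<^bsub>quot_module M H\<^esub> X = \<zero>\<^bsub>quot_module M H\<^esub>"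
      using x by (simp add: z' add M.M.l_neg)
    then show "\<exists>Y\<in>carrier (quot_module M H). Y \<oplus>\<^bsub>quot_module M H\<^esub> X = \<zero>\<^bsub>quot_module M H\<^esub>"
      using cI[of "\<ominus>\<^bsub>M\<^esub> x"] x by blast
  next
    fix X Y assume "X \<in> carrier (quot_module M H)" "Y \<in> carrier (quot_module M H)"
    from this[THEN cE] obtain x y where xy: "x \<in> carrier M" "X = H +>\<^bsub>M\<^esub> x" "y \<in> carrier M" "Y = H +>\<^bsub>M\<^esub> y" by (elim bexE)
    then show "X \<oplus>\<^bsub>quot_module M H\<^esub> Y \<in> carrier (quot_module M H)" by (simp add: add cI)
    show "X \<oplus>\<^bsub>quot_module M H\<^esub> Y = Y \<oplus>\<^bsub>quot_module M H\<^esub> X" using xy by (simp add: add M.M.a_comm)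
  next
    fix X Y Z assume "X \<in> carrier (quot_module M H)" "Y \<in> carrier (quot_module M H)" "Z \<in> carrier (quot_module M H)"
    from this[THEN cE] obtain x y z where "x \<in> carrier M" "X = H +>\<^bsub>M\<^esub> x" "y \<in> carrier M" "Y = H +>\<^bsub>M\<^esub> y"
      "z \<in> carrier M" "Z = H +>\<^bsub>M\<^esub> z" by (elim bexE)
    then show "X \<oplus>\<^bsub>quot_module M H\<^esub> Y \<oplus>\<^bsub>quot_module M H\<^esub> Z = X \<oplus>\<^bsub>quot_module M H\<^esub> (Y \<oplus>\<^bsub>quot_module M H\<^esub> Z)"
      by (simp add: add M.M.a_assoc)
  qed
  show ?thesis
  proof (rule moduleI)
    show "cring R" by (rule M.R.cring_axioms)
    show "abelian_group (quot_module M H)" by (rule ag)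
    show "a \<odot>\<^bsub>quot_module M H\<^esub> X \<in> carrier (quot_module M H)"
      if "a \<in> carrier R" "X \<in> carrier (quot_module M H)" for a X
      using cE[OF that(2)] that(1) by (elim bexE) (simp add: sm cI)
    show "(a \<oplus>\<^bsub>R\<^esub> b) \<odot>\<^bsub>quot_module M H\<^esub> X = a \<odot>\<^bsub>quot_module M H\<^esub> X \<oplus>\<^bsub>quot_module M H\<^esub> b \<odot>\<^bsub>quot_module M H\<^esub> X"
      if "a \<in> carrier R" "b \<in> carrier R" "X \<in> carrier (quot_module M H)" for a b X
      using cE[OF that(3)] that(1,2) by (elim bexE) (simp add: sm add M.smult_l_distr)
    show "a \<odot>\<^bsub>quot_module M H\<^esub> (X \<oplus>\<^bsub>quot_module M H\<^esub> Y) = a \<odot>\<^bsub>quot_module M H\<^esub> X \<oplus>\<^bsub>quot_module M H\<^esub> a \<odot>\<^bsub>quot_module M H\<^esub> Y"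
      if "a \<in> carrier R" "X \<in> carrier (quot_module M H)" "Y \<in> carrier (quot_module M H)" for a X Y
      using cE[OF that(2)] cE[OF that(3)] that(1) by (elim bexE) (simp add: sm add M.smult_r_distr)
    show "(a \<otimes>\<^bsub>R\<^esub> b) \<odot>\<^bsub>quot_module M H\<^esub> X = a \<odot>\<^bsub>quot_module M H\<^esub> (b \<odot>\<^bsub>quot_module M H\<^esub> X)"
      if "a \<in> carrier R" "b \<in> carrier R" "X \<in> carrier (quot_module M H)" for a b X
      using cE[OF that(3)] that(1,2) by (elim bexE) (simp add: sm M.smult_assoc1)
    show "\<one>\<^bsub>R\<^esub> \<odot>\<^bsub>quot_module M H\<^esub> X = X" if "X \<in> carrier (quot_module M H)" for X
      using cE[OF that] by (elim bexE) (simp add: sm)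
  qed
qed

lemma hom_module_module:
  assumes M: "module R M" and N: "module R N"
  shows "module R (hom_module R M N)"
proof -
  interpret R: cring R using M by (simp add: module_def)
  interpret M: module R M by fact
  interpret N: module R N by fact
  have clo: "f x \<in> carrier N" if "f \<in> mod_hom R M N" "x \<in> carrier M" for f x using mod_homD(2)[OF that] .
  have add: "(\<lambda>x\<in>carrier M. f x \<oplus>\<^bsub>N\<^esub> g x) \<in> mod_hom R M N" if f: "f \<in> mod_hom R M N" and g: "g \<in> mod_hom R M N" for f g
    by (rule mod_homI) (auto simp: clo[OF f] clo[OF g] mod_homD(3,4)[OF f] mod_homD(3,4)[OF g] N.M.a_ac N.smult_r_distr)
  have sm: "(\<lambda>x\<in>carrier M. r \<odot>\<^bsub>N\<^esub> f x) \<in> mod_hom R M N" if f: "f \<in> mod_hom R M N" and r: "r \<in> carrier R" for f r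
  proof (rule mod_homI)
    fix s x assume "s \<in> carrier R" "x \<in> carrier M"
    then show "(\<lambda>x\<in>carrier M. r \<odot>\<^bsub>N\<^esub> f x) (s \<odot>\<^bsub>M\<^esub> x) = s \<odot>\<^bsub>N\<^esub> (\<lambda>x\<in>carrier M. r \<odot>\<^bsub>N\<^esub> f x) x"
      using r by (simp add: clo[OF f] mod_homD(4)[OF f] R.m_comm flip: N.smult_assoc1)
  qed (use r in \<open>auto simp: clo[OF f] mod_homD(3)[OF f] N.smult_r_distr\<close>)
  have z: "(\<lambda>x\<in>carrier M. \<zero>\<^bsub>N\<^esub>) \<in> mod_hom R M N" by (rule mod_homI) auto
  have ext: "f \<in> extensional (carrier M)" if "f \<in> mod_hom R M N" for f
    using mod_homD(1)[OF that] by (simp add: PiE_iff)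
  show ?thesis
  proof (rule moduleI)
    show "abelian_group (hom_module R M N)"
    proof (rule abelian_groupI)
      fix f assume f: "f \<in> carrier (hom_module R M N)"
      then have f': "f \<in> mod_hom R M N" by (simp add: hom_module_def)
      have "(\<lambda>x\<in>carrier M. (\<ominus>\<^bsub>R\<^esub> \<one>\<^bsub>R\<^esub>) \<odot>\<^bsub>N\<^esub> f x) \<oplus>\<^bsub>hom_module R M N\<^esub> f = \<zero>\<^bsub>hom_module R M N\<^esub>"
        by (auto simp: hom_module_def clo[OF f'] N.smult_l_minus N.M.l_neg intro!: restrict_ext)
      moreover have "(\<lambda>x\<in>carrier M. (\<ominus>\<^bsub>R\<^esub> \<one>\<^bsub>R\<^esub>) \<odot>\<^bsub>N\<^esub> f x) \<in> carrier (hom_module R M N)"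
        using sm[OF f'] by (simp add: hom_module_def)
      ultimately show "\<exists>y\<in>carrier (hom_module R M N). y \<oplus>\<^bsub>hom_module R M N\<^esub> f = \<zero>\<^bsub>hom_module R M N\<^esub>"
        by blast
      show "\<zero>\<^bsub>hom_module R M N\<^esub> \<oplus>\<^bsub>hom_module R M N\<^esub> f = f"
        by (rule extensionalityI[of _ "carrier M"]) (auto simp: hom_module_def ext[OF f'] clo[OF f'])
    qed (auto simp: hom_module_def add z clo N.M.a_ac intro!: restrict_ext)
    show "\<one>\<^bsub>R\<^esub> \<odot>\<^bsub>hom_module R M N\<^esub> f = f" if "f \<in> carrier (hom_module R M N)" for f
      by (rule extensionalityI[of _ "carrier M"]) (use that in \<open>auto simp: hom_module_def ext clo\<close>)
  qed (auto simp: hom_module_def sm clo N.smult_l_distr N.smult_r_distr N.smult_assoc1 R.cring_axioms intro!: restrict_ext)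
qed


section \<open>Independence of the carrier types in the definitions\<close>

text \<open>Baer's criterion, via Zorn's lemma on graphs of partial homomorphisms.\<close>

locale linear_rel = B: module R B + E: module R E for R (structure) and B (structure) and E (structure) +
  fixes G
  assumes sub: "G \<subseteq> carrier B \<times> carrier E"
    and zero: "(\<zero>\<^bsub>B\<^esub>, \<zero>\<^bsub>E\<^esub>) \<in> G"
    and add: "(x, y) \<in> G \<Longrightarrow> (x', y') \<in> G \<Longrightarrow> (x \<oplus>\<^bsub>B\<^esub> x', y \<oplus>\<^bsub>E\<^esub> y') \<in> G"
    and smult: "r \<in> carrier R \<Longrightarrow> (x, y) \<in> G \<Longrightarrow> (r \<odot>\<^bsub>B\<^esub> x, r \<odot>\<^bsub>E\<^esub> y) \<in> G"
    and sv: "(\<zero>\<^bsub>B\<^esub>, y) \<in> G \<Longrightarrow> y = \<zero>\<^bsub>E\<^esub>"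
begin

lemma carr: "(x, y) \<in> G \<Longrightarrow> x \<in> carrier B \<and> y \<in> carrier E"
  using sub by auto

lemma minus: "(x, y) \<in> G \<Longrightarrow> (\<ominus>\<^bsub>B\<^esub> x, \<ominus>\<^bsub>E\<^esub> y) \<in> G"
  using smult[of "\<ominus> \<one>" x y] carr[of x y] by (simp add: B.smult_l_minus E.smult_l_minus)

lemma unique: assumes "(x, y) \<in> G" "(x, y') \<in> G" shows "y = y'"
proof -
  have "(x \<oplus>\<^bsub>B\<^esub> \<ominus>\<^bsub>B\<^esub> x, y \<oplus>\<^bsub>E\<^esub> \<ominus>\<^bsub>E\<^esub> y') \<in> G"
    using assms minus add by blast
  then have "y \<oplus>\<^bsub>E\<^esub> \<ominus>\<^bsub>E\<^esub> y' = \<zero>\<^bsub>E\<^esub>"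
    using sv carr[OF assms(1)] by (simp add: B.M.r_neg)
  then show ?thesis
    using carr assms by (metis E.M.minus_equality E.M.minus_minus E.M.add.inv_closed)
qed

end

lemma injective_module_extend:
  fixes R :: "('r, 'x) ring_scheme" and A :: "('r, 'a) module" and B :: "('r, 'b) module"
    and E :: "('r, 'e) module"
  assumes inj: "injective_module R E" and A: "module R A" and B: "module R B"
    and i: "i \<in> mod_hom R A B" "inj_on i (carrier A)" and f: "f \<in> mod_hom R A E"
  shows "\<exists>h\<in>mod_hom R B E. \<forall>x\<in>carrier A. h (i x) = f x"
proof -
  have E: "module R E" using inj by (simp add: injective_module_def)
  interpret R: cring R using A by (simp add: module_def)
  interpret A: module R A by fact
  interpret B: module R B by fact
  interpret E: module R E by fact
  let ?L = "\<lambda>G. linear_rel R B E G"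
  let ?G0 = "(\<lambda>a. (i a, f a)) ` carrier A"
  note [simp] = mod_homD(2)[OF i(1)] mod_homD(2)[OF f]
  have i0: "i \<zero>\<^bsub>A\<^esub> = \<zero>\<^bsub>B\<^esub>" and f0: "f \<zero>\<^bsub>A\<^esub> = \<zero>\<^bsub>E\<^esub>"
    using mod_homD(4)[OF i(1), of "\<zero>\<^bsub>R\<^esub>" "\<zero>\<^bsub>A\<^esub>"] mod_homD(4)[OF f, of "\<zero>\<^bsub>R\<^esub>" "\<zero>\<^bsub>A\<^esub>"] by auto
  have G0: "?L ?G0"
  proof (unfold_locales)
    show "?G0 \<subseteq> carrier B \<times> carrier E" by auto
    show "(\<zero>\<^bsub>B\<^esub>, \<zero>\<^bsub>E\<^esub>) \<in> ?G0" using i0 f0 by (auto intro!: image_eqI[of _ _ "\<zero>\<^bsub>A\<^esub>"])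
    fix x y assume "(x, y) \<in> ?G0"
    then obtain a where a: "a \<in> carrier A" "x = i a" "y = f a" by auto
    { fix x' y' assume "(x', y') \<in> ?G0"
      then obtain a' where "a' \<in> carrier A" "x' = i a'" "y' = f a'" by auto
      with a show "(x \<oplus>\<^bsub>B\<^esub> x', y \<oplus>\<^bsub>E\<^esub> y') \<in> ?G0"
        by (auto intro!: image_eqI[of _ _ "a \<oplus>\<^bsub>A\<^esub> a'"] simp: mod_homD(3)[OF i(1)] mod_homD(3)[OF f]) }
    { fix r assume "r \<in> carrier R"
      with a show "(r \<odot>\<^bsub>B\<^esub> x, r \<odot>\<^bsub>E\<^esub> y) \<in> ?G0"
        by (auto intro!: image_eqI[of _ _ "r \<odot>\<^bsub>A\<^esub> a"] simp: mod_homD(4)[OF i(1)] mod_homD(4)[OF f]) }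
  next
    fix y assume "(\<zero>\<^bsub>B\<^esub>, y) \<in> ?G0"
    then obtain a where a: "a \<in> carrier A" "i a = i \<zero>\<^bsub>A\<^esub>" "y = f a" using i0 by auto
    then have "a = \<zero>\<^bsub>A\<^esub>" using i(2) by (auto simp: inj_on_def)
    then show "y = \<zero>\<^bsub>E\<^esub>" using a f0 by simp
  qed
  let ?S = "{G. ?L G \<and> ?G0 \<subseteq> G}"
  have "\<exists>G\<in>?S. \<forall>G'\<in>?S. G \<subseteq> G' \<longrightarrow> G' = G"
  proof (rule subset_Zorn_nonempty)
    show "?S \<noteq> {}" using G0 by blast
    fix C assume "C \<noteq> {}" and C: "subset.chain ?S C"
    have CL: "?L G" "?G0 \<subseteq> G" if "G \<in> C" for G using C that by (auto simp: subset.chain_def)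
    have dir: "\<exists>G\<in>C. p \<in> G \<and> q \<in> G" if "p \<in> \<Union>C" "q \<in> \<Union>C" for p q
      using that C unfolding subset.chain_def by blast
    have "?L (\<Union>C)"
    proof (unfold_locales)
      show "\<Union>C \<subseteq> carrier B \<times> carrier E" using linear_rel.sub[OF CL(1)] by blast
      show "(\<zero>\<^bsub>B\<^esub>, \<zero>\<^bsub>E\<^esub>) \<in> \<Union>C" using linear_rel.zero[OF CL(1)] \<open>C \<noteq> {}\<close> by blast
      show "(x \<oplus>\<^bsub>B\<^esub> x', y \<oplus>\<^bsub>E\<^esub> y') \<in> \<Union>C" if "(x, y) \<in> \<Union>C" "(x', y') \<in> \<Union>C" for x y x' y'
        using dir[OF that] linear_rel.add[OF CL(1)] by blast
      show "(r \<odot>\<^bsub>B\<^esub> x, r \<odot>\<^bsub>E\<^esub> y) \<in> \<Union>C" if "r \<in> carrier R" "(x, y) \<in> \<Union>C" for r x y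
        using that linear_rel.smult[OF CL(1)] by blast
      show "y = \<zero>\<^bsub>E\<^esub>" if "(\<zero>\<^bsub>B\<^esub>, y) \<in> \<Union>C" for y
        using that linear_rel.sv[OF CL(1)] by blast
    qed
    then show "\<Union>C \<in> ?S" using \<open>C \<noteq> {}\<close> CL(2) by blast
  qed
  then obtain G where GS: "G \<in> ?S" and max0: "\<forall>G'\<in>?S. G \<subseteq> G' \<longrightarrow> G' = G" by (elim bexE) rule
  have G: "?L G" "?G0 \<subseteq> G" using GS by simp_all
  have max: "G' = G" if "?L G'" "G \<subseteq> G'" for G'
    using max0 that G(2) by (metis (mono_tags, lifting) mem_Collect_eq subset_trans)
  interpret G: linear_rel R B E G by fact
  have total: "\<exists>y. (b, y) \<in> G" if b: "b \<in> carrier B" for b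
  proof -
    define I where "I = {r \<in> carrier R. \<exists>y. (r \<odot>\<^bsub>B\<^esub> b, y) \<in> G}"
    define \<phi> where "\<phi> = (\<lambda>r\<in>I. THE y. (r \<odot>\<^bsub>B\<^esub> b, y) \<in> G)"
    have \<phi>: "(r \<odot>\<^bsub>B\<^esub> b, \<phi> r) \<in> G" if "r \<in> I" for r
    proof -
      obtain y where y: "(r \<odot>\<^bsub>B\<^esub> b, y) \<in> G" using \<open>r \<in> I\<close> by (auto simp: I_def)
      then have "(THE y. (r \<odot>\<^bsub>B\<^esub> b, y) \<in> G) = y" by (blast intro: G.unique)
      then show ?thesis using \<open>r \<in> I\<close> y by (simp add: \<phi>_def)
    qed
    have \<phi>_eq: "\<phi> r = y" if "r \<in> carrier R" "(r \<odot>\<^bsub>B\<^esub> b, y) \<in> G" for r y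
      using \<phi>[of r] G.unique that by (auto simp: I_def)
    have I: "ideal I R"
    proof (rule idealI)
      show "ring R" by (rule R.ring_axioms)
      show "subgroup I (add_monoid R)"
      proof (rule subgroup.intro)
        show "x \<otimes>\<^bsub>add_monoid R\<^esub> y \<in> I" if "x \<in> I" "y \<in> I" for x y
          using that G.add b by (fastforce simp: I_def B.smult_l_distr)
        show "\<one>\<^bsub>add_monoid R\<^esub> \<in> I" using G.zero b by (auto simp: I_def)
        show "inv\<^bsub>add_monoid R\<^esub> x \<in> I" if "x \<in> I" for x
          using that b G.minus by (fastforce simp: I_def B.smult_l_minus simp flip: a_inv_def)
      qed (auto simp: I_def)
      fix a x assume "a \<in> I" "x \<in> carrier R"
      then show *: "x \<otimes>\<^bsub>R\<^esub> a \<in> I" using G.smult b by (fastforce simp: I_def B.smult_assoc1)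
      then show "a \<otimes>\<^bsub>R\<^esub> x \<in> I" using \<open>a \<in> I\<close> \<open>x \<in> carrier R\<close> by (simp add: I_def R.m_comm)
    qed
    interpret I: ideal I R by fact
    have IM: "module R ((regular_module R)\<lparr>carrier := I\<rparr>)"
      by (rule submodule.submodule_is_module[OF submodule_regular_ideal[OF I R.cring_axioms]
           regular_module_module[OF R.cring_axioms]])
    have \<phi>hom: "\<phi> \<in> mod_hom R ((regular_module R)\<lparr>carrier := I\<rparr>) E"
    proof (rule mod_homI)
      show "\<phi> \<in> carrier ((regular_module R)\<lparr>carrier := I\<rparr>) \<rightarrow>\<^sub>E carrier E"
        using \<phi> G.sub by (auto simp: \<phi>_def)
    next
      fix x y assume xy: "x \<in> carrier ((regular_module R)\<lparr>carrier := I\<rparr>)"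
         "y \<in> carrier ((regular_module R)\<lparr>carrier := I\<rparr>)"
      then have "((x \<oplus>\<^bsub>R\<^esub> y) \<odot>\<^bsub>B\<^esub> b, \<phi> x \<oplus>\<^bsub>E\<^esub> \<phi> y) \<in> G"
        using G.add[OF \<phi> \<phi>, of x y] b I.Icarr by (simp add: B.smult_l_distr)
      then show "\<phi> (x \<oplus>\<^bsub>(regular_module R)\<lparr>carrier := I\<rparr>\<^esub> y) = \<phi> x \<oplus>\<^bsub>E\<^esub> \<phi> y"
        using xy I.Icarr by (intro \<phi>_eq) auto
    next
      fix r x assume rx: "r \<in> carrier R" "x \<in> carrier ((regular_module R)\<lparr>carrier := I\<rparr>)"
      then have "((r \<otimes>\<^bsub>R\<^esub> x) \<odot>\<^bsub>B\<^esub> b, r \<odot>\<^bsub>E\<^esub> \<phi> x) \<in> G"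
        using G.smult[OF rx(1) \<phi>, of x] b I.Icarr by (simp add: B.smult_assoc1)
      then show "\<phi> (r \<odot>\<^bsub>(regular_module R)\<lparr>carrier := I\<rparr>\<^esub> x) = r \<odot>\<^bsub>E\<^esub> \<phi> x"
        using rx I.Icarr by (intro \<phi>_eq) auto
    qed
    have incl: "(\<lambda>x\<in>I. x) \<in> mod_hom R ((regular_module R)\<lparr>carrier := I\<rparr>) (regular_module R)"
      by (rule mod_homI) (auto simp: I.Icarr I.I_l_closed)
    have "\<exists>h\<in>mod_hom R (regular_module R) E.
        \<forall>x\<in>carrier ((regular_module R)\<lparr>carrier := I\<rparr>). h ((\<lambda>x\<in>I. x) x) = \<phi> x"
      by (rule inj[unfolded injective_module_def, THEN conjunct2, rule_format,
            OF IM regular_module_module[OF R.cring_axioms] incl \<phi>hom]) (simp add: inj_on_def)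
    then obtain h where h: "h \<in> mod_hom R (regular_module R) E" "\<And>x. x \<in> I \<Longrightarrow> h x = \<phi> x"
      by auto
    define e where "e = h \<one>\<^bsub>R\<^esub>"
    have e: "e \<in> carrier E" using mod_homD(2)[OF h(1)] by (simp add: e_def)
    have he: "\<phi> r = r \<odot>\<^bsub>E\<^esub> e" if "r \<in> I" for r
      using mod_homD(4)[OF h(1), of r "\<one>\<^bsub>R\<^esub>"] h(2) that I.Icarr by (simp add: e_def)
    define G' where "G' = {(d \<oplus>\<^bsub>B\<^esub> r \<odot>\<^bsub>B\<^esub> b, g \<oplus>\<^bsub>E\<^esub> r \<odot>\<^bsub>E\<^esub> e) |d g r. (d, g) \<in> G \<and> r \<in> carrier R}"
    have G'I: "(x, y) \<in> G'" if "(d, g) \<in> G" "r \<in> carrier R" "x = d \<oplus>\<^bsub>B\<^esub> r \<odot>\<^bsub>B\<^esub> b" "y = g \<oplus>\<^bsub>E\<^esub> r \<odot>\<^bsub>E\<^esub> e" for x y d g r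
      using that unfolding G'_def by blast
    have "?L G'"
    proof (unfold_locales)
      show "G' \<subseteq> carrier B \<times> carrier E" using G.sub b e by (auto simp: G'_def)
      show "(\<zero>\<^bsub>B\<^esub>, \<zero>\<^bsub>E\<^esub>) \<in> G'" using b e by (intro G'I[OF G.zero R.zero_closed]) auto
      fix x y assume "(x, y) \<in> G'"
      then obtain d g r where *: "(d, g) \<in> G" "r \<in> carrier R" "x = d \<oplus>\<^bsub>B\<^esub> r \<odot>\<^bsub>B\<^esub> b" "y = g \<oplus>\<^bsub>E\<^esub> r \<odot>\<^bsub>E\<^esub> e"
        unfolding G'_def by blast
      note c = G.carr[OF *(1)]
      { fix x' y' assume "(x', y') \<in> G'"
        then obtain d' g' r' where **: "(d', g') \<in> G" "r' \<in> carrier R" "x' = d' \<oplus>\<^bsub>B\<^esub> r' \<odot>\<^bsub>B\<^esub> b" "y' = g' \<oplus>\<^bsub>E\<^esub> r' \<odot>\<^bsub>E\<^esub> e"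
          unfolding G'_def by blast
        note c' = G.carr[OF **(1)]
        show "(x \<oplus>\<^bsub>B\<^esub> x', y \<oplus>\<^bsub>E\<^esub> y') \<in> G'"
        proof (rule G'I[OF G.add[OF *(1) **(1)]])
          show "r \<oplus>\<^bsub>R\<^esub> r' \<in> carrier R" using * ** by simp
        qed (use * ** c c' b e in \<open>simp_all add: B.smult_l_distr E.smult_l_distr B.M.a_ac E.M.a_ac\<close>) }
      { fix s assume s: "s \<in> carrier R"
        show "(s \<odot>\<^bsub>B\<^esub> x, s \<odot>\<^bsub>E\<^esub> y) \<in> G'"
        proof (rule G'I[OF G.smult[OF s *(1)]])
          show "s \<otimes>\<^bsub>R\<^esub> r \<in> carrier R" using * s by simp
        qed (use * s c b e in \<open>simp_all add: B.smult_r_distr E.smult_r_distr B.smult_assoc1 E.smult_assoc1\<close>) }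
    next
      fix y assume "(\<zero>\<^bsub>B\<^esub>, y) \<in> G'"
      then obtain d g r where *: "(d, g) \<in> G" "r \<in> carrier R" "\<zero>\<^bsub>B\<^esub> = d \<oplus>\<^bsub>B\<^esub> r \<odot>\<^bsub>B\<^esub> b" "y = g \<oplus>\<^bsub>E\<^esub> r \<odot>\<^bsub>E\<^esub> e"
        unfolding G'_def by blast
      note c = G.carr[OF *(1)]
      have "r \<odot>\<^bsub>B\<^esub> b = \<ominus>\<^bsub>B\<^esub> d"
        using * c b by (metis B.M.minus_equality B.M.minus_minus B.smult_closed B.M.a_comm)
      then have "(r \<odot>\<^bsub>B\<^esub> b, \<ominus>\<^bsub>E\<^esub> g) \<in> G" using G.minus[OF *(1)] by simp
      then have "r \<in> I" and \<phi>r: "\<phi> r = \<ominus>\<^bsub>E\<^esub> g"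
        using *(2) by (unfold I_def, blast, intro \<phi>_eq)
      then have "r \<odot>\<^bsub>E\<^esub> e = \<ominus>\<^bsub>E\<^esub> g" using he by simp
      then show "y = \<zero>\<^bsub>E\<^esub>" using *(4) c by (simp add: E.M.r_neg)
    qed
    moreover have "G \<subseteq> G'"
    proof (clarify)
      fix x y assume xy: "(x, y) \<in> G"
      show "(x, y) \<in> G'" using G.carr[OF xy] b e by (intro G'I[OF xy R.zero_closed]) auto
    qed
    ultimately have "G' = G" by (rule max)
    moreover have "(b, e) \<in> G'" using b e by (intro G'I[OF G.zero R.one_closed]) auto
    ultimately show ?thesis by blast
  qed
  define h where "h = (\<lambda>b\<in>carrier B. THE y. (b, y) \<in> G)"
  have h: "(b, h b) \<in> G" if b: "b \<in> carrier B" for b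
  proof -
    obtain y where y: "(b, y) \<in> G" using total[OF b] by blast
    then have "(THE y. (b, y) \<in> G) = y" by (blast intro: G.unique)
    then show ?thesis using b y by (simp add: h_def)
  qed
  have h_eq: "h b = y" if "(b, y) \<in> G" for b y
    using G.unique[OF h that] G.carr[OF that] by simp
  have "h \<in> mod_hom R B E"
  proof (rule mod_homI)
    show "h \<in> carrier B \<rightarrow>\<^sub>E carrier E" using h G.sub by (auto simp: h_def)
  qed (auto intro!: h_eq G.add G.smult h)
  moreover have "\<forall>x\<in>carrier A. h (i x) = f x" using G(2) by (auto intro!: h_eq)
  ultimately show ?thesis by blast
qed

text \<open>The free module on a set \<open>I\<close>.\<close>

definition free_on :: "('s, 'y) ring_scheme \<Rightarrow> 'i set \<Rightarrow> ('s, 'i \<Rightarrow> 's) module" where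
  "free_on S I = \<lparr>carrier = {a \<in> I \<rightarrow>\<^sub>E carrier S. finite {i \<in> I. a i \<noteq> \<zero>\<^bsub>S\<^esub>}},
     monoid.mult = undefined, one = undefined, zero = (\<lambda>i\<in>I. \<zero>\<^bsub>S\<^esub>),
     add = (\<lambda>a b. \<lambda>i\<in>I. a i \<oplus>\<^bsub>S\<^esub> b i), smult = (\<lambda>r a. \<lambda>i\<in>I. r \<otimes>\<^bsub>S\<^esub> a i)\<rparr>"

lemma free_on_module:
  assumes "cring S"
  shows "module S (free_on S I)"
proof -
  interpret S: cring S by fact
  have mem: "a i \<in> carrier S" if "a \<in> I \<rightarrow>\<^sub>E carrier S" "i \<in> I" for a i using that by auto
  have fin_add: "finite {i \<in> I. a i \<oplus>\<^bsub>S\<^esub> b i \<noteq> \<zero>\<^bsub>S\<^esub>}"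
    if "finite {i \<in> I. a i \<noteq> \<zero>\<^bsub>S\<^esub>}" "finite {i \<in> I. b i \<noteq> \<zero>\<^bsub>S\<^esub>}" for a b
    by (rule finite_subset[OF _ finite_UnI[OF that]]) auto
  have fin_smult: "finite {i \<in> I. r \<otimes>\<^bsub>S\<^esub> a i \<noteq> \<zero>\<^bsub>S\<^esub>}"
    if "finite {i \<in> I. a i \<noteq> \<zero>\<^bsub>S\<^esub>}" "r \<in> carrier S" for r a
    by (rule finite_subset[OF _ that(1)]) (use that(2) in auto)
  have fin_minus: "finite {i \<in> I. \<ominus>\<^bsub>S\<^esub> a i \<noteq> \<zero>\<^bsub>S\<^esub>}"
    if "finite {i \<in> I. a i \<noteq> \<zero>\<^bsub>S\<^esub>}" for a
    by (rule finite_subset[OF _ that]) auto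
  show ?thesis
  proof (rule moduleI)
    show "abelian_group (free_on S I)"
    proof (rule abelian_groupI)
      show "x \<oplus>\<^bsub>free_on S I\<^esub> y \<in> carrier (free_on S I)"
        if "x \<in> carrier (free_on S I)" "y \<in> carrier (free_on S I)" for x y
        using that by (auto simp: free_on_def mem Pi_iff fin_add cong: conj_cong)
      show "x \<oplus>\<^bsub>free_on S I\<^esub> y \<oplus>\<^bsub>free_on S I\<^esub> z = x \<oplus>\<^bsub>free_on S I\<^esub> (y \<oplus>\<^bsub>free_on S I\<^esub> z)"
        if "x \<in> carrier (free_on S I)" "y \<in> carrier (free_on S I)" "z \<in> carrier (free_on S I)" for x y z
        using that by (auto simp: free_on_def mem fun_eq_iff restrict_def S.a_assoc)
      show "x \<oplus>\<^bsub>free_on S I\<^esub> y = y \<oplus>\<^bsub>free_on S I\<^esub> x"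
        if "x \<in> carrier (free_on S I)" "y \<in> carrier (free_on S I)" for x y
        using that by (auto simp: free_on_def mem fun_eq_iff restrict_def S.a_comm)
      show "\<zero>\<^bsub>free_on S I\<^esub> \<oplus>\<^bsub>free_on S I\<^esub> x = x" if "x \<in> carrier (free_on S I)" for x
        using that by (intro ext) (auto simp: free_on_def PiE_iff extensional_def)
      show "\<exists>y\<in>carrier (free_on S I). y \<oplus>\<^bsub>free_on S I\<^esub> x = \<zero>\<^bsub>free_on S I\<^esub>"
        if "x \<in> carrier (free_on S I)" for x
        using that
        by (intro bexI[of _ "\<lambda>i\<in>I. \<ominus>\<^bsub>S\<^esub> x i"])
           (auto simp: free_on_def mem Pi_iff restrict_def S.l_neg fin_minus cong: conj_cong)
    qed (auto simp: free_on_def cong: conj_cong)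
  next
    show "a \<odot>\<^bsub>free_on S I\<^esub> x \<in> carrier (free_on S I)"
      if "a \<in> carrier S" "x \<in> carrier (free_on S I)" for a x
      using that by (auto simp: free_on_def mem Pi_iff fin_smult cong: conj_cong)
    show "\<one>\<^bsub>S\<^esub> \<odot>\<^bsub>free_on S I\<^esub> x = x" if "x \<in> carrier (free_on S I)" for x
      using that by (intro ext) (auto simp: free_on_def PiE_iff extensional_def)
  qed (auto simp: free_on_def mem fun_eq_iff restrict_def assms S.l_distr S.r_distr S.m_assoc)
qed

lemma free_on_zero: "\<zero>\<^bsub>free_on S I\<^esub> = (\<lambda>i\<in>I. \<zero>\<^bsub>S\<^esub>)"
  and free_on_add: "a \<oplus>\<^bsub>free_on S I\<^esub> b = (\<lambda>i\<in>I. a i \<oplus>\<^bsub>S\<^esub> b i)"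
  by (simp_all add: free_on_def)

lemma free_on_free:
  fixes S :: "('s, 'y) ring_scheme" and I :: "'i set"
  assumes "cring S"
  shows "free_module S (free_on S I)"
proof (cases "\<one>\<^bsub>S\<^esub> = \<zero>\<^bsub>S\<^esub>")
  interpret S: cring S by fact
  interpret F: module S "free_on S I" by (rule free_on_module) fact
  case True
  then have "carrier S = {\<zero>\<^bsub>S\<^esub>}" by (rule S.one_zeroD)
  then have "x = \<zero>\<^bsub>free_on S I\<^esub>" if "x \<in> carrier (free_on S I)" for x
    using that by (auto simp: free_on_def fun_eq_iff restrict_def PiE_iff extensional_def)
  then have "is_basis S (free_on S I) {}"
    by (auto simp: is_basis_def)
  then show ?thesis using F.module_axioms by (auto simp: free_module_def)
next
  interpret S: cring S by fact
  interpret F: module S "free_on S I" by (rule free_on_module) fact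
  case nz: False
  define \<delta> where "\<delta> = (\<lambda>j. \<lambda>i\<in>I. if i = j then \<one>\<^bsub>S\<^esub> else \<zero>\<^bsub>S\<^esub>)"
  have \<delta>F: "\<delta> j \<in> carrier (free_on S I)" for j
    by (auto simp: free_on_def \<delta>_def intro: finite_subset[of _ "{j}"] split: if_splits)
  have \<delta>_at: "i \<in> I \<Longrightarrow> \<delta> j i = (if i = j then \<one>\<^bsub>S\<^esub> else \<zero>\<^bsub>S\<^esub>)" for i j by (simp add: \<delta>_def)
  have inj: "inj_on \<delta> I"
  proof (rule inj_onI)
    fix i j assume "i \<in> I" "j \<in> I" "\<delta> i = \<delta> j"
    then have "\<delta> i i = \<delta> j i" by simp
    then show "i = j" using nz \<open>i \<in> I\<close> by (simp add: \<delta>_at split: if_splits)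
  qed
  have eval: "finsum (free_on S I) f A i = (\<Oplus>\<^bsub>S\<^esub>b\<in>A. f b i)"
    if "finite A" "f \<in> A \<rightarrow> carrier (free_on S I)" "i \<in> I" for f i and A :: "('i \<Rightarrow> 's) set"
    using that
  proof (induction A rule: finite_induct)
    case empty
    then show ?case by (simp add: free_on_zero)
  next
    case (insert b A)
    have 1: "(\<lambda>b. f b i) \<in> A \<rightarrow> carrier S" "f b i \<in> carrier S"
      using insert.prems by (auto simp: free_on_def PiE_mem Pi_iff)
    have 2: "f \<in> A \<rightarrow> carrier (free_on S I)" "f b \<in> carrier (free_on S I)" using insert.prems by auto
    have "finsum (free_on S I) f (insert b A) i = (f b \<oplus>\<^bsub>free_on S I\<^esub> finsum (free_on S I) f A) i"
      using insert.hyps 2 by simp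
    also have "\<dots> = f b i \<oplus>\<^bsub>S\<^esub> finsum (free_on S I) f A i"
      using insert.prems by (simp add: free_on_add)
    finally show ?case using insert.IH 2 insert.hyps insert.prems 1 by simp
  qed
  let ?comb = "\<lambda>a. \<Oplus>\<^bsub>free_on S I\<^esub>b\<in>{b \<in> \<delta> ` I. a b \<noteq> \<zero>\<^bsub>S\<^esub>}. a b \<odot>\<^bsub>free_on S I\<^esub> b"
  have comb: "?comb a \<in> carrier (free_on S I)" "\<And>i. i \<in> I \<Longrightarrow> ?comb a i = a (\<delta> i)"
    if a: "a \<in> \<delta> ` I \<rightarrow>\<^sub>E carrier S" "finite {b \<in> \<delta> ` I. a b \<noteq> \<zero>\<^bsub>S\<^esub>}" for a
  proof -
    have mem: "(\<lambda>b. a b \<odot>\<^bsub>free_on S I\<^esub> b) \<in> {b \<in> \<delta> ` I. a b \<noteq> \<zero>\<^bsub>S\<^esub>} \<rightarrow> carrier (free_on S I)"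
      using a \<delta>F by (auto intro!: F.smult_closed)
    then show "?comb a \<in> carrier (free_on S I)" by (rule F.M.finsum_closed)
    fix i assume i: "i \<in> I"
    have ai: "a (\<delta> i) \<in> carrier S" using a i by auto
    have "?comb a i = (\<Oplus>\<^bsub>S\<^esub>b\<in>{b \<in> \<delta> ` I. a b \<noteq> \<zero>\<^bsub>S\<^esub>}. (a b \<odot>\<^bsub>free_on S I\<^esub> b) i)"
      by (rule eval) (use a mem i in auto)
    also have "\<dots> = (\<Oplus>\<^bsub>S\<^esub>b\<in>{b \<in> \<delta> ` I. a b \<noteq> \<zero>\<^bsub>S\<^esub>}. if \<delta> i = b then a b else \<zero>\<^bsub>S\<^esub>)"
    proof (rule S.finsum_cong')
      fix b assume "b \<in> {b \<in> \<delta> ` I. a b \<noteq> \<zero>\<^bsub>S\<^esub>}"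
      then obtain j where j: "j \<in> I" "b = \<delta> j" by auto
      have "a (\<delta> j) \<in> carrier S" using a j by auto
      moreover have "\<delta> i = \<delta> j \<longleftrightarrow> i = j" using inj i j by (auto simp: inj_on_def)
      ultimately show "(a b \<odot>\<^bsub>free_on S I\<^esub> b) i = (if \<delta> i = b then a b else \<zero>\<^bsub>S\<^esub>)"
        using i j by (simp add: free_on_def \<delta>_at)
    next
      show "(\<lambda>b. if \<delta> i = b then a b else \<zero>\<^bsub>S\<^esub>) \<in> {b \<in> \<delta> ` I. a b \<noteq> \<zero>\<^bsub>S\<^esub>} \<rightarrow> carrier S"
        using ai by (simp add: Pi_iff)
    qed simp
    also have "\<dots> = a (\<delta> i)"
    proof (cases "a (\<delta> i) = \<zero>\<^bsub>S\<^esub>")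
      case True
      have "(\<Oplus>\<^bsub>S\<^esub>b\<in>{b \<in> \<delta> ` I. a b \<noteq> \<zero>\<^bsub>S\<^esub>}. if \<delta> i = b then a b else \<zero>\<^bsub>S\<^esub>)
          = (\<Oplus>\<^bsub>S\<^esub>b\<in>{b \<in> \<delta> ` I. a b \<noteq> \<zero>\<^bsub>S\<^esub>}. \<zero>\<^bsub>S\<^esub>)"
        by (rule S.finsum_cong') (use True in auto)
      then show ?thesis using True by simp
    next
      case False
      then show ?thesis using a i by (intro S.finsum_singleton) auto
    qed
    finally show "?comb a i = a (\<delta> i)" .
  qed
  have "is_basis S (free_on S I) (\<delta> ` I)"
    unfolding is_basis_def
  proof (intro conjI ballI)
    show "\<delta> ` I \<subseteq> carrier (free_on S I)" using \<delta>F by auto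
    fix x assume x: "x \<in> carrier (free_on S I)"
    have x': "x \<in> I \<rightarrow>\<^sub>E carrier S" "finite {i \<in> I. x i \<noteq> \<zero>\<^bsub>S\<^esub>}" using x by (auto simp: free_on_def)
    show "\<exists>!a. a \<in> \<delta> ` I \<rightarrow>\<^sub>E carrier S \<and> finite {b \<in> \<delta> ` I. a b \<noteq> \<zero>\<^bsub>S\<^esub>} \<and> x = ?comb a"
    proof (rule ex1I)
      let ?a = "\<lambda>b\<in>\<delta> ` I. x (inv_into I \<delta> b)"
      have a1: "?a \<in> \<delta> ` I \<rightarrow>\<^sub>E carrier S" using x' inj by auto
      have "{b \<in> \<delta> ` I. ?a b \<noteq> \<zero>\<^bsub>S\<^esub>} \<subseteq> \<delta> ` {i \<in> I. x i \<noteq> \<zero>\<^bsub>S\<^esub>}" using inj by auto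
      then have a2: "finite {b \<in> \<delta> ` I. ?a b \<noteq> \<zero>\<^bsub>S\<^esub>}" using x'(2) by (meson finite_imageI finite_subset)
      have "x = ?comb ?a"
      proof (rule PiE_ext[of _ I "\<lambda>_. carrier S"])
        show "?comb ?a \<in> I \<rightarrow>\<^sub>E carrier S" using comb(1)[OF a1 a2] by (simp add: free_on_def)
        show "x i = ?comb ?a i" if "i \<in> I" for i using comb(2)[OF a1 a2 that] inj that by simp
      qed (rule x')
      then show "?a \<in> \<delta> ` I \<rightarrow>\<^sub>E carrier S \<and> finite {b \<in> \<delta> ` I. ?a b \<noteq> \<zero>\<^bsub>S\<^esub>} \<and> x = ?comb ?a"
        using a1 a2 by blast
      fix a assume a: "a \<in> \<delta> ` I \<rightarrow>\<^sub>E carrier S \<and> finite {b \<in> \<delta> ` I. a b \<noteq> \<zero>\<^bsub>S\<^esub>} \<and> x = ?comb a"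
      show "a = ?a"
      proof (rule PiE_ext[of _ "\<delta> ` I" "\<lambda>_. carrier S"])
        fix b assume "b \<in> \<delta> ` I"
        then obtain i where "i \<in> I" "b = \<delta> i" by auto
        then show "a b = ?a b" using a comb(2)[of a i] inj by simp
      next
        show "a \<in> \<delta> ` I \<rightarrow>\<^sub>E carrier S" using a by blast
      qed (rule a1)
    qed
  qed
  then show ?thesis using F.module_axioms by (auto simp: free_module_def)
qed

lemma h_divisibleI:
  fixes R :: "('r, 'x) ring_scheme" and M :: "('r, 'm) module"
    and N :: "(('r \<times> 'r) set, 'n) module"
  assumes "cring R" and W: "submonoid W R" and M: "module R M" and N: "module (loc_ring R W) N"
    and g: "g \<in> mod_hom R (restrict_scalars (loc_map R W (regular_module R)) N) M"
    and surj: "g ` carrier N = carrier M"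
  shows "h_divisible R W M"
proof -
  let ?S = "loc_ring R W" and ?\<phi> = "loc_map R W (regular_module R)"
  let ?F = "free_on ?S (carrier M)"
  interpret R: cring R by fact
  interpret M: module R M by fact
  interpret N: module ?S N by fact
  have S: "cring ?S" by (rule N.R.cring_axioms)
  interpret F: module ?S ?F by (rule free_on_module[OF S])
  have g_closed: "g x \<in> carrier M" if "x \<in> carrier N" for x
    using mod_homD(2)[OF g] that by (simp add: restrict_scalars_def)
  have g_add: "g (x \<oplus>\<^bsub>N\<^esub> y) = g x \<oplus>\<^bsub>M\<^esub> g y" if "x \<in> carrier N" "y \<in> carrier N" for x y
    using mod_homD(3)[OF g] that by (simp add: restrict_scalars_def)
  have g_smult: "g (?\<phi> r \<odot>\<^bsub>N\<^esub> x) = r \<odot>\<^bsub>M\<^esub> g x" if "r \<in> carrier R" "x \<in> carrier N" for r x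
    using mod_homD(4)[OF g] that by (simp add: restrict_scalars_def)
  have \<phi>: "?\<phi> r \<in> carrier ?S" if "r \<in> carrier R" for r
    using that submonoid.one_closed[OF W]
    by (auto simp: loc_map_def loc_ring_def loc_regular_def loc_module_def)
  define n where "n = inv_into (carrier N) g"
  have n: "n m \<in> carrier N" "g (n m) = m" if "m \<in> carrier M" for m
    using that surj by (auto simp: n_def inv_into_into f_inv_into_f)
  define supp where "supp = (\<lambda>a :: 'm \<Rightarrow> _. {m \<in> carrier M. a m \<noteq> \<zero>\<^bsub>?S\<^esub>})"
  define \<sigma> where "\<sigma> = (\<lambda>a. \<Oplus>\<^bsub>N\<^esub>m\<in>supp a. a m \<odot>\<^bsub>N\<^esub> n m)"
  have F: "a m \<in> carrier ?S" "finite (supp a)" if "a \<in> carrier ?F" "m \<in> carrier M" for a m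
    using that by (auto simp: free_on_def supp_def)
  have F_fin: "finite (supp a)" if "a \<in> carrier ?F" for a
    using that by (auto simp: free_on_def supp_def)
  have trm: "(\<lambda>m. a m \<odot>\<^bsub>N\<^esub> n m) \<in> T \<rightarrow> carrier N" if "a \<in> carrier ?F" "T \<subseteq> carrier M" for a T
    using that F(1)[OF that(1)] n(1) by blast
  have \<sigma>_eq: "\<sigma> a = (\<Oplus>\<^bsub>N\<^esub>m\<in>T. a m \<odot>\<^bsub>N\<^esub> n m)"
    if "a \<in> carrier ?F" "supp a \<subseteq> T" "T \<subseteq> carrier M" "finite T" for a T
    unfolding \<sigma>_def
  proof (rule N.M.add.finprod_mono_neutral_cong_left)
    show "a i \<odot>\<^bsub>N\<^esub> n i = \<zero>\<^bsub>N\<^esub>" if "i \<in> T - supp a" for i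
      using that \<open>T \<subseteq> carrier M\<close> n(1)[of i] by (auto simp: supp_def)
    show "(\<lambda>m. a m \<odot>\<^bsub>N\<^esub> n m) \<in> T \<rightarrow> carrier N" by (rule trm) (rule that)+
  qed (use that in auto)
  have \<sigma>N: "\<sigma> a \<in> carrier N" if "a \<in> carrier ?F" for a
    unfolding \<sigma>_def by (rule N.M.finsum_closed, rule trm[OF that]) (auto simp: supp_def)
  have supp_sub: "supp a \<subseteq> carrier M" for a by (auto simp: supp_def)
  have \<sigma>_add: "\<sigma> (a \<oplus>\<^bsub>?F\<^esub> b) = \<sigma> a \<oplus>\<^bsub>N\<^esub> \<sigma> b" if a: "a \<in> carrier ?F" and b: "b \<in> carrier ?F" for a b
  proof -
    let ?T = "supp a \<union> supp b"
    have T: "finite ?T" "?T \<subseteq> carrier M" using F_fin a b supp_sub by auto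
    have s: "supp (a \<oplus>\<^bsub>?F\<^esub> b) \<subseteq> ?T"
      by (auto simp: supp_def free_on_def)
    have "\<sigma> (a \<oplus>\<^bsub>?F\<^esub> b) = (\<Oplus>\<^bsub>N\<^esub>m\<in>?T. (a \<oplus>\<^bsub>?F\<^esub> b) m \<odot>\<^bsub>N\<^esub> n m)"
      by (rule \<sigma>_eq) (use T s a b in auto)
    also have "\<dots> = (\<Oplus>\<^bsub>N\<^esub>m\<in>?T. a m \<odot>\<^bsub>N\<^esub> n m \<oplus>\<^bsub>N\<^esub> b m \<odot>\<^bsub>N\<^esub> n m)"
    proof (rule N.M.finsum_cong')
      show "(\<lambda>m. a m \<odot>\<^bsub>N\<^esub> n m \<oplus>\<^bsub>N\<^esub> b m \<odot>\<^bsub>N\<^esub> n m) \<in> ?T \<rightarrow> carrier N"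
        using trm[OF a T(2)] trm[OF b T(2)] by (auto simp: Pi_iff)
      fix m assume m: "m \<in> ?T"
      then have "m \<in> carrier M" using T by auto
      then show "(a \<oplus>\<^bsub>?F\<^esub> b) m \<odot>\<^bsub>N\<^esub> n m = a m \<odot>\<^bsub>N\<^esub> n m \<oplus>\<^bsub>N\<^esub> b m \<odot>\<^bsub>N\<^esub> n m"
        using F(1)[OF a] F(1)[OF b] n(1)
        by (simp add: free_on_def N.smult_l_distr)
    qed simp
    also have "\<dots> = (\<Oplus>\<^bsub>N\<^esub>m\<in>?T. a m \<odot>\<^bsub>N\<^esub> n m) \<oplus>\<^bsub>N\<^esub> (\<Oplus>\<^bsub>N\<^esub>m\<in>?T. b m \<odot>\<^bsub>N\<^esub> n m)"
      by (rule N.M.finsum_addf[OF trm[OF a T(2)] trm[OF b T(2)]])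
    also have "\<dots> = \<sigma> a \<oplus>\<^bsub>N\<^esub> \<sigma> b"
      using \<sigma>_eq[OF a _ T(2,1)] \<sigma>_eq[OF b _ T(2,1)] by simp
    finally show ?thesis .
  qed
  have \<sigma>_smult: "\<sigma> (s \<odot>\<^bsub>?F\<^esub> a) = s \<odot>\<^bsub>N\<^esub> \<sigma> a" if s: "s \<in> carrier ?S" and a: "a \<in> carrier ?F" for s a
  proof -
    have sub: "supp (s \<odot>\<^bsub>?F\<^esub> a) \<subseteq> supp a"
    proof
      fix m assume "m \<in> supp (s \<odot>\<^bsub>?F\<^esub> a)"
      then have m: "m \<in> carrier M" "s \<otimes>\<^bsub>?S\<^esub> a m \<noteq> \<zero>\<^bsub>?S\<^esub>" by (auto simp: supp_def free_on_def split: if_splits)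
      then have "a m \<noteq> \<zero>\<^bsub>?S\<^esub>" using N.R.r_null[OF s] by metis
      then show "m \<in> supp a" using m(1) by (simp add: supp_def)
    qed
    have "\<sigma> (s \<odot>\<^bsub>?F\<^esub> a) = (\<Oplus>\<^bsub>N\<^esub>m\<in>supp a. (s \<odot>\<^bsub>?F\<^esub> a) m \<odot>\<^bsub>N\<^esub> n m)"
      by (rule \<sigma>_eq) (use s a sub supp_sub F_fin in auto)
    also have "\<dots> = (\<Oplus>\<^bsub>N\<^esub>m\<in>supp a. s \<odot>\<^bsub>N\<^esub> (a m \<odot>\<^bsub>N\<^esub> n m))"
    proof (rule N.M.finsum_cong')
      show "(\<lambda>m. s \<odot>\<^bsub>N\<^esub> (a m \<odot>\<^bsub>N\<^esub> n m)) \<in> supp a \<rightarrow> carrier N"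
        using trm[OF a supp_sub] s by (auto simp: Pi_iff)
      fix m assume "m \<in> supp a"
      then have "m \<in> carrier M" using supp_sub by auto
      then show "(s \<odot>\<^bsub>?F\<^esub> a) m \<odot>\<^bsub>N\<^esub> n m = s \<odot>\<^bsub>N\<^esub> (a m \<odot>\<^bsub>N\<^esub> n m)"
        using F(1)[OF a] n(1) s by (simp add: free_on_def N.smult_assoc1)
    qed simp
    also have "\<dots> = s \<odot>\<^bsub>N\<^esub> \<sigma> a"
      unfolding \<sigma>_def by (rule N.finsum_smult_ldistr[symmetric, OF F_fin[OF a] s trm[OF a supp_sub]])
    finally show ?thesis .
  qed
  define h where "h = (\<lambda>a\<in>carrier ?F. g (\<sigma> a))"
  have "h \<in> mod_hom R (restrict_scalars ?\<phi> ?F) M"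
  proof (rule mod_homI)
    show "h \<in> carrier (restrict_scalars ?\<phi> ?F) \<rightarrow>\<^sub>E carrier M"
      by (auto simp: h_def restrict_scalars_def intro: g_closed \<sigma>N)
  next
    fix a b assume "a \<in> carrier (restrict_scalars ?\<phi> ?F)" "b \<in> carrier (restrict_scalars ?\<phi> ?F)"
    then have ab: "a \<in> carrier ?F" "b \<in> carrier ?F" by (simp_all add: restrict_scalars_def)
    then have "h (a \<oplus>\<^bsub>?F\<^esub> b) = h a \<oplus>\<^bsub>M\<^esub> h b"
      using F.M.a_closed[OF ab] \<sigma>_add[OF ab] g_add[OF \<sigma>N[OF ab(1)] \<sigma>N[OF ab(2)]] by (simp add: h_def)
    then show "h (a \<oplus>\<^bsub>restrict_scalars ?\<phi> ?F\<^esub> b) = h a \<oplus>\<^bsub>M\<^esub> h b"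
      by (simp add: restrict_scalars_def)
  next
    fix r a assume r: "r \<in> carrier R" and "a \<in> carrier (restrict_scalars ?\<phi> ?F)"
    then have a: "a \<in> carrier ?F" by (simp add: restrict_scalars_def)
    have "h (?\<phi> r \<odot>\<^bsub>?F\<^esub> a) = r \<odot>\<^bsub>M\<^esub> h a"
      using F.smult_closed[OF \<phi>[OF r] a] a \<sigma>_smult[OF \<phi>[OF r] a] g_smult[OF r \<sigma>N[OF a]]
      by (simp add: h_def)
    then show "h (r \<odot>\<^bsub>restrict_scalars ?\<phi> ?F\<^esub> a) = r \<odot>\<^bsub>M\<^esub> h a"
      by (simp add: restrict_scalars_def)
  qed
  moreover have "h ` carrier ?F = carrier M"
  proof
    show "h ` carrier ?F \<subseteq> carrier M" by (auto simp: h_def intro: g_closed \<sigma>N)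
    show "carrier M \<subseteq> h ` carrier ?F"
    proof
      fix m assume m: "m \<in> carrier M"
      let ?a = "\<lambda>i\<in>carrier M. if i = m then \<one>\<^bsub>?S\<^esub> else \<zero>\<^bsub>?S\<^esub>"
      have a: "?a \<in> carrier ?F"
        by (auto simp: free_on_def intro: finite_subset[of _ "{m}"] split: if_splits)
      have "\<sigma> ?a = (\<Oplus>\<^bsub>N\<^esub>i\<in>{m}. ?a i \<odot>\<^bsub>N\<^esub> n i)"
        by (rule \<sigma>_eq[OF a]) (use m in \<open>auto simp: supp_def split: if_splits\<close>)
      then have "\<sigma> ?a = n m" using n[OF m] m by simp
      then have "h ?a = m" using a n[OF m] by (simp add: h_def)
      then show "m \<in> h ` carrier ?F" by (intro image_eqI[OF _ a]) (rule sym)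
    qed
  qed
  ultimately show ?thesis
    unfolding h_divisible_def using free_on_free[OF S] by blast
qed

end

theory Submission
  imports Defs
begin

text \<open>The submodule \<open>div\<^sub>W M\<close> is the largest \<open>W\<close>-divisible submodule of \<open>M\<close>, and \<open>tr M\<close> for \<open>W\<^sup>-\<^sup>1R\<close> consists
  of the values \<open>f 1\<close> of homomorphisms \<open>f\<close> from \<open>W\<^sup>-\<^sup>1R\<close> to \<open>M\<close>.  For a Matlis-dualizable \<open>M\<close> it
  suffices to show that every \<open>x \<in> \<Inter>\<^sub>w wM\<close> is such a value.  Evaluation at \<open>x\<close> kills the torsion
  of \<open>M\<^sup>\<or>\<close>: if \<open>w d = 0\<close> and \<open>x = w z\<close>, then \<open>d x = (w d) z = 0\<close>.  As \<open>E\<close> is injective, it extends to some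
  \<open>h\<close> from \<open>W\<^sup>-\<^sup>1M\<^sup>\<or>\<close> to \<open>E\<close>, and the functionals \<open>d \<mapsto> h (d/w)\<close> on \<open>M\<^sup>\<or>\<close> are evaluations at elements
  \<open>y w\<close> of \<open>M\<close>, which define \<open>f\<close> by \<open>f (1/w) = y w\<close>.  For the smile dual, the functionals vanishing
  on \<open>to\<^sub>W M\<close> form a \<open>W\<close>-divisible submodule of \<open>M\<^sup>\<or>\<close> by injectivity of \<open>E\<close>, and they separate the points
  outside \<open>to\<^sub>W M\<close> because \<open>E\<close> is a cogenerator.\<close>

section \<open>Submodules and homomorphisms\<close>

context module
begin

text \<open>Closure under negatives, which \<open>submoduleI\<close> demands, comes from scalar
  multiplication by -1.\<close>

lemma submodule_criterion:
  assumes "H \<subseteq> carrier M" "\<zero>\<^bsub>M\<^esub> \<in> H"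
    and "\<And>a b. a \<in> H \<Longrightarrow> b \<in> H \<Longrightarrow> a \<oplus>\<^bsub>M\<^esub> b \<in> H"
    and smult: "\<And>r a. r \<in> carrier R \<Longrightarrow> a \<in> H \<Longrightarrow> r \<odot>\<^bsub>M\<^esub> a \<in> H"
  shows "submodule H R M"
proof (rule submoduleI)
  fix a assume a: "a \<in> H"
  then have "a \<in> carrier M" using assms(1) by blast
  then have "\<ominus>\<^bsub>M\<^esub> a = (\<ominus> \<one>) \<odot>\<^bsub>M\<^esub> a" by (simp add: smult_l_minus)
  then show "\<ominus>\<^bsub>M\<^esub> a \<in> H" using smult[OF _ a] by simp
qed (use assms in auto)

lemma submodule_finsum_closed:
  assumes "submodule K R M" "finite A" "f \<in> A \<rightarrow> K"
  shows "finsum M f A \<in> K"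
  using assms(2,3)
proof (induction A rule: finite_induct)
  case empty
  show ?case using subgroup.one_closed[OF submodule.axioms(1)[OF assms(1)]] by simp
next
  case (insert a A)
  then have "f \<in> A \<rightarrow> carrier M" "f a \<in> carrier M"
    using submoduleE(1)[OF assms(1)] by auto
  then show ?case
    using insert submoduleE(5)[OF assms(1), of "f a" "finsum M f A"] by simp
qed

lemma submodule_zero: "submodule K R M \<Longrightarrow> \<zero>\<^bsub>M\<^esub> \<in> K"
  using subgroup.one_closed[OF submodule.axioms(1)] by fastforce

end

section \<open>Sums of submodules\<close>

context
  fixes R (structure) and M :: "('a, 'c) module"
  assumes M: "module R M"
begin

interpretation module R M by (rule M)

text \<open>With the next two lemmas this characterises \<open>submodule_sum\<close> as the join of
  a set of submodules. Explicit finite sums are unfolded later only to prove that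
  \<open>div_W\<close> is divisible.\<close>

lemma submodule_sum_upper:
  assumes "H \<in> \<H>" "H \<subseteq> carrier M"
  shows "H \<subseteq> submodule_sum M \<H>"
proof
  fix x assume "x \<in> H"
  then have "x = finsum M (\<lambda>_. x) {H}" using assms(2) by auto
  then show "x \<in> submodule_sum M \<H>"
    unfolding submodule_sum_def using assms(1) \<open>x \<in> H\<close>
    by (intro CollectI exI[of _ "\<lambda>_. x"] exI[of _ "{H}"]) auto
qed

lemma submodule_sum_least:
  assumes "submodule K R M" "\<And>H. H \<in> \<H> \<Longrightarrow> H \<subseteq> K"
  shows "submodule_sum M \<H> \<subseteq> K"
proof
  fix z assume "z \<in> submodule_sum M \<H>"
  then obtain x \<F> where "finite \<F>" "\<F> \<subseteq> \<H>" "\<forall>H\<in>\<F>. x H \<in> H" "z = finsum M x \<F>"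
    by (auto simp: submodule_sum_def)
  then show "z \<in> K"
    using assms by (auto intro!: submodule_finsum_closed)
qed

lemma submodule_sum_submodule:
  assumes sub: "\<And>H. H \<in> \<H> \<Longrightarrow> submodule H R M"
  shows "submodule (submodule_sum M \<H>) R M"
proof (rule submodule_criterion)
  have c: "x \<in> \<F> \<rightarrow> carrier M" if "\<F> \<subseteq> \<H>" "\<forall>H\<in>\<F>. x H \<in> H" for x \<F>
    using that submoduleE(1)[OF sub] by blast
  show "submodule_sum M \<H> \<subseteq> carrier M"
    using c by (auto simp: submodule_sum_def intro!: M.finsum_closed)
  show "\<zero>\<^bsub>M\<^esub> \<in> submodule_sum M \<H>"
    unfolding submodule_sum_def by (intro CollectI exI[of _ "\<lambda>_. \<zero>\<^bsub>M\<^esub>"] exI[of _ "{}"]) auto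
  fix a assume "a \<in> submodule_sum M \<H>"
  then obtain x \<F> where x: "finite \<F>" "\<F> \<subseteq> \<H>" "\<forall>H\<in>\<F>. x H \<in> H" "a = finsum M x \<F>"
    by (auto simp: submodule_sum_def)
  {
    fix b assume "b \<in> submodule_sum M \<H>"
    then obtain y \<G> where y: "finite \<G>" "\<G> \<subseteq> \<H>" "\<forall>H\<in>\<G>. y H \<in> H" "b = finsum M y \<G>"
      by (auto simp: submodule_sum_def)
    \<comment> \<open>Both choices of summands are extended by zero to the union of the index sets,
      so that the two sums can be added pointwise. The default zero is admissible because it lies in
      every submodule.\<close>
    define x' where "x' = (\<lambda>H. if H \<in> \<F> then x H else \<zero>\<^bsub>M\<^esub>)"
    define y' where "y' = (\<lambda>H. if H \<in> \<G> then y H else \<zero>\<^bsub>M\<^esub>)"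
    have m: "x' H \<in> H" "y' H \<in> H" if "H \<in> \<F> \<union> \<G>" for H
      using that x(2,3) y(2,3) submodule_zero[OF sub] by (auto simp: x'_def y'_def)
    have c': "x' \<in> \<F> \<union> \<G> \<rightarrow> carrier M" "y' \<in> \<F> \<union> \<G> \<rightarrow> carrier M"
      using c[of "\<F> \<union> \<G>"] m x(2) y(2) by simp_all
    have "a = finsum M x' (\<F> \<union> \<G>)" unfolding x(4)
      by (rule M.add.finprod_mono_neutral_cong_left)
        (use c' x(1) y(1) in \<open>auto simp: x'_def\<close>)
    moreover have "b = finsum M y' (\<F> \<union> \<G>)" unfolding y(4)
      by (rule M.add.finprod_mono_neutral_cong_left)
        (use c' x(1) y(1) in \<open>auto simp: y'_def\<close>)
    ultimately have "a \<oplus>\<^bsub>M\<^esub> b = finsum M (\<lambda>H. x' H \<oplus>\<^bsub>M\<^esub> y' H) (\<F> \<union> \<G>)"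
      using M.finsum_addf[OF c'] by simp
    moreover have "\<forall>H\<in>\<F> \<union> \<G>. x' H \<oplus>\<^bsub>M\<^esub> y' H \<in> H"
      using m x(2) y(2) submoduleE(5)[OF sub] by blast
    ultimately show "a \<oplus>\<^bsub>M\<^esub> b \<in> submodule_sum M \<H>"
      unfolding submodule_sum_def using x(1,2) y(1,2)
      by (intro CollectI exI[of _ "\<lambda>H. x' H \<oplus>\<^bsub>M\<^esub> y' H"] exI[of _ "\<F> \<union> \<G>"]) auto
  next
    fix r assume r: "r \<in> carrier R"
    have "r \<odot>\<^bsub>M\<^esub> a = finsum M (\<lambda>H. r \<odot>\<^bsub>M\<^esub> x H) \<F>"
      unfolding x(4) by (rule finsum_smult_ldistr[OF x(1) r c[OF x(2,3)]])
    moreover have "\<forall>H\<in>\<F>. r \<odot>\<^bsub>M\<^esub> x H \<in> H"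
      using x(2,3) r submoduleE(4)[OF sub] by blast
    ultimately show "r \<odot>\<^bsub>M\<^esub> a \<in> submodule_sum M \<H>"
      unfolding submodule_sum_def using x(1,2)
      by (intro CollectI exI[of _ "\<lambda>H. r \<odot>\<^bsub>M\<^esub> x H"] exI[of _ \<F>]) auto
  }
qed

end

section \<open>Images, inverses and quotient maps\<close>

lemma mod_hom_zero:
  assumes "module R M" "module R N" "f \<in> mod_hom R M N"
  shows "f \<zero>\<^bsub>M\<^esub> = \<zero>\<^bsub>N\<^esub>"
proof -
  interpret M: module R M by fact
  interpret N: module R N by fact
  show ?thesis
    using mod_homD(4)[OF assms(3), of "\<zero>\<^bsub>R\<^esub>" "\<zero>\<^bsub>M\<^esub>"] mod_homD(2)[OF assms(3), of "\<zero>\<^bsub>M\<^esub>"] by simp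
qed

lemma mod_hom_image_submodule:
  assumes "module R M" "module R N" and f: "f \<in> mod_hom R M N" and K: "submodule K R M"
  shows "submodule (f ` K) R N"
proof -
  interpret M: module R M by fact
  interpret N: module R N by fact
  note KM = M.submoduleE(1)[OF K, THEN subsetD]
  show ?thesis
  proof (rule N.submodule_criterion)
    show "f ` K \<subseteq> carrier N" using KM mod_homD(2)[OF f] by blast
    show "\<zero>\<^bsub>N\<^esub> \<in> f ` K"
      using mod_hom_zero[OF assms(1-3)] M.submodule_zero[OF K] by (metis imageI)
    fix a assume "a \<in> f ` K"
    then obtain x where x: "x \<in> K" "a = f x" by blast
    { fix b assume "b \<in> f ` K"
      then obtain y where y: "y \<in> K" "b = f y" by blast
      show "a \<oplus>\<^bsub>N\<^esub> b \<in> f ` K"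
        using mod_homD(3)[OF f KM KM] x y M.submoduleE(5)[OF K x(1) y(1)] by (metis imageI) }
    { fix r assume "r \<in> carrier R"
      then show "r \<odot>\<^bsub>N\<^esub> a \<in> f ` K"
        using mod_homD(4)[OF f _ KM] x M.submoduleE(4)[OF K _ x(1)] by (metis imageI) }
  qed
qed

text \<open>The inverse is cut off outside \<open>carrier N\<close> because homomorphisms are
  extensional.\<close>

lemma mod_iso_inverse:
  assumes M: "module R M" and g: "g \<in> mod_iso R M N"
  shows "restrict (inv_into (carrier M) g) (carrier N) \<in> mod_hom R N M"
proof -
  interpret M: module R M by fact
  let ?h = "inv_into (carrier M) g"
  have g: "g \<in> mod_hom R M N" and b: "bij_betw g (carrier M) (carrier N)"
    using g by (auto simp: mod_iso_def)
  have h: "?h y \<in> carrier M" "g (?h y) = y" if "y \<in> carrier N" for y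
    using that b by (auto simp: bij_betw_def inv_into_into f_inv_into_f)
  have eq: "?h z = x" "z \<in> carrier N" if "x \<in> carrier M" "g x = z" for x z
    using that b mod_homD(2)[OF g] by (auto simp: bij_betw_def)
  show ?thesis
  proof (rule mod_homI)
    fix x y assume xy: "x \<in> carrier N" "y \<in> carrier N"
    then have "g (?h x \<oplus>\<^bsub>M\<^esub> ?h y) = x \<oplus>\<^bsub>N\<^esub> y" by (simp add: mod_homD(3)[OF g] h)
    then show "restrict ?h (carrier N) (x \<oplus>\<^bsub>N\<^esub> y) =
        restrict ?h (carrier N) x \<oplus>\<^bsub>M\<^esub> restrict ?h (carrier N) y"
      using xy eq[of "?h x \<oplus>\<^bsub>M\<^esub> ?h y" "x \<oplus>\<^bsub>N\<^esub> y"] by (simp add: h)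
  next
    fix r x assume rx: "r \<in> carrier R" "x \<in> carrier N"
    then have "g (r \<odot>\<^bsub>M\<^esub> ?h x) = r \<odot>\<^bsub>N\<^esub> x" by (simp add: mod_homD(4)[OF g] h)
    then show "restrict ?h (carrier N) (r \<odot>\<^bsub>N\<^esub> x) = r \<odot>\<^bsub>M\<^esub> restrict ?h (carrier N) x"
      using rx eq[of "r \<odot>\<^bsub>M\<^esub> ?h x" "r \<odot>\<^bsub>N\<^esub> x"] by (simp add: h)
  qed (use h in auto)
qed

text \<open>Functoriality along \<open>g\<close> gives one inclusion of the isomorphism condition,
  functoriality along the inverse of \<open>g\<close> the other. This is why both orders of the two
  instances are assumed.\<close>

lemma submodule_selectorI:
  fixes \<alpha> :: "('r, 'm) module \<Rightarrow> 'm set" and \<alpha>' :: "('r, 'n) module \<Rightarrow> 'n set"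
  assumes "\<And>M. module R M \<Longrightarrow> submodule (\<alpha> M) R M" "\<And>N. module R N \<Longrightarrow> submodule (\<alpha>' N) R N"
    and "functorial_selector R \<alpha> \<alpha>'" "functorial_selector R \<alpha>' \<alpha>"
  shows "submodule_selector R \<alpha> \<alpha>'"
proof -
  have "\<alpha>' N \<subseteq> g ` \<alpha> M" if M: "module R M" and N: "module R N" and g: "g \<in> mod_iso R M N"
    for M :: "('r, 'm) module" and N :: "('r, 'n) module" and g
  proof
    fix y assume y: "y \<in> \<alpha>' N"
    let ?h = "inv_into (carrier M) g"
    have yN: "y \<in> carrier N" using module.submoduleE(1)[OF N assms(2)[OF N]] y by blast
    have "restrict ?h (carrier N) ` \<alpha>' N \<subseteq> \<alpha> M"
      using assms(4) M N mod_iso_inverse[OF M g] unfolding functorial_selector_def by blast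
    then have "?h y \<in> \<alpha> M" using y yN by (auto simp: image_subset_iff)
    moreover have "g (?h y) = y"
      using g yN by (auto simp: mod_iso_def bij_betw_def f_inv_into_f)
    ultimately show "y \<in> g ` \<alpha> M" by (metis imageI)
  qed
  moreover have "g ` \<alpha> M \<subseteq> \<alpha>' N" if "module R M" "module R N" "g \<in> mod_iso R M N"
    for M :: "('r, 'm) module" and N :: "('r, 'n) module" and g
    using assms(3) that unfolding functorial_selector_def mod_iso_def by blast
  ultimately show ?thesis
    using assms(1,2) unfolding submodule_selector_def by (meson subset_antisym)
qed

text \<open>Later proofs handle quotients mostly through these three facts instead of coset
  arithmetic.\<close>

lemma quot_map_hom:
  assumes "module R M" and H: "submodule H R M"
  shows "quot_map M H \<in> mod_hom R M (quot_module M H)"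
    and "carrier (quot_module M H) = quot_map M H ` carrier M"
    and "\<And>x. x \<in> carrier M \<Longrightarrow> quot_map M H x = \<zero>\<^bsub>quot_module M H\<^esub> \<longleftrightarrow> x \<in> H"
proof -
  interpret M: module R M by fact
  interpret S: submodule H R M by fact
  interpret A: abelian_subgroup H M
    by (rule abelian_subgroupI3) (unfold_locales)
  show im: "carrier (quot_module M H) = quot_map M H ` carrier M"
    by (auto simp: quot_module_def A_RCOSETS_def' quot_map_def)
  show "quot_map M H x = \<zero>\<^bsub>quot_module M H\<^esub> \<longleftrightarrow> x \<in> H" if x: "x \<in> carrier M" for x
    using A.a_rcos_self[OF x] A.a_rcos_const x by (auto simp: quot_map_def quot_module_def)
  show "quot_map M H \<in> mod_hom R M (quot_module M H)"
  proof (rule mod_homI)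
    show "quot_map M H \<in> carrier M \<rightarrow>\<^sub>E carrier (quot_module M H)"
      using im by (auto simp: quot_map_def)
    show "quot_map M H (x \<oplus>\<^bsub>M\<^esub> y) = quot_map M H x \<oplus>\<^bsub>quot_module M H\<^esub> quot_map M H y"
      if "x \<in> carrier M" "y \<in> carrier M" for x y
      using that A.a_rcos_sum[OF that] by (simp add: quot_map_def quot_module_def)
    fix r x assume r: "r \<in> carrier R" and x: "x \<in> carrier M"
    \<comment> \<open>Scalar multiplication of cosets is a union over representatives. It collapses
      because every representative yields the same coset.\<close>
    have "H +>\<^bsub>M\<^esub> (r \<odot>\<^bsub>M\<^esub> y) = H +>\<^bsub>M\<^esub> (r \<odot>\<^bsub>M\<^esub> x)" if y: "y \<in> H +>\<^bsub>M\<^esub> x" for y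
    proof -
      obtain h where h: "h \<in> H" "y = h \<oplus>\<^bsub>M\<^esub> x" using y by (auto simp: a_r_coset_def')
      then have "r \<odot>\<^bsub>M\<^esub> y = r \<odot>\<^bsub>M\<^esub> h \<oplus>\<^bsub>M\<^esub> r \<odot>\<^bsub>M\<^esub> x"
        using r x A.a_Hcarr by (simp add: M.smult_r_distr)
      then have "r \<odot>\<^bsub>M\<^esub> y \<in> H +>\<^bsub>M\<^esub> (r \<odot>\<^bsub>M\<^esub> x)"
        using S.smult_closed[OF r h(1)] by (auto simp: a_r_coset_def')
      then show ?thesis using A.a_repr_independence'[of _ "r \<odot>\<^bsub>M\<^esub> x"] r x by simp
    qed
    then have "(\<Union>y\<in>H +>\<^bsub>M\<^esub> x. H +>\<^bsub>M\<^esub> (r \<odot>\<^bsub>M\<^esub> y)) = H +>\<^bsub>M\<^esub> (r \<odot>\<^bsub>M\<^esub> x)"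
      using A.a_rcos_self[OF x] by blast
    then show "quot_map M H (r \<odot>\<^bsub>M\<^esub> x) = r \<odot>\<^bsub>quot_module M H\<^esub> quot_map M H x"
      using r x by (simp add: quot_map_def quot_module_def)
  qed
qed


section \<open>Torsion and divisible submodules\<close>

lemma W_divisible_carrier_iff:
  "W_divisible W (M\<lparr>carrier := D\<rparr>) \<longleftrightarrow> (\<forall>w\<in>W. (\<lambda>x. w \<odot>\<^bsub>M\<^esub> x) ` D = D)"
  by (simp add: W_divisible_def)

context localization
begin

text \<open>If \<open>w\<close> kills \<open>a\<close> and \<open>v\<close> kills \<open>b\<close>,
  the product of \<open>v\<close> and \<open>w\<close> is in \<open>W\<close> and kills both, hence
  their sum.\<close>

lemma to_W_submodule: "submodule (to_W R W M) R M"
proof (rule M.submodule_criterion)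
  fix a assume "a \<in> to_W R W M"
  then obtain w where a: "a \<in> carrier M" "w \<in> W" "w \<odot>\<^bsub>M\<^esub> a = \<zero>\<^bsub>M\<^esub>" by (auto simp: to_W_eq)
  { fix b assume "b \<in> to_W R W M"
    then obtain v where b: "b \<in> carrier M" "v \<in> W" "v \<odot>\<^bsub>M\<^esub> b = \<zero>\<^bsub>M\<^esub>" by (auto simp: to_W_eq)
    have "(v \<otimes> w) \<odot>\<^bsub>M\<^esub> a = \<zero>\<^bsub>M\<^esub>" using a b by (simp add: M.smult_assoc1)
    moreover have "(v \<otimes> w) \<odot>\<^bsub>M\<^esub> b = \<zero>\<^bsub>M\<^esub>"
      using a b by (simp add: M.R.m_comm[of v w] M.smult_assoc1)
    ultimately have "(v \<otimes> w) \<odot>\<^bsub>M\<^esub> (a \<oplus>\<^bsub>M\<^esub> b) = \<zero>\<^bsub>M\<^esub>" using a b by (simp add: M.smult_r_distr)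
    then show "a \<oplus>\<^bsub>M\<^esub> b \<in> to_W R W M" using a b W.m_closed[of v w] by (auto simp: to_W_eq) }
  { fix r assume r: "r \<in> carrier R"
    have "w \<odot>\<^bsub>M\<^esub> (r \<odot>\<^bsub>M\<^esub> a) = r \<odot>\<^bsub>M\<^esub> (w \<odot>\<^bsub>M\<^esub> a)"
      using r a(1,2) by (simp add: sm M.R.m_comm)
    then show "r \<odot>\<^bsub>M\<^esub> a \<in> to_W R W M" using r a by (auto simp: to_W_eq) }
qed (auto simp: to_W_eq intro: exI[of _ \<one>])

text \<open>In other words, the quotient of \<open>M\<close> by its torsion is torsion free. This
  gives co-idempotence and, in the dual, allows functionals vanishing on the torsion to be divided
  by \<open>w\<close>.\<close>

lemma to_W_saturated:
  assumes "x \<in> carrier M" "w \<in> W" "w \<odot>\<^bsub>M\<^esub> x \<in> to_W R W M"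
  shows "x \<in> to_W R W M"
proof -
  obtain v where "v \<in> W" "v \<odot>\<^bsub>M\<^esub> (w \<odot>\<^bsub>M\<^esub> x) = \<zero>\<^bsub>M\<^esub>" using assms by (auto simp: to_W_eq)
  then show ?thesis using assms W.m_closed[of v w] by (auto simp: to_W_eq sm)
qed

text \<open>Two elements with the same multiple by \<open>w\<close> differ by a torsion
  element.\<close>

lemma W_torsion_free_iff: "W_torsion_free W M \<longleftrightarrow> to_W R W M = {\<zero>\<^bsub>M\<^esub>}"
proof
  assume tf: "W_torsion_free W M"
  have "z = \<zero>\<^bsub>M\<^esub>" if "z \<in> carrier M" "w \<in> W" "w \<odot>\<^bsub>M\<^esub> z = \<zero>\<^bsub>M\<^esub>" for z w
    using tf that inj_onD[of "(\<odot>\<^bsub>M\<^esub>) w" "carrier M" z "\<zero>\<^bsub>M\<^esub>"] by (auto simp: W_torsion_free_def)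
  then show "to_W R W M = {\<zero>\<^bsub>M\<^esub>}"
    using M.submodule_zero[OF to_W_submodule] by (auto simp: to_W_eq)
next
  assume 0: "to_W R W M = {\<zero>\<^bsub>M\<^esub>}"
  show "W_torsion_free W M"
    unfolding W_torsion_free_def
  proof (intro ballI inj_onI)
    fix w x y assume w: "w \<in> W" and xy: "x \<in> carrier M" "y \<in> carrier M" "w \<odot>\<^bsub>M\<^esub> x = w \<odot>\<^bsub>M\<^esub> y"
    then have "w \<odot>\<^bsub>M\<^esub> (x \<ominus>\<^bsub>M\<^esub> y) = \<zero>\<^bsub>M\<^esub>"
      by (simp add: a_minus_def M.smult_r_distr M.smult_r_minus M.M.r_neg)
    then have "x \<ominus>\<^bsub>M\<^esub> y \<in> to_W R W M" using w xy by (auto simp: to_W_eq)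
    then have "x \<oplus>\<^bsub>M\<^esub> \<ominus>\<^bsub>M\<^esub> y = \<zero>\<^bsub>M\<^esub>" using 0 by (simp add: a_minus_def)
    then show "x = y"
      using xy by (metis M.M.minus_equality M.M.minus_minus M.M.add.inv_closed)
  qed
qed

lemma div_W_submodule: "submodule (div_W R W M) R M"
  unfolding div_W_def by (rule submodule_sum_submodule[OF M.module_axioms]) simp

text \<open>One inclusion per \<open>w\<close> suffices as hypothesis, since a submodule is already
  closed under multiplication by \<open>w\<close>.\<close>

lemma div_W_greatest:
  assumes "submodule D R M" "\<And>w. w \<in> W \<Longrightarrow> D \<subseteq> (\<lambda>x. w \<odot>\<^bsub>M\<^esub> x) ` D"
  shows "D \<subseteq> div_W R W M"
proof -
  have "W_divisible W (M\<lparr>carrier := D\<rparr>)"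
    using assms M.submoduleE(4)[OF assms(1)] by (auto simp: W_divisible_carrier_iff)
  then show ?thesis
    unfolding div_W_def using assms(1) M.submoduleE(1)[OF assms(1)]
    by (intro submodule_sum_upper[OF M.module_axioms]) auto
qed

text \<open>Division by \<open>w\<close> is carried out summand by summand: each summand has a
  quotient inside its own divisible submodule, and \<open>w\<close> is then pulled out of the
  sum.\<close>

lemma div_W_divisible: "W_divisible W (M\<lparr>carrier := div_W R W M\<rparr>)"
  unfolding W_divisible_carrier_iff
proof (intro ballI equalityI)
  fix w assume w: "w \<in> W"
  show "(\<lambda>x. w \<odot>\<^bsub>M\<^esub> x) ` div_W R W M \<subseteq> div_W R W M"
    using w M.submoduleE(4)[OF div_W_submodule] by auto
  show "div_W R W M \<subseteq> (\<lambda>x. w \<odot>\<^bsub>M\<^esub> x) ` div_W R W M"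
  proof
    fix z assume "z \<in> div_W R W M"
    then obtain x \<F> where x: "finite \<F>" "\<forall>H\<in>\<F>. x H \<in> H" "z = finsum M x \<F>"
      and \<F>: "\<F> \<subseteq> {D. submodule D R M \<and> W_divisible W (M\<lparr>carrier := D\<rparr>)}"
      by (auto simp: submodule_sum_def div_W_def)
    have "\<exists>y\<in>H. x H = w \<odot>\<^bsub>M\<^esub> y" if "H \<in> \<F>" for H
    proof -
      have "(\<lambda>x. w \<odot>\<^bsub>M\<^esub> x) ` H = H" using \<F> that w by (auto simp: W_divisible_carrier_iff)
      then show ?thesis using x(2) that by blast
    qed
    then obtain y where y: "\<And>H. H \<in> \<F> \<Longrightarrow> y H \<in> H \<and> x H = w \<odot>\<^bsub>M\<^esub> y H" by metis
    have yc: "y \<in> \<F> \<rightarrow> carrier M" using y \<F> M.submoduleE(1) by blast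
    have "z = finsum M (\<lambda>H. w \<odot>\<^bsub>M\<^esub> y H) \<F>"
      unfolding x(3) by (rule M.M.finsum_cong') (use y yc w in auto)
    also have "\<dots> = w \<odot>\<^bsub>M\<^esub> finsum M y \<F>"
      using M.finsum_smult_ldistr[OF x(1) Wc[OF w] yc] by simp
    finally show "z \<in> (\<lambda>x. w \<odot>\<^bsub>M\<^esub> x) ` div_W R W M"
      unfolding div_W_def submodule_sum_def using x(1) \<F> y by blast
  qed
qed

text \<open>Both directions express that \<open>div_W R W M\<close> is the largest divisible
  submodule.\<close>

lemma W_divisible_iff: "W_divisible W M \<longleftrightarrow> div_W R W M = carrier M"
proof
  assume "W_divisible W M"
  then show "div_W R W M = carrier M"
    using div_W_greatest[OF M.carrier_is_submodule] M.submoduleE(1)[OF div_W_submodule]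
    by (auto simp: W_divisible_def)
next
  assume "div_W R W M = carrier M"
  then show "W_divisible W M" using div_W_divisible by simp
qed

text \<open>This inclusion holds for every module. For Matlis-dualizable modules the reverse one is
  reached through the trace.\<close>

lemma div_W_subset: "div_W R W M \<subseteq> (\<Inter>w\<in>W. (\<lambda>x. w \<odot>\<^bsub>M\<^esub> x) ` carrier M)"
  using div_W_divisible M.submoduleE(1)[OF div_W_submodule]
  unfolding W_divisible_carrier_iff by blast

end

section \<open>Functoriality and idempotence of the selectors\<close>

lemma localizationI: "module R M \<Longrightarrow> submonoid W R \<Longrightarrow> localization R M W"
  by (simp add: localization_def)

lemma to_W_functorial:
  fixes R :: "('r, 'x) ring_scheme"
  assumes W: "submonoid W R"
  shows "functorial_selector R (to_W R W :: ('r, 'm) module \<Rightarrow> _) (to_W R W :: ('r, 'n) module \<Rightarrow> _)"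
  unfolding functorial_selector_def
proof (intro allI impI ballI)
  fix M :: "('r, 'm) module" and N :: "('r, 'n) module" and g
  assume M: "module R M" and N: "module R N" and g: "g \<in> mod_hom R M N"
  interpret M: localization R M W by (rule localizationI[OF M W])
  interpret N: localization R N W by (rule localizationI[OF N W])
  show "g ` to_W R W M \<subseteq> to_W R W N"
  proof (rule image_subsetI)
    fix x assume "x \<in> to_W R W M"
    then obtain w where w: "x \<in> carrier M" "w \<in> W" "w \<odot>\<^bsub>M\<^esub> x = \<zero>\<^bsub>M\<^esub>" by (auto simp: M.to_W_eq)
    then have "w \<odot>\<^bsub>N\<^esub> g x = \<zero>\<^bsub>N\<^esub>"
      using mod_homD(4)[OF g, of w x] mod_hom_zero[OF M N g] by simp
    then show "g x \<in> to_W R W N" using w mod_homD(2)[OF g] by (auto simp: N.to_W_eq)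
  qed
qed

text \<open>A homomorphic image of a divisible submodule is divisible, so it lies below the largest
  one.\<close>

lemma div_W_functorial:
  fixes R :: "('r, 'x) ring_scheme"
  assumes W: "submonoid W R"
  shows "functorial_selector R (div_W R W :: ('r, 'm) module \<Rightarrow> _) (div_W R W :: ('r, 'n) module \<Rightarrow> _)"
  unfolding functorial_selector_def
proof (intro allI impI ballI)
  fix M :: "('r, 'm) module" and N :: "('r, 'n) module" and g
  assume M: "module R M" and N: "module R N" and g: "g \<in> mod_hom R M N"
  interpret M: localization R M W by (rule localizationI[OF M W])
  interpret N: localization R N W by (rule localizationI[OF N W])
  show "g ` div_W R W M \<subseteq> div_W R W N"
  proof (rule N.div_W_greatest)
    show "submodule (g ` div_W R W M) R N"
      by (rule mod_hom_image_submodule[OF M N g M.div_W_submodule])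
    fix w assume w: "w \<in> W"
    show "g ` div_W R W M \<subseteq> (\<lambda>x. w \<odot>\<^bsub>N\<^esub> x) ` g ` div_W R W M"
    proof (rule image_subsetI)
      fix x assume "x \<in> div_W R W M"
      then obtain y where y: "y \<in> div_W R W M" "x = w \<odot>\<^bsub>M\<^esub> y"
        using M.div_W_divisible w unfolding W_divisible_carrier_iff by blast
      then have "g x = w \<odot>\<^bsub>N\<^esub> g y"
        using mod_homD(4)[OF g] w M.M.submoduleE(1)[OF M.div_W_submodule] by auto
      then show "g x \<in> (\<lambda>x. w \<odot>\<^bsub>N\<^esub> x) ` g ` div_W R W M" using y(1) by blast
    qed
  qed
qed

lemma to_W_idempotent:
  fixes R :: "('r, 'x) ring_scheme"
  assumes W: "submonoid W R"
  shows "idempotent_selector R (to_W R W :: ('r, 'm) module \<Rightarrow> _)"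
  unfolding idempotent_selector_def
proof (intro allI impI)
  fix M :: "('r, 'm) module" assume M: "module R M"
  interpret M: localization R M W by (rule localizationI[OF M W])
  interpret T: localization R "M\<lparr>carrier := to_W R W M\<rparr>" W
    by (rule localizationI[OF submodule.submodule_is_module[OF M.to_W_submodule M] W])
  show "to_W R W (M\<lparr>carrier := to_W R W M\<rparr>) = to_W R W M"
    unfolding T.to_W_eq by (auto simp: M.to_W_eq)
qed

text \<open>As a module, \<open>div_W R W M\<close> is divisible and therefore its own largest
  divisible submodule.\<close>

lemma div_W_idempotent:
  fixes R :: "('r, 'x) ring_scheme"
  assumes W: "submonoid W R"
  shows "idempotent_selector R (div_W R W :: ('r, 'm) module \<Rightarrow> _)"
  unfolding idempotent_selector_def
proof (intro allI impI)
  fix M :: "('r, 'm) module" assume M: "module R M"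
  interpret M: localization R M W by (rule localizationI[OF M W])
  interpret T: localization R "M\<lparr>carrier := div_W R W M\<rparr>" W
    by (rule localizationI[OF submodule.submodule_is_module[OF M.div_W_submodule M] W])
  show "div_W R W (M\<lparr>carrier := div_W R W M\<rparr>) = div_W R W M"
    using M.div_W_divisible T.W_divisible_iff by simp
qed

text \<open>If \<open>w\<close> kills the class of \<open>x\<close>, then \<open>w x\<close> is
  torsion, and saturation makes \<open>x\<close> torsion, so its class is zero.\<close>

lemma to_W_co_idempotent:
  fixes R :: "('r, 'x) ring_scheme"
  assumes W: "submonoid W R"
  shows "co_idempotent_selector R (to_W R W :: ('r, 'm) module \<Rightarrow> _) (to_W R W)"
  unfolding co_idempotent_selector_def
proof (intro allI impI)
  fix M :: "('r, 'm) module" assume M: "module R M"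
  interpret M: localization R M W by (rule localizationI[OF M W])
  let ?T = "to_W R W M" and ?Q = "quot_module M (to_W R W M)"
  interpret Q: localization R ?Q W
    by (rule localizationI[OF quot_module_module[OF M M.to_W_submodule] W])
  note q = quot_map_hom[OF M M.to_W_submodule]
  have "X = \<zero>\<^bsub>?Q\<^esub>" if X: "X \<in> to_W R W ?Q" for X
  proof -
    obtain w where w: "X \<in> carrier ?Q" "w \<in> W" "w \<odot>\<^bsub>?Q\<^esub> X = \<zero>\<^bsub>?Q\<^esub>" using X by (auto simp: Q.to_W_eq)
    then obtain x where x: "x \<in> carrier M" "X = quot_map M ?T x" using q(2) by auto
    then have "quot_map M ?T (w \<odot>\<^bsub>M\<^esub> x) = \<zero>\<^bsub>?Q\<^esub>" using w mod_homD(4)[OF q(1)] by simp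
    then have "x \<in> ?T" using q(3)[of "w \<odot>\<^bsub>M\<^esub> x"] w x M.to_W_saturated by simp
    then show ?thesis using q(3) x by simp
  qed
  then show "to_W R W ?Q = {\<zero>\<^bsub>?Q\<^esub>}" using Q.M.submodule_zero[OF Q.to_W_submodule] by blast
qed

text \<open>Homomorphisms from \<open>R/(w)\<close> to \<open>M\<close> correspond, through the
  image of the class of 1, to the elements killed by \<open>w\<close>. These elements already form a
  submodule, so the sum in the trace adds nothing.\<close>

lemma cyclic_trace_eq:
  assumes M: "module R M" and w: "w \<in> carrier R"
  shows "cyclic_trace R w M = {z \<in> carrier M. w \<odot>\<^bsub>M\<^esub> z = \<zero>\<^bsub>M\<^esub>}"
proof -
  interpret M: module R M by fact
  let ?I = "PIdl\<^bsub>R\<^esub> w" and ?P = "regular_module R"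
  let ?Q = "quot_module ?P ?I" and ?K = "{z \<in> carrier M. w \<odot>\<^bsub>M\<^esub> z = \<zero>\<^bsub>M\<^esub>}"
  have P: "module R ?P" by (rule regular_module_module) (rule M.R.cring_axioms)
  have I: "submodule ?I R ?P"
    by (rule submodule_regular_ideal[OF M.R.cgenideal_ideal[OF w] M.R.cring_axioms])
  have Q: "module R ?Q" by (rule quot_module_module[OF P I])
  interpret Q: module R ?Q by fact
  note q = quot_map_hom[OF P I]
  have K: "submodule ?K R M"
  proof (rule M.submodule_criterion)
    fix r a assume "r \<in> carrier R" "a \<in> ?K"
    then show "r \<odot>\<^bsub>M\<^esub> a \<in> ?K"
      using w M.smult_assoc1[of w r a] M.smult_assoc1[of r w a] by (simp add: M.R.m_comm)
  qed (use w in \<open>auto simp: M.smult_r_distr\<close>)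
  have "f ` carrier ?Q \<subseteq> ?K" if f: "f \<in> mod_hom R ?Q M" for f
  proof (rule image_subsetI)
    fix X assume X: "X \<in> carrier ?Q"
    then obtain x where x: "x \<in> carrier R" "X = quot_map ?P ?I x" using q(2) by auto
    have "x \<otimes>\<^bsub>R\<^esub> w \<in> ?I" using x by (auto simp: cgenideal_def)
    then have "w \<otimes>\<^bsub>R\<^esub> x \<in> ?I" using x w by (simp add: M.R.m_comm)
    then have "w \<odot>\<^bsub>?Q\<^esub> X = \<zero>\<^bsub>?Q\<^esub>"
      using mod_homD(4)[OF q(1) w, of x] q(3)[of "w \<otimes>\<^bsub>R\<^esub> x"] x w by simp
    then show "f X \<in> ?K"
      using X mod_homD(2)[OF f X] mod_homD(4)[OF f w X] mod_hom_zero[OF Q M f] by simp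
  qed
  then have "cyclic_trace R w M \<subseteq> ?K"
    unfolding cyclic_trace_def trace_def by (intro submodule_sum_least[OF M K]) blast
  moreover have "z \<in> cyclic_trace R w M" if z: "z \<in> carrier M" "w \<odot>\<^bsub>M\<^esub> z = \<zero>\<^bsub>M\<^esub>" for z
  proof -
    \<comment> \<open>The value at a coset is read off a chosen representative. Two representatives
      differ by a multiple of \<open>w\<close>, which kills \<open>z\<close>.\<close>
    define f where "f = (\<lambda>X\<in>carrier ?Q. (SOME r. r \<in> carrier R \<and> X = quot_map ?P ?I r) \<odot>\<^bsub>M\<^esub> z)"
    have f: "f (quot_map ?P ?I x) = x \<odot>\<^bsub>M\<^esub> z" if x: "x \<in> carrier R" for x
    proof -
      let ?r = "SOME r. r \<in> carrier R \<and> quot_map ?P ?I x = quot_map ?P ?I r"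
      have r: "?r \<in> carrier R" "quot_map ?P ?I x = quot_map ?P ?I ?r"
        using someI_ex[of "\<lambda>r. r \<in> carrier R \<and> quot_map ?P ?I x = quot_map ?P ?I r"] x by auto
      interpret A: abelian_subgroup ?I ?P
        by (rule abelian_subgroupI3)
          (use I P in \<open>auto simp: module_def submodule_def additive_subgroup_def\<close>)
      have "x \<in> ?I +>\<^bsub>?P\<^esub> ?r" using A.a_rcos_self[of x] x r by (simp add: quot_map_def)
      then obtain s where s: "s \<in> carrier R" "x = (s \<otimes>\<^bsub>R\<^esub> w) \<oplus>\<^bsub>R\<^esub> ?r"
        by (auto simp: a_r_coset_def' cgenideal_def)
      then have "x \<odot>\<^bsub>M\<^esub> z = ?r \<odot>\<^bsub>M\<^esub> z"
        using z w r(1) M.smult_l_distr[of "s \<otimes>\<^bsub>R\<^esub> w" ?r z] by (simp add: M.smult_assoc1)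
      moreover have "quot_map ?P ?I x \<in> carrier ?Q" using mod_homD(2)[OF q(1)] x by simp
      ultimately show ?thesis by (simp add: f_def)
    qed
    have "f \<in> mod_hom R ?Q M"
    proof (rule mod_homI)
      have "f X \<in> carrier M" if "X \<in> carrier ?Q" for X
        using that f z unfolding q(2) by auto
      then show "f \<in> carrier ?Q \<rightarrow>\<^sub>E carrier M" by (auto simp: f_def)
      fix X assume "X \<in> carrier ?Q"
      then obtain x where x: "x \<in> carrier R" "X = quot_map ?P ?I x" using q(2) by auto
      { fix Y assume "Y \<in> carrier ?Q"
        then obtain y where y: "y \<in> carrier R" "Y = quot_map ?P ?I y" using q(2) by auto
        have "X \<oplus>\<^bsub>?Q\<^esub> Y = quot_map ?P ?I (x \<oplus>\<^bsub>R\<^esub> y)"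
          using mod_homD(3)[OF q(1), of x y] x y by simp
        then show "f (X \<oplus>\<^bsub>?Q\<^esub> Y) = f X \<oplus>\<^bsub>M\<^esub> f Y" using x y z by (simp add: f M.smult_l_distr) }
      { fix r assume r: "r \<in> carrier R"
        have "r \<odot>\<^bsub>?Q\<^esub> X = quot_map ?P ?I (r \<otimes>\<^bsub>R\<^esub> x)"
          using mod_homD(4)[OF q(1), of r x] x r by simp
        then show "f (r \<odot>\<^bsub>?Q\<^esub> X) = r \<odot>\<^bsub>M\<^esub> f X" using x r z by (simp add: f M.smult_assoc1) }
    qed
    moreover have "z \<in> f ` carrier ?Q"
      using f[of "\<one>\<^bsub>R\<^esub>"] z mod_homD(2)[OF q(1), of "\<one>\<^bsub>R\<^esub>"]
      by (intro image_eqI[of _ _ "quot_map ?P ?I \<one>\<^bsub>R\<^esub>"]) auto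
    ultimately show ?thesis
      unfolding cyclic_trace_def trace_def
      using submodule_sum_upper[OF M, of "f ` carrier ?Q" "(\<lambda>f. f ` carrier ?Q) ` mod_hom R ?Q M"]
        mod_homD(2)[of f R ?Q M] by blast
  qed
  ultimately show ?thesis by blast
qed

section \<open>Homomorphisms from the localized ring\<close>

text \<open>A homomorphism \<open>f\<close> from \<open>W\<^sup>-\<^sup>1R\<close> to \<open>M\<close> is determined by the values \<open>y w = f (1/w)\<close>, and these
  can be prescribed subject to the relations below.\<close>

definition coherent_families ::
  "('r, 'x) ring_scheme \<Rightarrow> 'r set \<Rightarrow> ('r, 'm) module \<Rightarrow> ('r \<Rightarrow> 'm) set" where
  "coherent_families R W M = {y. \<forall>w\<in>W. y w \<in> carrier M \<and>
     (\<forall>v\<in>W. v \<odot>\<^bsub>M\<^esub> y (w \<otimes>\<^bsub>R\<^esub> v) = y w)}"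

context localization
begin

lemma regular_localization: "localization R (regular_module R) W"
  by (simp add: localizationI[OF regular_module_module[OF M.R.cring_axioms] W.submonoid_axioms])

lemma loc_map_hom: "loc_map R W M \<in> mod_hom R M (loc_module R W M)"
proof (rule mod_homI)
  show "loc_map R W M \<in> carrier M \<rightarrow>\<^sub>E carrier (loc_module R W M)"
    by (auto simp: loc_map_def intro!: carrierI)
qed (simp_all add: loc_map_def add_class smult_class)

lemma loc_map_eq_zero_iff:
  "x \<in> carrier M \<Longrightarrow> loc_map R W M x = \<zero>\<^bsub>loc_module R W M\<^esub> \<longleftrightarrow> x \<in> to_W R W M"
  by (simp add: to_W_def a_kernel_def kernel_def)

text \<open>Keeps a common denominator instead of the product formed by \<open>add_class\<close>. It
  yields additivity of \<open>d \<mapsto> h (d/w)\<close> in the duality argument.\<close>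

lemma add_class_same:
  assumes "x \<in> carrier M" "y \<in> carrier M" "w \<in> W"
  shows "cl x w \<oplus>\<^bsub>loc_module R W M\<^esub> cl y w = cl (x \<oplus>\<^bsub>M\<^esub> y) w"
  using assms
  by (simp add: add_class)
     (rule class_eqI[where u = \<one>], auto simp: M.smult_r_distr sm)

lemma class_cancel:
  assumes "x \<in> carrier M" "w \<in> W" "v \<in> W"
  shows "cl (v \<odot>\<^bsub>M\<^esub> x) (w \<otimes> v) = cl x w"
  using assms by (intro class_eqI[where u = \<one>]) (auto simp: sm M.R.m_ac)

text \<open>On the side of homomorphisms this is precomposition with multiplication by
  \<open>1/w\<close>.\<close>

lemma family_shift:
  assumes "y \<in> coherent_families R W M" "w \<in> W"
  shows "(\<lambda>v. y (w \<otimes> v)) \<in> coherent_families R W M"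
  using assms by (simp add: coherent_families_def M.R.m_assoc[symmetric])

text \<open>The homomorphism is \<open>r/w \<mapsto> r (y w)\<close>. The coherence relations are
  what makes it independent of the chosen fraction.\<close>

lemma hom_of_family:
  assumes y: "y \<in> coherent_families R W M"
  shows "\<exists>f\<in>mod_hom R (loc_regular R W) M.
    \<forall>r\<in>carrier R. \<forall>w\<in>W. f (loc_class R W (regular_module R) r w) = r \<odot>\<^bsub>M\<^esub> y w"
proof -
  interpret L: localization R "regular_module R" W by (rule regular_localization)
  have yc: "y w \<in> carrier M" and yy: "v \<odot>\<^bsub>M\<^esub> y (w \<otimes> v) = y w" if "w \<in> W" "v \<in> W" for w v
    using y that by (auto simp: coherent_families_def)
  have wd: "r \<odot>\<^bsub>M\<^esub> y w = s \<odot>\<^bsub>M\<^esub> y v"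
    if r: "r \<in> carrier R" "w \<in> W" and s: "s \<in> carrier R" "v \<in> W" and eq: "L.cl r w = L.cl s v"
    for r w s v
  proof -
    have "(s, v) \<in> L.cl r w" using L.class_self[of s v] s eq by simp
    then obtain u where u: "u \<in> W" "(u \<otimes> v) \<otimes> r = (u \<otimes> w) \<otimes> s"
      using L.class_memD(4)[of s v r w] r by (simp, elim bexE) blast
    \<comment> \<open>Equal fractions give \<open>u v r = u w s\<close> for some \<open>u\<close> in
      \<open>W\<close>. Both values are rewritten as multiples of \<open>y\<close> at the common
      denominator \<open>u w v\<close>.\<close>
    have "r \<odot>\<^bsub>M\<^esub> y w = r \<odot>\<^bsub>M\<^esub> ((u \<otimes> v) \<odot>\<^bsub>M\<^esub> y (w \<otimes> (u \<otimes> v)))"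
      using yy[of w "u \<otimes> v"] r s u(1) by simp
    also have "\<dots> = ((u \<otimes> v) \<otimes> r) \<odot>\<^bsub>M\<^esub> y (u \<otimes> w \<otimes> v)"
      using r s u(1) yc by (simp add: sm M.R.m_ac)
    also have "\<dots> = s \<odot>\<^bsub>M\<^esub> ((u \<otimes> w) \<odot>\<^bsub>M\<^esub> y (v \<otimes> (u \<otimes> w)))"
      unfolding u(2) using r s u(1) yc by (simp add: sm M.R.m_ac)
    also have "\<dots> = s \<odot>\<^bsub>M\<^esub> y v" using yy[of v "u \<otimes> w"] r s u(1) by simp
    finally show ?thesis .
  qed
  define f where "f = (\<lambda>X\<in>carrier (loc_regular R W).
    SOME m. \<exists>r\<in>carrier R. \<exists>w\<in>W. X = L.cl r w \<and> m = r \<odot>\<^bsub>M\<^esub> y w)"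
  have f: "f (L.cl r w) = r \<odot>\<^bsub>M\<^esub> y w" if r: "r \<in> carrier R" "w \<in> W" for r w
  proof -
    have "(SOME m. \<exists>s\<in>carrier R. \<exists>v\<in>W. L.cl r w = L.cl s v \<and> m = s \<odot>\<^bsub>M\<^esub> y v) = r \<odot>\<^bsub>M\<^esub> y w"
      by (rule some_equality) (use r wd in blast)+
    then show ?thesis using L.carrierI[of r w] r by (simp add: f_def loc_regular_def)
  qed
  have "f \<in> mod_hom R (loc_regular R W) M"
  proof (rule mod_homI)
    have "f X \<in> carrier M" if "X \<in> carrier (loc_regular R W)" for X
      using that f yc by (auto simp: loc_regular_def elim!: L.carrierE)
    then show "f \<in> carrier (loc_regular R W) \<rightarrow>\<^sub>E carrier M" by (auto simp: f_def)
    fix X assume "X \<in> carrier (loc_regular R W)"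
    then obtain r w where r: "r \<in> carrier R" "w \<in> W" "X = L.cl r w"
      by (auto simp: loc_regular_def elim!: L.carrierE)
    { fix Y assume "Y \<in> carrier (loc_regular R W)"
      then obtain s v where s: "s \<in> carrier R" "v \<in> W" "Y = L.cl s v"
        by (auto simp: loc_regular_def elim!: L.carrierE)
      have "f (X \<oplus>\<^bsub>loc_regular R W\<^esub> Y) = (v \<otimes> r \<oplus> w \<otimes> s) \<odot>\<^bsub>M\<^esub> y (w \<otimes> v)"
        using r s by (simp add: loc_regular_def L.add_class f)
      also have "\<dots> = r \<odot>\<^bsub>M\<^esub> (v \<odot>\<^bsub>M\<^esub> y (w \<otimes> v)) \<oplus>\<^bsub>M\<^esub> s \<odot>\<^bsub>M\<^esub> (w \<odot>\<^bsub>M\<^esub> y (v \<otimes> w))"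
        using r s yc by (simp add: M.smult_l_distr sm M.R.m_comm)
      also have "\<dots> = f X \<oplus>\<^bsub>M\<^esub> f Y" using r s yy by (simp add: f)
      finally show "f (X \<oplus>\<^bsub>loc_regular R W\<^esub> Y) = f X \<oplus>\<^bsub>M\<^esub> f Y" . }
    { fix a assume "a \<in> carrier R"
      then show "f (a \<odot>\<^bsub>loc_regular R W\<^esub> X) = a \<odot>\<^bsub>M\<^esub> f X"
        using r yc by (simp add: loc_regular_def L.smult_class f sm) }
  qed
  then show ?thesis using f by blast
qed

text \<open>The fraction \<open>r/u\<close> is arbitrary, so that the value of the family at
  \<open>\<one>\<close> can be any value of \<open>f\<close>, not only its value at 1.\<close>

lemma family_of_hom:
  assumes f: "f \<in> mod_hom R (loc_regular R W) M" and r: "r \<in> carrier R" "u \<in> W"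
  shows "(\<lambda>w. f (loc_class R W (regular_module R) r (u \<otimes> w))) \<in> coherent_families R W M"
proof -
  interpret L: localization R "regular_module R" W by (rule regular_localization)
  have c: "L.cl r (u \<otimes> w) \<in> carrier (loc_regular R W)" if "w \<in> W" for w
    using L.carrierI[of r "u \<otimes> w"] r that by (simp add: loc_regular_def)
  have "v \<odot>\<^bsub>M\<^esub> f (L.cl r (u \<otimes> (w \<otimes> v))) = f (L.cl r (u \<otimes> w))" if wv: "w \<in> W" "v \<in> W" for w v
  proof -
    have "v \<odot>\<^bsub>M\<^esub> f (L.cl r (u \<otimes> (w \<otimes> v))) = f (L.cl (v \<otimes> r) ((u \<otimes> w) \<otimes> v))"
      using mod_homD(4)[OF f Wc[OF wv(2)] c[of "w \<otimes> v"]] L.smult_class[of r "u \<otimes> (w \<otimes> v)" v] wv r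
      by (simp add: loc_regular_def M.R.m_assoc)
    also have "L.cl (v \<otimes> r) ((u \<otimes> w) \<otimes> v) = L.cl r (u \<otimes> w)"
      using L.class_cancel[of r "u \<otimes> w" v] wv r by simp
    finally show ?thesis .
  qed
  then show ?thesis using mod_homD(2)[OF f c] by (simp add: coherent_families_def)
qed

section \<open>The trace of the localized ring\<close>

lemma hom_image_subset_trace:
  "f \<in> mod_hom R L M \<Longrightarrow> f ` carrier L \<subseteq> trace R L M"
  unfolding trace_def using mod_homD(2)[of f R L M]
  by (intro submodule_sum_upper[OF M.module_axioms]) auto

lemma trace_submodule: "module R L \<Longrightarrow> submodule (trace R L M) R M"
  unfolding trace_def
  by (intro submodule_sum_submodule[OF M.module_axioms])
     (auto intro: mod_hom_image_submodule M.module_axioms module.carrier_is_submodule)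

lemma loc_regular_module: "module R (loc_regular R W)"
proof -
  interpret L: localization R "regular_module R" W by (rule regular_localization)
  show ?thesis using L.loc_module_module by (simp add: loc_regular_def)
qed

text \<open>Coherent families are closed under pointwise operations, and evaluation at
  \<open>\<one>\<close> respects these.\<close>

lemma family_submodule: "submodule ((\<lambda>y. y \<one>) ` coherent_families R W M) R M"
proof (rule M.submodule_criterion)
  show "(\<lambda>y. y \<one>) ` coherent_families R W M \<subseteq> carrier M"
    by (auto simp: coherent_families_def)
  show "\<zero>\<^bsub>M\<^esub> \<in> (\<lambda>y. y \<one>) ` coherent_families R W M"
    by (rule image_eqI[of _ _ "\<lambda>_. \<zero>\<^bsub>M\<^esub>"]) (auto simp: coherent_families_def)
  fix a assume "a \<in> (\<lambda>y. y \<one>) ` coherent_families R W M"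
  then obtain y where y: "y \<in> coherent_families R W M" "a = y \<one>" by blast
  { fix b assume "b \<in> (\<lambda>y. y \<one>) ` coherent_families R W M"
    then obtain z where z: "z \<in> coherent_families R W M" "b = z \<one>" by blast
    have "(\<lambda>w. y w \<oplus>\<^bsub>M\<^esub> z w) \<in> coherent_families R W M"
      using y(1) z(1) by (simp add: coherent_families_def M.smult_r_distr)
    then show "a \<oplus>\<^bsub>M\<^esub> b \<in> (\<lambda>y. y \<one>) ` coherent_families R W M"
      using y(2) z(2) by (auto intro: image_eqI) }
  { fix r assume r: "r \<in> carrier R"
    have "v \<odot>\<^bsub>M\<^esub> (r \<odot>\<^bsub>M\<^esub> y (w \<otimes> v)) = r \<odot>\<^bsub>M\<^esub> y w" if "w \<in> W" "v \<in> W" for w v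
    proof -
      have c: "y (w \<otimes> v) \<in> carrier M" "v \<odot>\<^bsub>M\<^esub> y (w \<otimes> v) = y w"
        using y(1) that by (auto simp: coherent_families_def)
      have "v \<odot>\<^bsub>M\<^esub> (r \<odot>\<^bsub>M\<^esub> y (w \<otimes> v)) = r \<odot>\<^bsub>M\<^esub> (v \<odot>\<^bsub>M\<^esub> y (w \<otimes> v))"
        using c(1) r that by (simp add: sm M.R.m_comm)
      then show ?thesis using c(2) by simp
    qed
    then have "(\<lambda>w. r \<odot>\<^bsub>M\<^esub> y w) \<in> coherent_families R W M"
      using y(1) r by (simp add: coherent_families_def)
    then show "r \<odot>\<^bsub>M\<^esub> a \<in> (\<lambda>y. y \<one>) ` coherent_families R W M"
      using y(2) by (auto intro: image_eqI) }
qed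

text \<open>Every value of a homomorphism is the value at \<open>\<one>\<close> of a coherent family
  and conversely. As these values form a submodule, the finite sums in the trace produce nothing
  new.\<close>

lemma trace_loc_regular_eq:
  "trace R (loc_regular R W) M = (\<lambda>y. y \<one>) ` coherent_families R W M"
proof
  interpret L: localization R "regular_module R" W by (rule regular_localization)
  have "f X \<in> (\<lambda>y. y \<one>) ` coherent_families R W M"
    if f: "f \<in> mod_hom R (loc_regular R W) M" and X: "X \<in> carrier (loc_regular R W)" for f X
  proof -
    obtain r u where r: "r \<in> carrier R" "u \<in> W" "X = L.cl r u"
      using X by (auto simp: loc_regular_def elim!: L.carrierE)
    then show ?thesis by (intro image_eqI[OF _ family_of_hom[OF f r(1,2)]]) simp
  qed
  then show "trace R (loc_regular R W) M \<subseteq> (\<lambda>y. y \<one>) ` coherent_families R W M"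
    unfolding trace_def
    by (intro submodule_sum_least[OF M.module_axioms family_submodule]) blast
  show "(\<lambda>y. y \<one>) ` coherent_families R W M \<subseteq> trace R (loc_regular R W) M"
  proof (rule image_subsetI)
    fix y assume y: "y \<in> coherent_families R W M"
    obtain f where f: "f \<in> mod_hom R (loc_regular R W) M" "f (L.cl \<one> \<one>) = \<one> \<odot>\<^bsub>M\<^esub> y \<one>"
      using hom_of_family[OF y] by auto
    have "L.cl \<one> \<one> \<in> carrier (loc_regular R W)"
      using L.carrierI[of \<one> \<one>] by (simp add: loc_regular_def)
    moreover have "y \<one> = f (L.cl \<one> \<one>)"
      using f(2) y by (simp add: coherent_families_def)
    ultimately show "y \<one> \<in> trace R (loc_regular R W) M"
      using hom_image_subset_trace[OF f(1)] by blast
  qed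
qed

text \<open>Coherence gives \<open>y 1 = w (y w)\<close>, and \<open>y w\<close> is again in the
  trace, being the value at \<open>\<one>\<close> of the family shifted by \<open>w\<close>.\<close>

lemma trace_subset_div_W: "trace R (loc_regular R W) M \<subseteq> div_W R W M"
proof (rule div_W_greatest[OF trace_submodule[OF loc_regular_module]])
  fix w assume w: "w \<in> W"
  show "trace R (loc_regular R W) M \<subseteq> (\<lambda>x. w \<odot>\<^bsub>M\<^esub> x) ` trace R (loc_regular R W) M"
    unfolding trace_loc_regular_eq
  proof (rule image_subsetI)
    fix y assume y: "y \<in> coherent_families R W M"
    then have "y \<one> = w \<odot>\<^bsub>M\<^esub> y (\<one> \<otimes> w)"
      using w W.one_closed unfolding coherent_families_def by (metis (mono_tags, lifting) mem_Collect_eq)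
    \<comment> \<open>The argument is written as \<open>w \<otimes> \<one>\<close> to match the
      shifted family at \<open>\<one>\<close>.\<close>
    then have "y \<one> = w \<odot>\<^bsub>M\<^esub> y (w \<otimes> \<one>)" using w by simp
    then show "y \<one> \<in> (\<lambda>x. w \<odot>\<^bsub>M\<^esub> x) ` (\<lambda>y. y \<one>) ` coherent_families R W M"
      by (intro image_eqI[OF _ imageI[OF family_shift[OF y w]]])
  qed
qed

section \<open>The ring structure of the localization and h-divisibility\<close>

lemma loc_ring_mult:
  assumes x: "x \<in> carrier R" "w \<in> W" and y: "y \<in> carrier R" "v \<in> W"
  shows "loc_class R W (regular_module R) x w \<otimes>\<^bsub>loc_ring R W\<^esub> loc_class R W (regular_module R) y v =
    loc_class R W (regular_module R) (x \<otimes> y) (w \<otimes> v)"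
proof -
  interpret L: localization R "regular_module R" W by (rule regular_localization)
  have "L.cl (x' \<otimes> y') (w' \<otimes> v') = L.cl (x \<otimes> y) (w \<otimes> v)"
    if p: "(x', w') \<in> L.cl x w" "(y', v') \<in> L.cl y v" for x' w' y' v'
  proof -
    have a: "x' \<in> carrier R" "w' \<in> W" "y' \<in> carrier R" "v' \<in> W"
      using L.class_memD(1,2)[OF p(1)] L.class_memD(1,2)[OF p(2)] x y by simp_all
    have xy': "L.cl x' w' = L.cl x w" "L.cl y' v' = L.cl y v"
      using L.class_memD(3)[OF p(1)] L.class_memD(3)[OF p(2)] x y by simp_all
    \<comment> \<open>The representatives of the two factors are exchanged one at a time.\<close>
    have "L.cl (x' \<otimes> y') (w' \<otimes> v') = L.cl (x \<otimes> y') (w \<otimes> v')"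
    proof -
      obtain s where "s \<in> W" "(s \<otimes> w') \<otimes> x = (s \<otimes> w) \<otimes> x'"
        using L.class_memD(4)[OF p(1)] x by (simp, elim bexE) blast
      note s = this
      have "(s \<otimes> (w \<otimes> v')) \<otimes> (x' \<otimes> y') = ((s \<otimes> w) \<otimes> x') \<otimes> (v' \<otimes> y')"
        using a x s(1) by (simp add: M.R.m_ac)
      also have "\<dots> = (s \<otimes> (w' \<otimes> v')) \<otimes> (x \<otimes> y')"
        unfolding s(2)[symmetric] using a x s(1) by (simp add: M.R.m_ac)
      finally show ?thesis
        using a x s(1) by (intro L.class_eqI[where u = s]) auto
    qed
    also have "\<dots> = L.cl (x \<otimes> y) (w \<otimes> v)"
    proof -
      obtain s where "s \<in> W" "(s \<otimes> v') \<otimes> y = (s \<otimes> v) \<otimes> y'"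
        using L.class_memD(4)[OF p(2)] y by (simp, elim bexE) blast
      note s = this
      have "(s \<otimes> (w \<otimes> v)) \<otimes> (x \<otimes> y') = ((s \<otimes> v) \<otimes> y') \<otimes> (w \<otimes> x)"
        using a x y s(1) by (simp add: M.R.m_ac)
      also have "\<dots> = (s \<otimes> (w \<otimes> v')) \<otimes> (x \<otimes> y)"
        unfolding s(2)[symmetric] using a x y s(1) by (simp add: M.R.m_ac)
      finally show ?thesis
        using a x y s(1) by (intro L.class_eqI[where u = s]) auto
    qed
    finally show ?thesis .
  qed
  then have "(\<Union>(x', w')\<in>L.cl x w. \<Union>(y', v')\<in>L.cl y v. L.cl (x' \<otimes> y') (w' \<otimes> v')) =
      (\<Union>p\<in>L.cl x w. \<Union>q\<in>L.cl y v. L.cl (x \<otimes> y) (w \<otimes> v))"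
    by (intro SUP_cong refl) (auto intro!: SUP_cong)
  then show ?thesis
    using L.class_self[of x w] L.class_self[of y v] x y by (auto simp: loc_ring_def)
qed

lemma loc_ring_smult:
  assumes r: "r \<in> carrier R" and X: "X \<in> carrier (loc_ring R W)"
  shows "r \<odot>\<^bsub>loc_regular R W\<^esub> X = loc_map R W (regular_module R) r \<otimes>\<^bsub>loc_ring R W\<^esub> X"
proof -
  interpret L: localization R "regular_module R" W by (rule regular_localization)
  obtain x w where x: "x \<in> carrier R" "w \<in> W" "X = L.cl x w"
    using X by (auto simp: loc_ring_def loc_regular_def elim!: L.carrierE)
  then show ?thesis
    using r by (simp add: loc_map_def loc_ring_mult loc_regular_def L.smult_class)
qed

end

text \<open>This is \<open>Hom(W^{-1}R, M)\<close> over the ring \<open>W^{-1}R\<close>, which acts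
  by multiplication on the argument. Evaluation at 1 maps it onto the trace.\<close>

definition loc_hom_module ::
  "('r, 'x) ring_scheme \<Rightarrow> 'r set \<Rightarrow> ('r, 'm) module \<Rightarrow>
   (('r \<times> 'r) set, ('r \<times> 'r) set \<Rightarrow> 'm) module" where
  "loc_hom_module R W M = \<lparr>carrier = mod_hom R (loc_regular R W) M,
     monoid.mult = undefined, one = undefined,
     zero = zero (hom_module R (loc_regular R W) M), add = add (hom_module R (loc_regular R W) M),
     smult = (\<lambda>s f. \<lambda>t\<in>carrier (loc_ring R W). f (t \<otimes>\<^bsub>loc_ring R W\<^esub> s))\<rparr>"

context localization
begin

lemma loc_hom_module_module: "module (loc_ring R W) (loc_hom_module R W M)"
proof -
  let ?S = "loc_ring R W" and ?L = "loc_regular R W" and ?N = "loc_hom_module R W M"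
  interpret L: localization R "regular_module R" W by (rule regular_localization)
  interpret S: cring ?S by (rule loc_ring_cring[OF M.R.cring_axioms W.submonoid_axioms])
  interpret LM: module R ?L by (rule loc_regular_module)
  interpret H: module R "hom_module R ?L M"
    by (rule hom_module_module[OF LM.module_axioms M.module_axioms])
  have "carrier ?N = carrier (hom_module R ?L M)" "add ?N = add (hom_module R ?L M)"
    "zero ?N = zero (hom_module R ?L M)"
    by (simp_all add: loc_hom_module_def hom_module_def)
  \<comment> \<open>The additive group is that of \<open>hom_module\<close>; only the scalar action
    is new.\<close>
  then have ab: "abelian_group ?N"
    by (intro abelian_groupI) (use H.M.l_neg in \<open>simp_all add: H.M.a_ac\<close>)
  have car [simp]: "carrier ?L = carrier ?S" and add [simp]: "add ?L = add ?S"
    by (simp_all add: loc_ring_def)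
  have \<phi>: "loc_map R W (regular_module R) r \<in> carrier ?S" if "r \<in> carrier R" for r
    using mod_homD(2)[OF L.loc_map_hom] that by (simp add: loc_ring_def loc_regular_def)
  have N [simp]: "f \<in> carrier ?N \<longleftrightarrow> f \<in> mod_hom R ?L M"
    "f \<oplus>\<^bsub>?N\<^esub> g = (\<lambda>x\<in>carrier ?S. f x \<oplus>\<^bsub>M\<^esub> g x)"
    "s \<odot>\<^bsub>?N\<^esub> f = (\<lambda>t\<in>carrier ?S. f (t \<otimes>\<^bsub>?S\<^esub> s))" for f g s
    by (simp_all add: loc_hom_module_def hom_module_def)
  have fc: "f x \<in> carrier M" if "f \<in> mod_hom R ?L M" "x \<in> carrier ?S" for f x
    using mod_homD(2)[OF that(1)] that(2) by simp
  have fa: "f (x \<oplus>\<^bsub>?S\<^esub> y) = f x \<oplus>\<^bsub>M\<^esub> f y"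
    if "f \<in> mod_hom R ?L M" "x \<in> carrier ?S" "y \<in> carrier ?S" for f x y
    using mod_homD(3)[OF that(1), of x y] that(2,3) by simp
  show ?thesis
  proof (rule moduleI)
    show "cring ?S" by (rule S.cring_axioms)
    show "abelian_group ?N" by (rule ab)
  next
    fix s f assume s: "s \<in> carrier ?S" and f: "f \<in> carrier ?N"
    then have f': "f \<in> mod_hom R ?L M" by simp
    have "(\<lambda>t\<in>carrier ?S. f (t \<otimes>\<^bsub>?S\<^esub> s)) \<in> mod_hom R ?L M"
    proof (rule mod_homI)
      fix r t assume r: "r \<in> carrier R" and "t \<in> carrier ?L"
      then have t: "t \<in> carrier ?S" by simp
      \<comment> \<open>\<open>R\<close>-linearity is inherited by \<open>s f\<close> because
        \<open>r\<close> acts as multiplication by the fraction \<open>r/1\<close>, so associativity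
        lets it pass the factor \<open>s\<close>.\<close>
      have "(r \<odot>\<^bsub>?L\<^esub> t) \<otimes>\<^bsub>?S\<^esub> s = r \<odot>\<^bsub>?L\<^esub> (t \<otimes>\<^bsub>?S\<^esub> s)"
        using r t s \<phi> by (simp add: loc_ring_smult S.m_assoc)
      moreover have "r \<odot>\<^bsub>?L\<^esub> t \<in> carrier ?S" using LM.smult_closed[OF r] t by simp
      ultimately show "(\<lambda>t\<in>carrier ?S. f (t \<otimes>\<^bsub>?S\<^esub> s)) (r \<odot>\<^bsub>?L\<^esub> t) =
          r \<odot>\<^bsub>M\<^esub> (\<lambda>t\<in>carrier ?S. f (t \<otimes>\<^bsub>?S\<^esub> s)) t"
        using t s mod_homD(4)[OF f' r, of "t \<otimes>\<^bsub>?S\<^esub> s"] by simp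
    qed (use s fc[OF f'] fa[OF f'] in \<open>auto simp: S.l_distr\<close>)
    then show "s \<odot>\<^bsub>?N\<^esub> f \<in> carrier ?N" by simp
  next
    fix f assume "f \<in> carrier ?N"
    then have "f \<in> carrier ?S \<rightarrow>\<^sub>E carrier M" using mod_homD(1)[of f R ?L M] by simp
    then show "\<one>\<^bsub>?S\<^esub> \<odot>\<^bsub>?N\<^esub> f = f"
      by (intro extensionalityI[of _ "carrier ?S"]) (auto simp: PiE_def)
  qed (auto simp: fa S.r_distr S.m_assoc intro!: restrict_ext)
qed

text \<open>Given a covering \<open>g\<close> from a \<open>W^{-1}R\<close>-module and a preimage
  \<open>n\<close> of \<open>m\<close>, the family \<open>w \<mapsto> g ((1/w) n)\<close> is
  coherent with value \<open>m\<close> at \<open>\<one>\<close>. Conversely, evaluation at 1 on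
  \<open>loc_hom_module\<close> is onto \<open>M\<close> when the trace is everything, and
  \<open>h_divisibleI\<close> replaces that module by a free one.\<close>

lemma h_divisible_iff: "h_divisible R W M \<longleftrightarrow> trace R (loc_regular R W) M = carrier M"
proof
  let ?S = "loc_ring R W" and ?\<phi> = "loc_map R W (regular_module R)"
  interpret L: localization R "regular_module R" W by (rule regular_localization)
  have cI: "L.cl r w \<in> carrier ?S" if "r \<in> carrier R" "w \<in> W" for r w
    using L.carrierI[of r w] that by (simp add: loc_ring_def loc_regular_def)
  assume "h_divisible R W M"
  then obtain N :: "(('a \<times> 'a) set, 'c \<Rightarrow> ('a \<times> 'a) set) module" and g
    where N: "module ?S N" and g: "g \<in> mod_hom R (restrict_scalars ?\<phi> N) M"
      and surj: "g ` carrier N = carrier M"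
    unfolding h_divisible_def free_module_def by blast
  interpret N: module ?S N by fact
  have gc: "g x \<in> carrier M" if "x \<in> carrier N" for x
    using mod_homD(2)[OF g] that by (simp add: restrict_scalars_def)
  have gs: "r \<odot>\<^bsub>M\<^esub> g x = g (?\<phi> r \<odot>\<^bsub>N\<^esub> x)" if "r \<in> carrier R" "x \<in> carrier N" for r x
    using mod_homD(4)[OF g] that by (simp add: restrict_scalars_def)
  have "m \<in> (\<lambda>y. y \<one>) ` coherent_families R W M" if m: "m \<in> carrier M" for m
  proof -
    obtain n where n: "n \<in> carrier N" "m = g n" using m surj by blast
    have "v \<odot>\<^bsub>M\<^esub> g (L.cl \<one> (w \<otimes> v) \<odot>\<^bsub>N\<^esub> n) = g (L.cl \<one> w \<odot>\<^bsub>N\<^esub> n)"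
      if wv: "w \<in> W" "v \<in> W" for w v
    proof -
      have "?\<phi> v = L.cl v \<one>" using wv by (simp add: loc_map_def)
      then have "v \<odot>\<^bsub>M\<^esub> g (L.cl \<one> (w \<otimes> v) \<odot>\<^bsub>N\<^esub> n) = g (L.cl v \<one> \<odot>\<^bsub>N\<^esub> (L.cl \<one> (w \<otimes> v) \<odot>\<^bsub>N\<^esub> n))"
        using gs[of v] wv n cI by simp
      also have "\<dots> = g ((L.cl v \<one> \<otimes>\<^bsub>?S\<^esub> L.cl \<one> (w \<otimes> v)) \<odot>\<^bsub>N\<^esub> n)"
        using wv n cI by (simp add: N.smult_assoc1)
      also have "L.cl v \<one> \<otimes>\<^bsub>?S\<^esub> L.cl \<one> (w \<otimes> v) = L.cl \<one> w"
        using wv L.class_cancel[of \<one> w v] by (simp add: loc_ring_mult)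
      finally show ?thesis .
    qed
    then have "(\<lambda>w. g (L.cl \<one> w \<odot>\<^bsub>N\<^esub> n)) \<in> coherent_families R W M"
      using n cI gc by (simp add: coherent_families_def)
    moreover have "L.cl \<one> \<one> \<odot>\<^bsub>N\<^esub> n = n" using N.smult_one[OF n(1)] by (simp add: loc_ring_def)
    ultimately show ?thesis using n by (intro image_eqI) auto
  qed
  then show "trace R (loc_regular R W) M = carrier M"
    unfolding trace_loc_regular_eq using M.submoduleE(1)[OF family_submodule] by blast
next
  let ?S = "loc_ring R W" and ?\<phi> = "loc_map R W (regular_module R)" and ?N = "loc_hom_module R W M"
  let ?N' = "restrict_scalars ?\<phi> ?N"
  interpret L: localization R "regular_module R" W by (rule regular_localization)
  interpret S: cring ?S by (rule loc_ring_cring[OF M.R.cring_axioms W.submonoid_axioms])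
  assume tr: "trace R (loc_regular R W) M = carrier M"
  have car: "carrier (loc_regular R W) = carrier ?S" by (simp add: loc_ring_def)
  have \<phi>: "?\<phi> r \<in> carrier ?S" if "r \<in> carrier R" for r
    using mod_homD(2)[OF L.loc_map_hom] that by (simp add: loc_ring_def loc_regular_def)
  define g where "g = (\<lambda>f\<in>carrier ?N. f \<one>\<^bsub>?S\<^esub>)"
  have N': "carrier ?N = mod_hom R (loc_regular R W) M" "carrier ?N' = carrier ?N"
    by (simp_all add: loc_hom_module_def restrict_scalars_def)
  interpret N: module ?S ?N by (rule loc_hom_module_module)
  have g: "g \<in> mod_hom R ?N' M"
  proof (rule mod_homI)
    show "g \<in> carrier ?N' \<rightarrow>\<^sub>E carrier M"
      by (auto simp: g_def N' car intro: mod_homD(2))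
    fix f assume f: "f \<in> carrier ?N'"
    { fix h assume h: "h \<in> carrier ?N'"
      then have "f \<oplus>\<^bsub>?N\<^esub> h \<in> carrier ?N" using f N.M.a_closed by (simp add: N')
      then have "g (f \<oplus>\<^bsub>?N\<^esub> h) = (f \<oplus>\<^bsub>?N\<^esub> h) \<one>\<^bsub>?S\<^esub>" by (simp add: g_def)
      also have "\<dots> = g f \<oplus>\<^bsub>M\<^esub> g h"
        using f h by (simp add: g_def N'(2)) (simp add: loc_hom_module_def hom_module_def car)
      finally show "g (f \<oplus>\<^bsub>?N'\<^esub> h) = g f \<oplus>\<^bsub>M\<^esub> g h" by (simp add: restrict_scalars_def) }
    { fix r assume r: "r \<in> carrier R"
      have f': "f \<in> mod_hom R (loc_regular R W) M" using f by (simp add: N')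
      have "?\<phi> r \<odot>\<^bsub>?N\<^esub> f \<in> carrier ?N" using f \<phi>[OF r] by (simp add: N'(2))
      then have "g (?\<phi> r \<odot>\<^bsub>?N\<^esub> f) = (?\<phi> r \<odot>\<^bsub>?N\<^esub> f) \<one>\<^bsub>?S\<^esub>" by (simp add: g_def)
      also have "\<dots> = f (?\<phi> r)" using \<phi>[OF r] by (simp add: loc_hom_module_def)
      also have "\<dots> = f (r \<odot>\<^bsub>loc_regular R W\<^esub> \<one>\<^bsub>?S\<^esub>)"
        using loc_ring_smult[OF r S.one_closed] \<phi>[OF r] by simp
      also have "\<dots> = r \<odot>\<^bsub>M\<^esub> f \<one>\<^bsub>?S\<^esub>"
        using mod_homD(4)[OF f' r, of "\<one>\<^bsub>?S\<^esub>"] by (simp add: car)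
      finally show "g (r \<odot>\<^bsub>?N'\<^esub> f) = r \<odot>\<^bsub>M\<^esub> g f"
        using f by (simp add: restrict_scalars_def g_def) }
  qed
  have "m \<in> g ` carrier ?N" if m: "m \<in> carrier M" for m
  proof -
    obtain y where y: "y \<in> coherent_families R W M" "m = y \<one>"
      using m tr unfolding trace_loc_regular_eq by blast
    obtain f where f: "f \<in> mod_hom R (loc_regular R W) M" "f (L.cl \<one> \<one>) = \<one> \<odot>\<^bsub>M\<^esub> y \<one>"
      using hom_of_family[OF y(1)] by auto
    then have "g f = m" using m y(2) by (simp add: g_def N' loc_ring_def)
    then show ?thesis using f(1) N' by blast
  qed
  moreover have "g ` carrier ?N \<subseteq> carrier M" using mod_homD(2)[OF g] by (auto simp: N')
  ultimately have "g ` carrier ?N = carrier M" by blast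
  then show "h_divisible R W M"
    by (rule h_divisibleI[OF M.R.cring_axioms W.submonoid_axioms M.module_axioms N.module_axioms g])
qed

end

section \<open>Matlis duality\<close>

text \<open>The kernel condition is applied to the difference of \<open>p\<close> and
  \<open>q\<close>, written with the scalar -1 because \<open>mod_homD\<close> speaks only of sums
  and scalar multiples.\<close>

lemma mod_hom_eq_of_kernel:
  assumes "module R M" "module R N" and a: "a \<in> mod_hom R M N" and b: "b \<in> mod_hom R M K" "module R K"
    and ker: "\<And>p. p \<in> carrier M \<Longrightarrow> a p = \<zero>\<^bsub>N\<^esub> \<Longrightarrow> b p = \<zero>\<^bsub>K\<^esub>"
    and pq: "p \<in> carrier M" "q \<in> carrier M" "a p = a q"
  shows "b p = b q"
proof -
  interpret M: module R M by fact
  interpret N: module R N by fact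
  interpret K: module R K by fact
  let ?d = "p \<oplus>\<^bsub>M\<^esub> (\<ominus>\<^bsub>R\<^esub> \<one>\<^bsub>R\<^esub>) \<odot>\<^bsub>M\<^esub> q"
  have d: "?d \<in> carrier M" using pq by simp
  have "a ?d = a p \<oplus>\<^bsub>N\<^esub> \<ominus>\<^bsub>N\<^esub> a q"
    using pq mod_homD(2)[OF a] by (simp add: mod_homD(3,4)[OF a] N.smult_l_minus)
  then have "a ?d = \<zero>\<^bsub>N\<^esub>" using pq mod_homD(2)[OF a] by (simp add: N.M.r_neg)
  then have "b ?d = \<zero>\<^bsub>K\<^esub>" by (rule ker[OF d])
  moreover have "b ?d = b p \<oplus>\<^bsub>K\<^esub> \<ominus>\<^bsub>K\<^esub> b q"
    using pq mod_homD(2)[OF b(1)] by (simp add: mod_homD(3,4)[OF b(1)] K.smult_l_minus)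
  ultimately show ?thesis
    using mod_homD(2)[OF b(1)] pq
    by (metis K.M.minus_equality K.M.minus_minus K.M.add.inv_closed)
qed

text \<open>The working form of injectivity: \<open>b\<close> induces a map on the image of
  \<open>a\<close> as soon as it kills the kernel of \<open>a\<close>, and this map extends from the
  image to \<open>B\<close>.\<close>

lemma injective_factor:
  fixes R :: "('r, 'x) ring_scheme" and P :: "('r, 'p) module" and B :: "('r, 'b) module"
    and E :: "('r, 'e) module"
  assumes inj: "injective_module R E" and P: "module R P" and B: "module R B"
    and a: "a \<in> mod_hom R P B" and b: "b \<in> mod_hom R P E"
    and ker: "\<And>p. p \<in> carrier P \<Longrightarrow> a p = \<zero>\<^bsub>B\<^esub> \<Longrightarrow> b p = \<zero>\<^bsub>E\<^esub>"
  obtains h where "h \<in> mod_hom R B E" "\<And>p. p \<in> carrier P \<Longrightarrow> h (a p) = b p"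
proof -
  have E: "module R E" using inj by (simp add: injective_module_def)
  interpret P: module R P by fact
  interpret B: module R B by fact
  let ?A = "B\<lparr>carrier := a ` carrier P\<rparr>"
  have A: "module R ?A"
    by (rule submodule.submodule_is_module[OF
          mod_hom_image_submodule[OF P B a P.carrier_is_submodule] B])
  have i: "(\<lambda>x\<in>carrier ?A. x) \<in> mod_hom R ?A B"
    by (rule mod_homI)
      (use mod_homD(2)[OF a] module.smult_closed[OF A] abelian_monoid.a_closed[OF
          abelian_group.axioms(1)[OF module.axioms(2)[OF A]]] in auto)
  \<comment> \<open>A preimage under \<open>a\<close> is chosen; the kernel condition makes the
    value independent of the choice.\<close>
  define f where "f = (\<lambda>y\<in>carrier ?A. b (SOME p. p \<in> carrier P \<and> y = a p))"
  have f: "f (a p) = b p" if p: "p \<in> carrier P" for p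
  proof -
    let ?q = "SOME q. q \<in> carrier P \<and> a p = a q"
    have q: "?q \<in> carrier P \<and> a p = a ?q" by (rule someI[of _ p]) (simp add: p)
    then have "b ?q = b p" using mod_hom_eq_of_kernel[OF P B a b E ker, of ?q p] p by simp
    then show ?thesis using p by (simp add: f_def)
  qed
  have "f \<in> mod_hom R ?A E"
  proof (rule mod_homI)
    have "f y \<in> carrier E" if "y \<in> carrier ?A" for y
      using that f mod_homD(2)[OF b] by auto
    then show "f \<in> carrier ?A \<rightarrow>\<^sub>E carrier E" by (auto simp: f_def)
    fix x assume "x \<in> carrier ?A"
    then obtain p where p: "p \<in> carrier P" "x = a p" by auto
    { fix y assume "y \<in> carrier ?A"
      then obtain q where q: "q \<in> carrier P" "y = a q" by auto
      then show "f (x \<oplus>\<^bsub>?A\<^esub> y) = f x \<oplus>\<^bsub>E\<^esub> f y"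
        using p f[of "p \<oplus>\<^bsub>P\<^esub> q"] by (simp add: f mod_homD(3)[OF a] mod_homD(3)[OF b]) }
    { fix r assume "r \<in> carrier R"
      then show "f (r \<odot>\<^bsub>?A\<^esub> x) = r \<odot>\<^bsub>E\<^esub> f x"
        using p f[of "r \<odot>\<^bsub>P\<^esub> p"] by (simp add: f mod_homD(4)[OF a] mod_homD(4)[OF b]) }
  qed
  then obtain h where h: "h \<in> mod_hom R B E" "\<forall>x\<in>carrier ?A. h ((\<lambda>x\<in>carrier ?A. x) x) = f x"
    using injective_module_extend[OF inj A B i, of f] by (auto simp: inj_on_def)
  then have "h (a p) = b p" if "p \<in> carrier P" for p using f[OF that] that by simp
  then show ?thesis using that h(1) by blast
qed

section \<open>Maximal ideals and the cogenerator property\<close>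

lemma (in ring) maximalideal_exists:
  assumes I: "ideal I R" "\<one> \<notin> I"
  shows "\<exists>J. maximalideal J R \<and> I \<subseteq> J"
proof -
  \<comment> \<open>Properness is expressed by the absence of \<open>\<one>\<close>, a condition
    that survives unions of chains.\<close>
  let ?S = "{J. ideal J R \<and> I \<subseteq> J \<and> \<one> \<notin> J}"
  have "\<exists>J\<in>?S. \<forall>X\<in>?S. J \<subseteq> X \<longrightarrow> X = J"
  proof (rule subset_Zorn_nonempty)
    show "?S \<noteq> {}" using I by blast
    fix C assume C: "C \<noteq> {}" "subset.chain ?S C"
    then have CS: "C \<subseteq> ?S" and "subset.chain {I. ideal I R} C"
      unfolding subset.chain_def by blast+
    then have "ideal (\<Union>C) R" using chain_Union_is_ideal[of C] C(1) by simp
    moreover have "I \<subseteq> \<Union>C" "\<one> \<notin> \<Union>C" using C(1) CS by blast+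
    ultimately show "\<Union>C \<in> ?S" by simp
  qed
  then obtain J where J: "J \<in> ?S" and max: "\<forall>X\<in>?S. J \<subseteq> X \<longrightarrow> X = J" by (elim bexE) rule
  have "maximalideal J R"
  proof (rule maximalidealI)
    fix X assume X: "ideal X R" "J \<subseteq> X" "X \<subseteq> carrier R"
    show "X = J \<or> X = carrier R"
      using max J X ideal.one_imp_carrier[OF X(1)] by blast
  qed (use J in auto)
  then show ?thesis using J by blast
qed

text \<open>A proper ideal lies in some maximal ideal, which uniqueness identifies with
  \<open>max_ideal R\<close>.\<close>

lemma max_ideal_local:
  assumes "local_ring R"
  shows "maximalideal (max_ideal R) R"
    and "\<And>I. ideal I R \<Longrightarrow> \<one>\<^bsub>R\<^esub> \<notin> I \<Longrightarrow> I \<subseteq> max_ideal R"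
proof -
  interpret cring R using assms by (simp add: local_ring_def)
  have ex: "\<exists>!\<mm>. maximalideal \<mm> R" using assms by (simp add: local_ring_def)
  then show "maximalideal (max_ideal R) R" unfolding max_ideal_def by (rule theI')
  show "I \<subseteq> max_ideal R" if "ideal I R" "\<one>\<^bsub>R\<^esub> \<notin> I" for I
    using maximalideal_exists[OF that] ex \<open>maximalideal (max_ideal R) R\<close> by blast
qed

lemma annihilator_ideal:
  assumes "module R M" and x: "x \<in> carrier M"
  shows "ideal {r \<in> carrier R. r \<odot>\<^bsub>M\<^esub> x = \<zero>\<^bsub>M\<^esub>} R"
proof -
  interpret M: module R M by fact
  show ?thesis
  proof (rule idealI[OF M.R.ring_axioms])
    show "subgroup {r \<in> carrier R. r \<odot>\<^bsub>M\<^esub> x = \<zero>\<^bsub>M\<^esub>} (add_monoid R)"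
    proof (rule M.R.add.subgroupI)
      show "{r \<in> carrier R. r \<odot>\<^bsub>M\<^esub> x = \<zero>\<^bsub>M\<^esub>} \<noteq> {}"
        using x M.smult_l_null by blast
    qed (use x in \<open>auto simp: M.smult_l_distr M.smult_l_minus simp flip: a_inv_def\<close>)
    fix a r assume a: "a \<in> {r \<in> carrier R. r \<odot>\<^bsub>M\<^esub> x = \<zero>\<^bsub>M\<^esub>}" and r: "r \<in> carrier R"
    then have "(r \<otimes>\<^bsub>R\<^esub> a) \<odot>\<^bsub>M\<^esub> x = \<zero>\<^bsub>M\<^esub>" using x by (simp add: M.smult_assoc1)
    then show "r \<otimes>\<^bsub>R\<^esub> a \<in> {r \<in> carrier R. r \<odot>\<^bsub>M\<^esub> x = \<zero>\<^bsub>M\<^esub>}"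
      "a \<otimes>\<^bsub>R\<^esub> r \<in> {r \<in> carrier R. r \<odot>\<^bsub>M\<^esub> x = \<zero>\<^bsub>M\<^esub>}"
      using a r by (simp_all add: M.R.m_comm)
  qed
qed

lemma smult_hom:
  assumes "module R M" and x: "x \<in> carrier M"
  shows "(\<lambda>r\<in>carrier R. r \<odot>\<^bsub>M\<^esub> x) \<in> mod_hom R (regular_module R) M"
proof -
  interpret M: module R M by fact
  show ?thesis
    by (rule mod_homI) (use x in \<open>auto simp: M.smult_l_distr M.smult_assoc1\<close>)
qed

lemma mod_hom_compose:
  assumes "module R M" and f: "f \<in> mod_hom R M N" and g: "g \<in> mod_hom R N K"
  shows "compose (carrier M) g f \<in> mod_hom R M K"
proof -
  interpret M: module R M by fact
  show ?thesis
    by (rule mod_homI)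
      (auto simp: compose_eq mod_homD(2)[OF f] mod_homD(2)[OF g] mod_homD(3,4)[OF f]
        mod_homD(3,4)[OF g] compose_def)
qed

text \<open>The annihilator of a nonzero \<open>x\<close> is a proper ideal, hence inside the
  maximal ideal. So the map from \<open>R\<close> through the residue field into \<open>E\<close>
  kills every \<open>r\<close> with \<open>r x = 0\<close>, and it factors as
  \<open>r \<mapsto> h (r x)\<close>. At \<open>r = 1\<close> the value is nonzero, as the residue
  field embeds in \<open>E\<close>.\<close>

lemma injective_hull_cogenerator:
  assumes loc: "local_ring R" and E: "injective_hull R (residue_module R) E"
    and M: "module R M" and x: "x \<in> carrier M" "x \<noteq> \<zero>\<^bsub>M\<^esub>"
  obtains h where "h \<in> mod_hom R M E" "h x \<noteq> \<zero>\<^bsub>E\<^esub>"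
proof -
  interpret M: module R M by fact
  let ?m = "max_ideal R" and ?P = "regular_module R"
  have P: "module R ?P" by (rule regular_module_module[OF M.R.cring_axioms])
  interpret m: maximalideal ?m R by (rule max_ideal_local[OF loc])
  have m: "submodule ?m R ?P"
    by (rule submodule_regular_ideal[OF m.is_ideal M.R.cring_axioms])
  have K: "module R (residue_module R)"
    unfolding residue_module_def by (rule quot_module_module[OF P m])
  note q = quot_map_hom[OF P m, folded residue_module_def]
  have inj: "injective_module R E" using E by (simp add: injective_hull_def)
  then have E': "module R E" by (simp add: injective_module_def)
  obtain i where i: "i \<in> mod_hom R (residue_module R) E" "inj_on i (carrier (residue_module R))"
    using E by (auto simp: injective_hull_def)
  let ?b = "compose (carrier R) i (quot_map ?P ?m)" and ?a = "\<lambda>r\<in>carrier R. r \<odot>\<^bsub>M\<^esub> x"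
  have b: "?b \<in> mod_hom R ?P E" using mod_hom_compose[OF P q(1) i(1)] by simp
  have b0: "?b r = \<zero>\<^bsub>E\<^esub> \<longleftrightarrow> r \<in> ?m" if r: "r \<in> carrier R" for r
  proof -
    have "i (quot_map ?P ?m r) = i \<zero>\<^bsub>residue_module R\<^esub> \<longleftrightarrow> quot_map ?P ?m r = \<zero>\<^bsub>residue_module R\<^esub>"
      using i(2) mod_homD(2)[OF q(1), of r] r abelian_monoid.zero_closed[OF
          abelian_group.axioms(1)[OF module.axioms(2)[OF K]]] by (auto simp: inj_on_def)
    then show ?thesis using r q(3)[of r] mod_hom_zero[OF K E' i(1)] by (simp add: compose_eq)
  qed
  have "?b r = \<zero>\<^bsub>E\<^esub>" if "r \<in> carrier ?P" "?a r = \<zero>\<^bsub>M\<^esub>" for r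
    using that b0[of r] max_ideal_local(2)[OF loc annihilator_ideal[OF M x(1)]] x by auto
  then obtain h where h: "h \<in> mod_hom R M E" "\<And>r. r \<in> carrier ?P \<Longrightarrow> h (?a r) = ?b r"
    using injective_factor[OF inj P M smult_hom[OF M x(1)] b] by blast
  have "\<one>\<^bsub>R\<^esub> \<notin> ?m" using m.I_notcarr m.one_imp_carrier by blast
  then have "h x \<noteq> \<zero>\<^bsub>E\<^esub>" using h(2)[of "\<one>\<^bsub>R\<^esub>"] b0[of "\<one>\<^bsub>R\<^esub>"] x by simp
  then show ?thesis using that h(1) by blast
qed

section \<open>Evaluation maps and the trace of a Matlis-dualizable module\<close>

lemma eval_hom:
  assumes "module R M" "module R N" and x: "x \<in> carrier M"
  shows "(\<lambda>f\<in>carrier (hom_module R M N). f x) \<in> mod_hom R (hom_module R M N) N"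
proof -
  interpret H: module R "hom_module R M N" by (rule hom_module_module) fact+
  have [simp]: "f x \<in> carrier N" if "f \<in> carrier (hom_module R M N)" for f
    using that x mod_homD(2) by (simp add: hom_module_def)
  have [simp]: "(f \<oplus>\<^bsub>hom_module R M N\<^esub> g) x = f x \<oplus>\<^bsub>N\<^esub> g x"
    "(r \<odot>\<^bsub>hom_module R M N\<^esub> f) x = r \<odot>\<^bsub>N\<^esub> f x" for f g r
    using x by (simp_all add: hom_module_def)
  show ?thesis by (rule mod_homI) auto
qed

lemma matlis_dual_simps:
  "carrier (matlis_dual R E M) = mod_hom R M E"
  "x \<in> carrier M \<Longrightarrow> (r \<odot>\<^bsub>matlis_dual R E M\<^esub> f) x = r \<odot>\<^bsub>E\<^esub> f x"
  "x \<in> carrier M \<Longrightarrow> \<zero>\<^bsub>matlis_dual R E M\<^esub> x = \<zero>\<^bsub>E\<^esub>"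
  by (simp_all add: matlis_dual_def hom_module_def)

text \<open>The map \<open>Hom(W\<^sup>-\<^sup>1R, M) \<rightarrow> M\<close>, \<open>f \<mapsto> f 1\<close>, is the Matlis dual of \<open>M\<^sup>\<or> \<rightarrow> W\<^sup>-\<^sup>1M\<^sup>\<or>\<close>.  Hence \<open>x\<close> lies in its image as
  soon as evaluation at \<open>x\<close> kills the \<open>W\<close>-torsion of \<open>M\<^sup>\<or>\<close>, because it then extends to \<open>W\<^sup>-\<^sup>1M\<^sup>\<or>\<close>.\<close>

lemma Inter_subset_trace:
  assumes W: "submonoid W R" and inj: "injective_module R E" and dual: "matlis_dualizable R E M"
  shows "(\<Inter>w\<in>W. (\<lambda>x. w \<odot>\<^bsub>M\<^esub> x) ` carrier M) \<subseteq> trace R (loc_regular R W) M"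
proof
  let ?D = "matlis_dual R E M" and ?\<beta> = "bidual_map R E M"
  have M: "module R M" using dual by (simp add: matlis_dualizable_def)
  have E: "module R E" using inj by (simp add: injective_module_def)
  have D: "module R ?D" unfolding matlis_dual_def by (rule hom_module_module[OF M E])
  interpret M: localization R M W by (rule localizationI[OF M W])
  interpret D: localization R ?D W by (rule localizationI[OF D W])
  interpret E: module R E by fact
  interpret LD: module R "loc_module R W ?D" by (rule D.loc_module_module)
  have bij: "bij_betw ?\<beta> (carrier M) (mod_hom R ?D E)"
    using dual by (simp add: matlis_dualizable_def mod_iso_def matlis_dual_simps(1))
  have \<beta>: "?\<beta> a d = d a" if "a \<in> carrier M" "d \<in> carrier ?D" for a d
    using that by (simp add: bidual_map_def)
  \<comment> \<open>Injectivity of the bidual map: elements of \<open>M\<close> may be compared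
    functional by functional.\<close>
  have separated: "a = b" if ab: "a \<in> carrier M" "b \<in> carrier M"
    and eq: "\<And>d. d \<in> carrier ?D \<Longrightarrow> d a = d b" for a b
  proof -
    have "?\<beta> a = ?\<beta> b" using ab eq by (auto simp: bidual_map_def intro!: restrict_ext)
    then show ?thesis using bij ab by (auto simp: bij_betw_def inj_on_def)
  qed
  have Dh: "d a \<in> carrier E" "d (r \<odot>\<^bsub>M\<^esub> a) = r \<odot>\<^bsub>E\<^esub> d a"
    if "d \<in> carrier ?D" "a \<in> carrier M" "r \<in> carrier R" for d a r
    using that by (simp_all add: matlis_dual_simps(1) mod_homD(2,4)[of d R M E])
  fix x assume x: "x \<in> (\<Inter>w\<in>W. (\<lambda>x. w \<odot>\<^bsub>M\<^esub> x) ` carrier M)"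
  \<comment> \<open>The member \<open>\<one>\<close> of \<open>W\<close> places \<open>x\<close> in
    the carrier.\<close>
  have "x \<in> (\<lambda>x. \<one>\<^bsub>R\<^esub> \<odot>\<^bsub>M\<^esub> x) ` carrier M" by (rule INT_D[OF x M.W.one_closed])
  then have xM: "x \<in> carrier M" by auto
  have ev: "(\<lambda>d\<in>carrier ?D. d x) \<in> mod_hom R ?D E"
    using eval_hom[OF M E xM] by (simp add: matlis_dual_def)
  have ker: "(\<lambda>d\<in>carrier ?D. d x) d = \<zero>\<^bsub>E\<^esub>"
    if d: "d \<in> carrier ?D" "loc_map R W ?D d = \<zero>\<^bsub>loc_module R W ?D\<^esub>" for d
  proof -
    obtain w where w: "w \<in> W" "w \<odot>\<^bsub>?D\<^esub> d = \<zero>\<^bsub>?D\<^esub>"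
      using d D.loc_map_eq_zero_iff D.to_W_eq by auto
    obtain z where z: "z \<in> carrier M" "x = w \<odot>\<^bsub>M\<^esub> z" using x w(1) by blast
    have "d x = (w \<odot>\<^bsub>?D\<^esub> d) z" using Dh(2)[OF d(1) z(1)] w(1) z by (simp add: matlis_dual_simps(2))
    then show ?thesis using d(1) w(2) z(1) by (simp add: matlis_dual_simps(3))
  qed
  obtain h where h: "h \<in> mod_hom R (loc_module R W ?D) E"
    "\<And>d. d \<in> carrier ?D \<Longrightarrow> h (loc_map R W ?D d) = (\<lambda>d\<in>carrier ?D. d x) d"
    using injective_factor[OF inj D LD.module_axioms D.loc_map_hom ev ker] by blast
  define \<psi> where "\<psi> = (\<lambda>w. \<lambda>d\<in>carrier ?D. h (D.cl d w))"
  have \<psi>: "\<psi> w \<in> mod_hom R ?D E" if w: "w \<in> W" for w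
  proof (rule mod_homI)
    show "\<psi> w \<in> carrier ?D \<rightarrow>\<^sub>E carrier E"
      using mod_homD(2)[OF h(1)] D.carrierI w by (auto simp: \<psi>_def)
  next
    fix d e assume "d \<in> carrier ?D" "e \<in> carrier ?D"
    then show "\<psi> w (d \<oplus>\<^bsub>?D\<^esub> e) = \<psi> w d \<oplus>\<^bsub>E\<^esub> \<psi> w e"
      using w by (simp add: \<psi>_def D.carrierI flip: mod_homD(3)[OF h(1)] D.add_class_same)
  next
    fix r d assume "r \<in> carrier R" "d \<in> carrier ?D"
    then show "\<psi> w (r \<odot>\<^bsub>?D\<^esub> d) = r \<odot>\<^bsub>E\<^esub> \<psi> w d"
      using w by (simp add: \<psi>_def D.carrierI flip: mod_homD(4)[OF h(1)] D.smult_class)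
  qed
  \<comment> \<open>Surjectivity of the bidual map represents the functional \<open>\<psi> w\<close>
    as evaluation at an element of \<open>M\<close>.\<close>
  define y where "y = (\<lambda>w. inv_into (carrier M) ?\<beta> (\<psi> w))"
  have y: "y w \<in> carrier M" "\<And>d. d \<in> carrier ?D \<Longrightarrow> d (y w) = h (D.cl d w)" if w: "w \<in> W" for w
  proof -
    show yM: "y w \<in> carrier M"
      using bij \<psi>[OF w] by (auto simp: y_def bij_betw_def intro!: inv_into_into)
    have "?\<beta> (y w) = \<psi> w"
      using bij \<psi>[OF w] by (auto simp: y_def bij_betw_def intro!: f_inv_into_f)
    then show "d (y w) = h (D.cl d w)" if "d \<in> carrier ?D" for d
      using \<beta>[OF yM that] that by (simp add: \<psi>_def)
  qed
  have "v \<odot>\<^bsub>M\<^esub> y (w \<otimes>\<^bsub>R\<^esub> v) = y w" if wv: "w \<in> W" "v \<in> W" for w v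
  proof (rule separated)
    fix d assume d: "d \<in> carrier ?D"
    \<comment> \<open>Coherence, tested on \<open>d\<close>, is the cancellation of \<open>v\<close>
      in the fraction \<open>(v d)/(w v)\<close>.\<close>
    have "d (v \<odot>\<^bsub>M\<^esub> y (w \<otimes>\<^bsub>R\<^esub> v)) = v \<odot>\<^bsub>E\<^esub> h (D.cl d (w \<otimes>\<^bsub>R\<^esub> v))"
      using d wv Dh(2)[OF d] y by simp
    also have "\<dots> = h (D.cl (v \<odot>\<^bsub>?D\<^esub> d) (w \<otimes>\<^bsub>R\<^esub> v))"
      using d wv D.carrierI by (simp flip: mod_homD(4)[OF h(1)] add: D.smult_class)
    also have "\<dots> = d (y w)" using d wv y D.class_cancel by simp
    finally show "d (v \<odot>\<^bsub>M\<^esub> y (w \<otimes>\<^bsub>R\<^esub> v)) = d (y w)" .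
  qed (use wv y in auto)
  then have "y \<in> coherent_families R W M" using y by (simp add: coherent_families_def)
  moreover have "x = y \<one>\<^bsub>R\<^esub>"
  proof (rule separated)
    fix d assume d: "d \<in> carrier ?D"
    then show "d x = d (y \<one>\<^bsub>R\<^esub>)" using h(2)[OF d] y(2)[OF M.W.one_closed d] by (simp add: loc_map_def)
  qed (use xM y in auto)
  ultimately show "x \<in> trace R (loc_regular R W) M"
    unfolding M.trace_loc_regular_eq by blast
qed

text \<open>The dual of the quotient map has as image the functionals on the dual of
  \<open>M\<close> that factor through the quotient, that is, those vanishing on the selected
  submodule. For evaluation at \<open>x\<close> this vanishing is the stated condition.\<close>

lemma smile_dual_eq:
  assumes inj: "injective_module R E" and M: "module R M"
    and \<alpha>: "submodule (\<alpha> (matlis_dual R E M)) R (matlis_dual R E M)"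
  shows "smile_dual R E \<alpha> M = {x \<in> carrier M. \<forall>f\<in>\<alpha> (matlis_dual R E M). f x = \<zero>\<^bsub>E\<^esub>}"
proof -
  let ?D = "matlis_dual R E M"
  let ?A = "\<alpha> ?D" and ?Q = "quot_module ?D (\<alpha> ?D)"
  let ?\<pi> = "quot_map ?D ?A"
  have E: "module R E" using inj by (simp add: injective_module_def)
  have D: "module R ?D" unfolding matlis_dual_def by (rule hom_module_module[OF M E])
  have Q: "module R ?Q" by (rule quot_module_module[OF D \<alpha>])
  note q = quot_map_hom[OF D \<alpha>]
  have "bidual_map R E M x \<in> matlis_dual_map R E ?D ?Q ?\<pi> ` carrier (matlis_dual R E ?Q)
      \<longleftrightarrow> (\<forall>f\<in>?A. f x = \<zero>\<^bsub>E\<^esub>)" if x: "x \<in> carrier M" for x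
  proof
    assume "bidual_map R E M x \<in> matlis_dual_map R E ?D ?Q ?\<pi> ` carrier (matlis_dual R E ?Q)"
    then obtain g where g: "g \<in> mod_hom R ?Q E"
      and eq: "bidual_map R E M x = compose (carrier ?D) g ?\<pi>"
      by (auto simp: matlis_dual_map_def matlis_dual_simps(1))
    show "\<forall>f\<in>?A. f x = \<zero>\<^bsub>E\<^esub>"
    proof
      fix f assume f: "f \<in> ?A"
      then have fD: "f \<in> carrier ?D" using module.submoduleE(1)[OF D \<alpha>] by blast
      have "f x = g (?\<pi> f)"
        using fun_cong[OF eq, of f] x fD by (simp add: bidual_map_def compose_eq)
      then show "f x = \<zero>\<^bsub>E\<^esub>" using q(3)[OF fD] f mod_hom_zero[OF Q E g] by simp
    qed
  next
    assume 0: "\<forall>f\<in>?A. f x = \<zero>\<^bsub>E\<^esub>"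
    have ev: "(\<lambda>d\<in>carrier ?D. d x) \<in> mod_hom R ?D E"
      using eval_hom[OF M E x] by (simp add: matlis_dual_def)
    obtain g where g: "g \<in> mod_hom R ?Q E"
      "\<And>d. d \<in> carrier ?D \<Longrightarrow> g (?\<pi> d) = (\<lambda>d\<in>carrier ?D. d x) d"
      by (rule injective_factor[OF inj D Q q(1) ev]) (use q(3) 0 in auto)
    then have "bidual_map R E M x = compose (carrier ?D) g ?\<pi>"
      using x by (auto simp: bidual_map_def compose_def intro!: restrict_ext)
    then show "bidual_map R E M x \<in> matlis_dual_map R E ?D ?Q ?\<pi> ` carrier (matlis_dual R E ?Q)"
      using g(1) by (auto simp: matlis_dual_map_def matlis_dual_simps(1))
  qed
  then show ?thesis unfolding smile_dual_def Let_def by blast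
qed

text \<open>These functionals form a divisible submodule, so they lie in the largest one. Dividing
  \<open>f\<close> by \<open>w\<close> must stay among functionals that kill the torsion, which is
  why the quotient is constructed on \<open>M\<close> modulo torsion.\<close>

lemma torsion_annihilator_subset_div_W:
  assumes W: "submonoid W R" and inj: "injective_module R E" and M: "module R M"
  shows "{f \<in> mod_hom R M E. \<forall>t\<in>to_W R W M. f t = \<zero>\<^bsub>E\<^esub>} \<subseteq> div_W R W (matlis_dual R E M)"
proof -
  let ?D = "matlis_dual R E M"
  let ?T = "to_W R W M" and ?F = "{f \<in> mod_hom R M E. \<forall>t\<in>to_W R W M. f t = \<zero>\<^bsub>E\<^esub>}"
  have E: "module R E" using inj by (simp add: injective_module_def)
  have D: "module R ?D" unfolding matlis_dual_def by (rule hom_module_module[OF M E])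
  interpret M: localization R M W by (rule localizationI[OF M W])
  interpret D: localization R ?D W by (rule localizationI[OF D W])
  interpret E: module R E by fact
  note T = M.to_W_submodule
  have TM: "t \<in> carrier M" if "t \<in> ?T" for t using that M.M.submoduleE(1)[OF T] by blast
  note Q = quot_module_module[OF M T] and q = quot_map_hom[OF M T]
  show ?thesis
  proof (rule D.div_W_greatest)
    show "submodule ?F R ?D"
    proof (rule D.M.submodule_criterion)
      show "?F \<subseteq> carrier ?D" by (auto simp: matlis_dual_simps(1))
      show "\<zero>\<^bsub>?D\<^esub> \<in> ?F"
        using D.M.M.zero_closed TM by (auto simp: matlis_dual_simps)
      fix f assume f: "f \<in> ?F"
      { fix g assume g: "g \<in> ?F"
        have "f \<oplus>\<^bsub>?D\<^esub> g \<in> carrier ?D" 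
          using f g by (intro D.M.M.a_closed) (simp_all add: matlis_dual_simps(1))
        then show "f \<oplus>\<^bsub>?D\<^esub> g \<in> ?F"
          using f g TM by (auto simp: matlis_dual_def hom_module_def) }
      { fix r assume r: "r \<in> carrier R"
        have "r \<odot>\<^bsub>?D\<^esub> f \<in> carrier ?D" 
          using f r by (intro D.M.smult_closed) (simp_all add: matlis_dual_simps(1))
        then show "r \<odot>\<^bsub>?D\<^esub> f \<in> ?F" using f r TM by (auto simp: matlis_dual_simps) }
    qed
    fix w assume w: "w \<in> W"
    show "?F \<subseteq> (\<lambda>f. w \<odot>\<^bsub>?D\<^esub> f) ` ?F"
    proof
      fix f assume f: "f \<in> ?F"
      \<comment> \<open>Multiplication by \<open>w\<close> followed by the quotient map. By
        saturation its kernel is torsion, where \<open>f\<close> vanishes, so \<open>f\<close>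
        factors as \<open>h\<close> after \<open>?a\<close>; pulling \<open>h\<close> back to
        \<open>M\<close> gives the quotient of \<open>f\<close> by \<open>w\<close>.\<close>
      let ?a = "\<lambda>x\<in>carrier M. quot_map M ?T (w \<odot>\<^bsub>M\<^esub> x)"
      have a: "?a \<in> mod_hom R M (quot_module M ?T)"
      proof (rule mod_homI)
        show "?a \<in> carrier M \<rightarrow>\<^sub>E carrier (quot_module M ?T)"
          using mod_homD(2)[OF q(1)] w by auto
      next
        fix x z assume "x \<in> carrier M" "z \<in> carrier M"
        then show "?a (x \<oplus>\<^bsub>M\<^esub> z) = ?a x \<oplus>\<^bsub>quot_module M ?T\<^esub> ?a z"
          using w by (simp add: M.M.smult_r_distr mod_homD(3)[OF q(1)])
      next
        fix r x assume "r \<in> carrier R" "x \<in> carrier M"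
        moreover from this have "w \<odot>\<^bsub>M\<^esub> (r \<odot>\<^bsub>M\<^esub> x) = r \<odot>\<^bsub>M\<^esub> (w \<odot>\<^bsub>M\<^esub> x)"
          using w by (simp add: M.sm M.M.R.m_comm)
        ultimately show "?a (r \<odot>\<^bsub>M\<^esub> x) = r \<odot>\<^bsub>quot_module M ?T\<^esub> ?a x"
          using w by (simp add: mod_homD(4)[OF q(1)])
      qed
      have "f x = \<zero>\<^bsub>E\<^esub>" if x: "x \<in> carrier M" "?a x = \<zero>\<^bsub>quot_module M ?T\<^esub>" for x
        using f M.to_W_saturated[OF x(1) w] q(3)[of "w \<odot>\<^bsub>M\<^esub> x"] x w by auto
      then obtain h where h: "h \<in> mod_hom R (quot_module M ?T) E" "\<And>x. x \<in> carrier M \<Longrightarrow> h (?a x) = f x"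
        using injective_factor[OF inj M Q a, of f] f by blast
      let ?g = "compose (carrier M) h (quot_map M ?T)"
      have gh: "?g \<in> mod_hom R M E" by (rule mod_hom_compose[OF M q(1) h(1)])
      have "?g t = \<zero>\<^bsub>E\<^esub>" if "t \<in> ?T" for t
        using that TM[OF that] q(3)[OF TM[OF that]] mod_hom_zero[OF Q E h(1)] by (simp add: compose_eq)
      then have g: "?g \<in> ?F" using gh by blast
      have "f = w \<odot>\<^bsub>?D\<^esub> ?g"
      proof (rule extensionalityI[of _ "carrier M"])
        show "f \<in> extensional (carrier M)" using f mod_homD(1)[of f R M E] by (auto simp: PiE_def)
        show "w \<odot>\<^bsub>?D\<^esub> ?g \<in> extensional (carrier M)" by (simp add: matlis_dual_def hom_module_def)
        fix x assume x: "x \<in> carrier M"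
        have "?g (w \<odot>\<^bsub>M\<^esub> x) = f x" using h(2)[OF x] x w by (simp add: compose_eq)
        then show "f x = (w \<odot>\<^bsub>?D\<^esub> ?g) x"
          using mod_homD(4)[OF gh, of w x] x w by (simp add: matlis_dual_simps(2))
      qed
      then show "f \<in> (\<lambda>f. w \<odot>\<^bsub>?D\<^esub> f) ` ?F" using g by blast
    qed
  qed
qed

text \<open>If \<open>w x = 0\<close> and \<open>f = w g\<close>, then
  \<open>f x = g (w x) = 0\<close>. For \<open>x\<close> outside the torsion, the cogenerator
  property on \<open>M\<close> modulo torsion supplies a functional nonzero at the class of
  \<open>x\<close>, and its pullback lies in \<open>div_W\<close> of the dual.\<close>

lemma to_W_eq_smile_dual:
  assumes W: "submonoid W R" and loc: "local_ring R"
    and hull: "injective_hull R (residue_module R) E" and M: "module R M"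
  shows "to_W R W M = smile_dual R E (div_W R W) M"
proof -
  let ?D = "matlis_dual R E M" and ?T = "to_W R W M"
  have inj: "injective_module R E" using hull by (simp add: injective_hull_def)
  have E: "module R E" using inj by (simp add: injective_module_def)
  have D: "module R ?D" unfolding matlis_dual_def by (rule hom_module_module[OF M E])
  interpret M: localization R M W by (rule localizationI[OF M W])
  interpret D: localization R ?D W by (rule localizationI[OF D W])
  interpret E: module R E by fact
  note T = M.to_W_submodule
  note Q = quot_module_module[OF M T] and q = quot_map_hom[OF M T]
  have "f x = \<zero>\<^bsub>E\<^esub>" if x: "x \<in> ?T" and f: "f \<in> div_W R W ?D" for x f
  proof -
    obtain w where w: "x \<in> carrier M" "w \<in> W" "w \<odot>\<^bsub>M\<^esub> x = \<zero>\<^bsub>M\<^esub>"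
      using x by (auto simp: M.to_W_eq)
    obtain g where g: "g \<in> mod_hom R M E" "f = w \<odot>\<^bsub>?D\<^esub> g"
      using D.div_W_subset f w(2) by (auto simp: matlis_dual_simps(1))
    then show ?thesis
      using mod_homD(4)[OF g(1), of w x] w mod_hom_zero[OF M E g(1)] by (simp add: matlis_dual_simps(2))
  qed
  moreover have "x \<in> ?T" if x: "x \<in> carrier M" and 0: "\<forall>f\<in>div_W R W ?D. f x = \<zero>\<^bsub>E\<^esub>" for x
  proof (rule ccontr)
    assume "x \<notin> ?T"
    then obtain h where h: "h \<in> mod_hom R (quot_module M ?T) E" "h (quot_map M ?T x) \<noteq> \<zero>\<^bsub>E\<^esub>"
      using injective_hull_cogenerator[OF loc hull Q mod_homD(2)[OF q(1) x]] q(3)[OF x] by blast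
    let ?g = "compose (carrier M) h (quot_map M ?T)"
    have "?g t = \<zero>\<^bsub>E\<^esub>" if t: "t \<in> ?T" for t
    proof -
      have tM: "t \<in> carrier M" using M.M.submoduleE(1)[OF T] t by blast
      then show ?thesis using t q(3)[OF tM] mod_hom_zero[OF Q E h(1)] by (simp add: compose_eq)
    qed
    then have "?g \<in> div_W R W ?D"
      using torsion_annihilator_subset_div_W[OF W inj M] mod_hom_compose[OF M q(1) h(1)] by blast
    then show False using 0 h(2) x by (auto simp: compose_eq)
  qed
  ultimately show ?thesis
    unfolding smile_dual_eq[where \<alpha> = "div_W R W", OF inj M D.div_W_submodule] using M.M.submoduleE(1)[OF T] by blast
qed

theorem proposition9p3:
  fixes R :: "('r, 'x) ring_scheme" and W :: "'r set"
  assumes "cring R" and "submonoid W R"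
  shows
    \<comment> \<open>(1)\<close>
    "(\<forall>M :: ('r, 'm) module. module R M \<longrightarrow>
        (W_torsion_free W M \<longleftrightarrow> to_W R W M = {\<zero>\<^bsub>M\<^esub>})) \<and>
    \<comment> \<open>(2)\<close>
     (\<forall>M :: ('r, 'm) module. module R M \<longrightarrow>
        (W_divisible W M \<longleftrightarrow> div_W R W M = carrier M)) \<and>
    \<comment> \<open>(3)\<close>
     (\<forall>M :: ('r, 'm) module. module R M \<longrightarrow>
        (h_divisible R W M \<longleftrightarrow> trace R (loc_regular R W) M = carrier M)) \<and>
    \<comment> \<open>(4)\<close>
     (\<forall>M :: ('r, 'm) module. module R M \<longrightarrow>
        trace R (loc_regular R W) M \<subseteq> div_W R W M) \<and>
    \<comment> \<open>(5)\<close>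
     (\<forall>M :: ('r, 'm) module. module R M \<longrightarrow>
        to_W R W M = selector_lim W (cyclic_trace R) M) \<and>
    \<comment> \<open>(6)\<close>
     (submodule_selector R (div_W R W :: ('r, 'm) module \<Rightarrow> _) (div_W R W :: ('r, 'n) module \<Rightarrow> _) \<and>
      idempotent_selector R (div_W R W :: ('r, 'm) module \<Rightarrow> _) \<and>
      functorial_selector R (div_W R W :: ('r, 'm) module \<Rightarrow> _) (div_W R W :: ('r, 'n) module \<Rightarrow> _)) \<and>
    \<comment> \<open>(7)\<close>
     (submodule_selector R (to_W R W :: ('r, 'm) module \<Rightarrow> _) (to_W R W :: ('r, 'n) module \<Rightarrow> _) \<and>
      idempotent_selector R (to_W R W :: ('r, 'm) module \<Rightarrow> _) \<and>
      functorial_selector R (to_W R W :: ('r, 'm) module \<Rightarrow> _) (to_W R W :: ('r, 'n) module \<Rightarrow> _) \<and>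
      co_idempotent_selector R (to_W R W :: ('r, 'm) module \<Rightarrow> _) (to_W R W)) \<and>
    \<comment> \<open>(8)\<close>
     (\<forall>(E :: ('r, 'e) module) (M :: ('r, 'm) module).
        complete_local_noetherian R \<longrightarrow> injective_hull R (residue_module R) E \<longrightarrow>
        matlis_dualizable R E M \<longrightarrow>
        div_W R W M = trace R (loc_regular R W) M) \<and>
    \<comment> \<open>(9)\<close>
     (\<forall>(E :: ('r, 'e) module) (M :: ('r, 'm) module).
        complete_local_noetherian R \<longrightarrow> injective_hull R (residue_module R) E \<longrightarrow>
        matlis_dualizable R E M \<longrightarrow>
        to_W R W M = smile_dual R E (div_W R W) M) \<and>
    \<comment> \<open>(10)\<close>
     (\<forall>(E :: ('r, 'e) module) (M :: ('r, 'm) module).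
        complete_local_noetherian R \<longrightarrow> injective_hull R (residue_module R) E \<longrightarrow>
        matlis_dualizable R E M \<longrightarrow>
        div_W R W M = (\<Inter>w\<in>W. (\<lambda>x. w \<odot>\<^bsub>M\<^esub> x) ` carrier M))"
proof -
  note W = assms(2)
  have WR: "w \<in> carrier R" if "w \<in> W" for w
    using that submonoid.subset[OF W] by blast
  \<comment> \<open>Torsion is the union over \<open>w\<close> of the kernels of multiplication by
    \<open>w\<close>, and each kernel is a cyclic trace.\<close>
  have tors: "to_W R W M = selector_lim W (cyclic_trace R) M" if M: "module R M"
    for M :: "('r, 'm) module"
    using localization.to_W_eq[OF localizationI[OF M W]] cyclic_trace_eq[OF M WR]
    by (auto simp: selector_lim_def)
  \<comment> \<open>The trace lies in \<open>div_W\<close>, which lies in the intersection, which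
    lies in the trace; this cycle gives both equalities.\<close>
  have dual: "div_W R W M = trace R (loc_regular R W) M \<and>
      div_W R W M = (\<Inter>w\<in>W. (\<lambda>x. w \<odot>\<^bsub>M\<^esub> x) ` carrier M)"
    if E: "injective_hull R (residue_module R) E" and M: "matlis_dualizable R E M"
    for E :: "('r, 'e) module" and M :: "('r, 'm) module"
  proof -
    interpret M: localization R M W
      using M W by (auto simp: matlis_dualizable_def intro: localizationI)
    have "injective_module R E" using E by (simp add: injective_hull_def)
    then show ?thesis
      using Inter_subset_trace[OF W _ M] M.trace_subset_div_W M.div_W_subset by blast
  qed
  have smile: "to_W R W M = smile_dual R E (div_W R W) M"
    if "complete_local_noetherian R" "injective_hull R (residue_module R) E" "matlis_dualizable R E M"
    for E :: "('r, 'e) module" and M :: "('r, 'm) module"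
    using that
    by (intro to_W_eq_smile_dual[OF W]) (auto simp: complete_local_noetherian_def matlis_dualizable_def)
  note loc = localizationI[OF _ W]
  have sel: "submodule_selector R (div_W R W :: ('r, 'm) module \<Rightarrow> _) (div_W R W :: ('r, 'n) module \<Rightarrow> _)"
    "submodule_selector R (to_W R W :: ('r, 'm) module \<Rightarrow> _) (to_W R W :: ('r, 'n) module \<Rightarrow> _)"
    by (intro submodule_selectorI localization.div_W_submodule localization.to_W_submodule loc
        div_W_functorial to_W_functorial W; assumption)+
  show ?thesis
    by (intro conjI allI impI;
        rule localization.W_torsion_free_iff[OF loc] localization.W_divisible_iff[OF loc]
          localization.h_divisible_iff[OF loc] localization.trace_subset_div_W[OF loc] tors sel
          div_W_functorial[OF W] to_W_functorial[OF W] div_W_idempotent[OF W] to_W_idempotent[OF W]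
          to_W_co_idempotent[OF W] dual[THEN conjunct1] dual[THEN conjunct2] smile;
        assumption)
qed

end
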